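(* Let $n\ge3$ and, for $1\le k\le n-1$, let $K_k=S(U(k)\times U(n-k))\subset SU(n)$. For any $k=1,\ldots,n-2$ we have $$K_k\cap K_{n-1}\simeq S(U(k)\times U(n-k-1)\times U(1))\simeq U(k)\times U(n-k-1).$$ Furthermore $K_k/(K_k\cap K_{n-1})$ is Poisson diffeomorphic to the standard Poisson $\mathbb P^{n-k-1}\mathbb C$ and projects onto $X_k$ via $p$, where $p:SU(n)\to\mathbb P^{n-1}\mathbb C$ sends a matrix $A$ to the class $[A^{(n)}]$ of its last column, and $X_k=\{[Z_1:\cdots:Z_n]: Z_1=\cdots=Z_k=0\}\subset\mathbb P^{n-1}\mathbb C$.
   Context: $SU(n)$ carries the standard Poisson--Lie structure $\pi(g)=L_gr-R_gr$ (up to a constant factor), where $L_g,R_g$ are left and right translations, $r=\sum_{1\le i<j\le n}X^+_{ij}\wedge X^-_{ij}$, $X^+_{ij}=\sqrt{-1}\,(e_{ij}+e_{ji})$, $X^-_{ij}=e_{ij}-e_{ji}$, and $e_{ij}$ are matrix units. $K_k$ is the block-diagonal subgroup of matrices $\begin{pmatrix}A&0\\0&B\end{pmatrix}$ of determinant one with $A\in U(k)$, $B\in U(n-k)$; it is a Poisson--Lie subgroup of $SU(n)$ (a Lie subgroup that is a Poisson submanifold). Quotients of Poisson--Lie groups by closed Poisson--Lie (or coisotropic) subgroups carry the Poisson structure projected from the group. The standard Poisson $\mathbb P^{d-1}\mathbb C$ is the quotient $SU(d)/S(U(d-1)\times U(1))$ of the standard Poisson--Lie group $SU(d)$, with $S(U(d-1)\times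 U(1))$ embedded block-diagonally; a coset $[A]$ corresponds to the class of the last column of $A$. "Projects onto $X_k$ via $p$" means that the map $[A]\mapsto p(A)$ on $K_k/(K_k\cap K_{n-1})$ has image $X_k$. *)

theory Defs
  imports
    "HOL-Analysis.Abstract_Metric_Spaces"
    "HOL-Analysis.L2_Norm"
    "HOL-Algebra.Left_Coset"
    "Jordan_Normal_Form.Schur_Decomposition"
begin

section \<open>The real vector space of complex matrices\<close>

text \<open>
  Square matrices of size \<open>n\<close> are regarded as a real vector space of dimension \<open>2 * n^2\<close>
  with the Frobenius norm. All indices start at 0.
\<close>

definition mat_norm :: "nat \<Rightarrow> complex mat \<Rightarrow> real" where
  "mat_norm n A = L2_set (\<lambda>ij. cmod (A $$ ij)) ({..<n} \<times> {..<n})"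

definition mat_dist :: "nat \<Rightarrow> complex mat \<Rightarrow> complex mat \<Rightarrow> real" where
  "mat_dist n A B = L2_set (\<lambda>ij. cmod (A $$ ij - B $$ ij)) ({..<n} \<times> {..<n})"

definition mat_topology :: "nat \<Rightarrow> complex mat topology" where
  "mat_topology n = Metric_space.mtopology (carrier_mat n n) (mat_dist n)"

lemma mat_dist_eq_norm:
  assumes "A \<in> carrier_mat n n" "B \<in> carrier_mat n n"
  shows "mat_dist n A B = mat_norm n (A - B)"
  unfolding mat_dist_def mat_norm_def
  by (rule L2_set_cong) (use assms in auto)

lemma Metric_space_mat: "Metric_space (carrier_mat n n) (mat_dist n)"
proof
  fix A B C :: "complex mat"
  let ?I = "{..<n} \<times> {..<n}"
  show "0 \<le> mat_dist n A B"
    by (simp add: mat_dist_def)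
  show "mat_dist n A B = mat_dist n B A"
    by (simp add: mat_dist_def norm_minus_commute)
  show "mat_dist n A B = 0 \<longleftrightarrow> A = B"
    if "A \<in> carrier_mat n n" "B \<in> carrier_mat n n"
    using that by (auto simp: mat_dist_def L2_set_eq_0_iff)
  have "mat_dist n A C \<le>
      L2_set (\<lambda>ij. cmod (A $$ ij - B $$ ij) + cmod (B $$ ij - C $$ ij)) ?I"
    unfolding mat_dist_def
  proof (rule L2_set_mono)
    fix ij
    show "cmod (A $$ ij - C $$ ij) \<le> cmod (A $$ ij - B $$ ij) + cmod (B $$ ij - C $$ ij)"
      using norm_triangle_ineq[of "A $$ ij - B $$ ij" "B $$ ij - C $$ ij"] by simp
  qed simp
  also have "\<dots> \<le> mat_dist n A B + mat_dist n B C"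
    unfolding mat_dist_def by (rule L2_set_triangle_ineq)
  finally show "mat_dist n A C \<le> mat_dist n A B + mat_dist n B C" .
qed

definition real_linear :: "nat \<Rightarrow> (complex mat \<Rightarrow> real) \<Rightarrow> bool" where
  "real_linear n L \<longleftrightarrow>
     (\<forall>X \<in> carrier_mat n n. \<forall>Y \<in> carrier_mat n n. L (X + Y) = L X + L Y) \<and>
     (\<forall>X \<in> carrier_mat n n. \<forall>c. L (of_real c \<cdot>\<^sub>m X) = c * L X)"

text \<open>\<open>L\<close> is the (Frechet) differential at the point \<open>A\<close> of the real-valued function \<open>F\<close>.\<close>

definition has_differential ::
    "nat \<Rightarrow> (complex mat \<Rightarrow> real) \<Rightarrow> complex mat \<Rightarrow> (complex mat \<Rightarrow> real) \<Rightarrow> bool" where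
  "has_differential n F A L \<longleftrightarrow> real_linear n L \<and>
     (\<forall>\<epsilon>>0. \<exists>\<delta>>0. \<forall>H \<in> carrier_mat n n.
        mat_norm n H < \<delta> \<longrightarrow> \<bar>F (A + H) - F A - L H\<bar> \<le> \<epsilon> * mat_norm n H)"

text \<open>
  \<open>smooth_on n W F\<close>: the function \<open>F\<close> is infinitely differentiable on \<open>W\<close>, i.e. it is
  differentiable at each point of \<open>W\<close> and all its directional derivatives are again infinitely
  differentiable on \<open>W\<close>. It is only used for open \<open>W\<close>.
\<close>

coinductive smooth_on :: "nat \<Rightarrow> complex mat set \<Rightarrow> (complex mat \<Rightarrow> real) \<Rightarrow> bool"
  for n W where
  "\<lbrakk>\<And>A. A \<in> W \<Longrightarrow> has_differential n F A (DF A);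
    \<And>X. X \<in> carrier_mat n n \<Longrightarrow> smooth_on n W (\<lambda>A. DF A X)\<rbrakk>
   \<Longrightarrow> smooth_on n W F"


section \<open>Manifolds and Poisson manifolds\<close>

text \<open>
  A manifold is represented by its topology together with its sheaf of smooth real-valued
  functions; \<open>smooth_fun M U\<close> is the set of functions that are smooth on the open set \<open>U\<close>
  (values outside \<open>U\<close> are irrelevant). A Poisson manifold carries in addition the bracket
  \<open>bracket M U f h\<close> of two functions smooth on \<open>U\<close>, which again is a function on \<open>U\<close>.
\<close>

record 'a smooth_space =
  top_of :: "'a topology"
  smooth_fun :: "'a set \<Rightarrow> ('a \<Rightarrow> real) set"

record 'a poisson_space = "'a smooth_space" +
  bracket :: "'a set \<Rightarrow> ('a \<Rightarrow> real) \<Rightarrow> ('a \<Rightarrow> real) \<Rightarrow> 'a \<Rightarrow> real"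

definition preimage :: "('a, 'm) smooth_space_scheme \<Rightarrow> ('a \<Rightarrow> 'b) \<Rightarrow> 'b set \<Rightarrow> 'a set" where
  "preimage M q V = {x \<in> topspace (top_of M). q x \<in> V}"

definition diffeomorphism ::
    "('a, 'm) smooth_space_scheme \<Rightarrow> ('b, 'n) smooth_space_scheme \<Rightarrow> ('a \<Rightarrow> 'b) \<Rightarrow> bool" where
  "diffeomorphism M N \<phi> \<longleftrightarrow> homeomorphic_map (top_of M) (top_of N) \<phi> \<and>
     (\<forall>V f. openin (top_of N) V \<longrightarrow>
        (f \<in> smooth_fun N V \<longleftrightarrow> f \<circ> \<phi> \<in> smooth_fun M (preimage M \<phi> V)))"

definition poisson_diffeomorphism ::
    "('a, 'm) poisson_space_scheme \<Rightarrow> ('b, 'n) poisson_space_scheme \<Rightarrow> ('a \<Rightarrow> 'b) \<Rightarrow> bool" where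
  "poisson_diffeomorphism M N \<phi> \<longleftrightarrow> diffeomorphism M N \<phi> \<and>
     (\<forall>V. openin (top_of N) V \<longrightarrow>
        (\<forall>f \<in> smooth_fun N V. \<forall>h \<in> smooth_fun N V. \<forall>x \<in> preimage M \<phi> V.
           bracket M (preimage M \<phi> V) (f \<circ> \<phi>) (h \<circ> \<phi>) x = bracket N V f h (\<phi> x)))"

definition poisson_diffeomorphic ::
    "('a, 'm) poisson_space_scheme \<Rightarrow> ('b, 'n) poisson_space_scheme \<Rightarrow> bool" where
  "poisson_diffeomorphic M N \<longleftrightarrow> (\<exists>\<phi>. poisson_diffeomorphism M N \<phi>)"

text \<open>
  The submanifold structure on a set \<open>S\<close> that is embedded by an injection \<open>\<iota>\<close> into the
  \<open>n\<close>-by-\<open>n\<close> matrices: a function is smooth iff locally it is the restriction of a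
  smooth function on an open set of matrices.
\<close>

definition embedded_space :: "nat \<Rightarrow> ('a \<Rightarrow> complex mat) \<Rightarrow> 'a set \<Rightarrow> 'a smooth_space" where
  "embedded_space n \<iota> S =
     \<lparr>top_of = pullback_topology S \<iota> (mat_topology n),
      smooth_fun = (\<lambda>U. {f. \<forall>x \<in> U. \<exists>W F. openin (mat_topology n) W \<and> \<iota> x \<in> W \<and>
         smooth_on n W F \<and> (\<forall>y \<in> U. \<iota> y \<in> W \<longrightarrow> f y = F (\<iota> y))})\<rparr>"

text \<open>
  The quotient of a Poisson manifold along a map \<open>q\<close>: the quotient topology, the functions whose
  pull-back along \<open>q\<close> is smooth, and the projected bracket
  \<open>{f, h} \<circ> q = {f \<circ> q, h \<circ> q}\<close>.
\<close>

definition quotient_top :: "'a topology \<Rightarrow> ('a \<Rightarrow> 'b) \<Rightarrow> 'b topology" where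
  "quotient_top T q =
     topology (\<lambda>V. V \<subseteq> q ` topspace T \<and> openin T {x \<in> topspace T. q x \<in> V})"

lemma openin_quotient_top:
  "openin (quotient_top T q) V \<longleftrightarrow>
     V \<subseteq> q ` topspace T \<and> openin T {x \<in> topspace T. q x \<in> V}"
proof -
  have "istopology (\<lambda>V. V \<subseteq> q ` topspace T \<and> openin T {x \<in> topspace T. q x \<in> V})"
    unfolding istopology_def
  proof (intro conjI allI impI)
    fix V W
    assume V: "V \<subseteq> q ` topspace T \<and> openin T {x \<in> topspace T. q x \<in> V}"
      and W: "W \<subseteq> q ` topspace T \<and> openin T {x \<in> topspace T. q x \<in> W}"
    show "V \<inter> W \<subseteq> q ` topspace T" using V by blast
    have "{x \<in> topspace T. q x \<in> V \<inter> W} =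
        {x \<in> topspace T. q x \<in> V} \<inter> {x \<in> topspace T. q x \<in> W}" by blast
    then show "openin T {x \<in> topspace T. q x \<in> V \<inter> W}" using V W by auto
  next
    fix \<K>
    assume K: "\<forall>V \<in> \<K>. V \<subseteq> q ` topspace T \<and> openin T {x \<in> topspace T. q x \<in> V}"
    show "\<Union>\<K> \<subseteq> q ` topspace T" using K by blast
    have "{x \<in> topspace T. q x \<in> \<Union>\<K>} = \<Union>((\<lambda>V. {x \<in> topspace T. q x \<in> V}) ` \<K>)"
      by blast
    then show "openin T {x \<in> topspace T. q x \<in> \<Union>\<K>}" using K by auto
  qed
  then show ?thesis by (simp add: quotient_top_def topology_inverse')
qed

definition quotient_poisson :: "('a, 'm) poisson_space_scheme \<Rightarrow> ('a \<Rightarrow> 'b) \<Rightarrow> 'b poisson_space"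
  where
  "quotient_poisson M q =
     \<lparr>top_of = quotient_top (top_of M) q,
      smooth_fun = (\<lambda>V. {f. f \<circ> q \<in> smooth_fun M (preimage M q V)}),
      bracket = (\<lambda>V f h y. THE c. \<forall>x \<in> preimage M q {y}.
         bracket M (preimage M q V) (f \<circ> q) (h \<circ> q) x = c)\<rparr>"


section \<open>Matrix Lie groups\<close>

text \<open>
  A group with an embedding into the \<open>edim\<close>-by-\<open>edim\<close> matrices, which determines its manifold
  structure.
\<close>

record 'a lie_group = "'a monoid" +
  edim :: nat
  emb :: "'a \<Rightarrow> complex mat"

definition manifold_of :: "('a, 'm) lie_group_scheme \<Rightarrow> 'a smooth_space" where
  "manifold_of G = embedded_space (edim G) (emb G) (carrier G)"

definition mat_lie_group :: "nat \<Rightarrow> complex mat set \<Rightarrow> complex mat lie_group" where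
  "mat_lie_group n S =
     \<lparr>carrier = S, monoid.mult = (*), one = 1\<^sub>m n, edim = n, emb = (\<lambda>A. A)\<rparr>"

text \<open>
  The underlying group is \<open>G \<times>\<times> H\<close>. The product manifold structure is that of the product
  of the two matrix spaces, which is identified with the space of block-diagonal matrices.
\<close>

definition lie_prod ::
    "('a, 'm) lie_group_scheme \<Rightarrow> ('b, 'n) lie_group_scheme \<Rightarrow> ('a \<times> 'b) lie_group" where
  "lie_prod G H =
     \<lparr>carrier = carrier (G \<times>\<times> H), monoid.mult = monoid.mult (G \<times>\<times> H), one = one (G \<times>\<times> H),
      edim = edim G + edim H, emb = (\<lambda>(a, b). diag_block_mat [emb G a, emb H b])\<rparr>"

definition lie_isomorphic ::
    "('a, 'm) lie_group_scheme \<Rightarrow> ('b, 'n) lie_group_scheme \<Rightarrow> bool" where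
  "lie_isomorphic G H \<longleftrightarrow>
     (\<exists>\<phi>. \<phi> \<in> iso G H \<and> diffeomorphism (manifold_of G) (manifold_of H) \<phi>)"

definition U_set :: "nat \<Rightarrow> complex mat set" where
  "U_set d = {A \<in> carrier_mat d d. mat_adjoint A * A = 1\<^sub>m d}"

definition SU_set :: "nat \<Rightarrow> complex mat set" where
  "SU_set d = {A \<in> U_set d. det A = 1}"

text \<open>\<open>S_block [d1, ..., dr]\<close> is the group \<open>S(U(d1) \<times> ... \<times> U(dr))\<close>, embedded
  block-diagonally.\<close>

definition S_block :: "nat list \<Rightarrow> complex mat set" where
  "S_block ds = {diag_block_mat As | As.
     list_all2 (\<lambda>d A. A \<in> U_set d) ds As \<and> det (diag_block_mat As) = 1}"

definition K_set :: "nat \<Rightarrow> nat \<Rightarrow> complex mat set" where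
  "K_set n k = S_block [k, n - k]"


section \<open>The standard Poisson structure on \<open>SU(n)\<close> and on its quotients\<close>

definition e_mat :: "nat \<Rightarrow> nat \<Rightarrow> nat \<Rightarrow> complex mat" where
  "e_mat n i j = mat n n (\<lambda>(a, b). if a = i \<and> b = j then 1 else 0)"

definition X_plus :: "nat \<Rightarrow> nat \<Rightarrow> nat \<Rightarrow> complex mat" where
  "X_plus n i j = \<i> \<cdot>\<^sub>m (e_mat n i j + e_mat n j i)"

definition X_minus :: "nat \<Rightarrow> nat \<Rightarrow> nat \<Rightarrow> complex mat" where
  "X_minus n i j = e_mat n i j - e_mat n j i"

text \<open>The pairing of the bivector \<open>X \<and> Y\<close> with two covectors.\<close>

definition wedge ::
    "complex mat \<Rightarrow> complex mat \<Rightarrow> (complex mat \<Rightarrow> real) \<Rightarrow> (complex mat \<Rightarrow> real) \<Rightarrow> real" where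
  "wedge X Y \<alpha> \<beta> = \<alpha> X * \<beta> Y - \<alpha> Y * \<beta> X"

text \<open>The bivector \<open>\<pi>(g) = L\<^sub>g r - R\<^sub>g r\<close>, paired with two covectors at \<open>g\<close>.\<close>

definition std_bivector ::
    "nat \<Rightarrow> complex mat \<Rightarrow> (complex mat \<Rightarrow> real) \<Rightarrow> (complex mat \<Rightarrow> real) \<Rightarrow> real" where
  "std_bivector n g \<alpha> \<beta> =
     (\<Sum>j<n. \<Sum>i<j. wedge (g * X_plus n i j) (g * X_minus n i j) \<alpha> \<beta>) -
     (\<Sum>j<n. \<Sum>i<j. wedge (X_plus n i j * g) (X_minus n i j * g) \<alpha> \<beta>)"

text \<open>
  The Poisson structure on a Poisson submanifold \<open>S\<close> of \<open>SU(n)\<close> (possibly \<open>SU(n)\<close> itself): since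
  the bivector is tangent to \<open>S\<close>, the bracket at \<open>g\<close> is \<open>\<pi>(g)\<close> evaluated on the differentials
  of arbitrary smooth local extensions of the two functions.
\<close>

definition std_poisson :: "nat \<Rightarrow> complex mat set \<Rightarrow> complex mat poisson_space" where
  "std_poisson n S =
     \<lparr>top_of = top_of (embedded_space n (\<lambda>A. A) S),
      smooth_fun = smooth_fun (embedded_space n (\<lambda>A. A) S),
      bracket = (\<lambda>U f h g. THE c. \<forall>W F H \<alpha> \<beta>.
         openin (mat_topology n) W \<and> g \<in> W \<and> smooth_on n W F \<and> smooth_on n W H \<and>
         (\<forall>x \<in> U \<inter> W. f x = F x \<and> h x = H x) \<and>
         has_differential n F g \<alpha> \<and> has_differential n H g \<beta> \<longrightarrow>
         std_bivector n g \<alpha> \<beta> = c)\<rparr>"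

text \<open>The quotient \<open>S / H\<close> by right translations of a closed subgroup \<open>H\<close> of \<open>S\<close>.\<close>

definition std_homogeneous ::
    "nat \<Rightarrow> complex mat set \<Rightarrow> complex mat set \<Rightarrow> complex mat set poisson_space" where
  "std_homogeneous n S H =
     quotient_poisson (std_poisson n S) (\<lambda>A. A <#\<^bsub>mat_lie_group n S\<^esub> H)"

text \<open>The standard Poisson projective space of complex dimension \<open>m\<close>.\<close>

definition std_projective :: "nat \<Rightarrow> complex mat set poisson_space" where
  "std_projective m = std_homogeneous (m + 1) (SU_set (m + 1)) (S_block [m, 1])"


section \<open>Projective space\<close>

definition proj_class :: "complex vec \<Rightarrow> complex vec set" where
  "proj_class Z = {c \<cdot>\<^sub>v Z | c. c \<noteq> 0}"

definition p_map :: "nat \<Rightarrow> complex mat \<Rightarrow> complex vec set" where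
  "p_map n A = proj_class (col A (n - 1))"

definition X_set :: "nat \<Rightarrow> nat \<Rightarrow> complex vec set set" where
  "X_set n k = {proj_class Z | Z. Z \<in> carrier_vec n \<and> Z \<noteq> 0\<^sub>v n \<and> (\<forall>i<k. Z $ i = 0)}"

end

theory Submission
  imports Defs "HOL-Library.Landau_Symbols"
begin

text \<open>
  Write \<open>m = n - k\<close>. For the second isomorphism, a block-diagonal matrix with blocks \<open>A\<close>, \<open>B\<close>, \<open>c\<close> is
  recovered from \<open>A\<close> and \<open>B\<close> by \<open>c = cnj (det A * det B)\<close>, which is polynomial in the real coordinates.

  The Poisson diffeomorphism is induced by \<open>s : K\<^sub>k \<rightarrow> SU(m)\<close>, \<open>diag (A, B) \<mapsto> B diag (det A, 1, ..., 1)\<close>,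
  with section \<open>B \<mapsto> diag (1, B)\<close>. It preserves the last column of \<open>B\<close>, and on both sides the last
  column up to a scalar determines the coset. Moreover \<open>s\<close> is a Poisson map. The terms of
  the bivector with \<open>i < k \<le> j\<close> cancel at points of \<open>K\<^sub>k\<close>, because they form the Kaehler bivector of
  the off-diagonal block, on which \<open>diag (A, B)\<close> acts by the unitary map \<open>Z \<mapsto> A Z B\<^sup>*\<close>. Those with
  \<open>i < j < k\<close> are killed by \<open>s\<close> since \<open>X\<^sub>i\<^sub>j\<close> has trace 0. Those with \<open>k \<le> i < j\<close> are mapped to the
  corresponding terms for \<open>SU(m)\<close>, since conjugation with a diagonal unitary matrix only rotates the
  plane of \<open>X\<^sup>+\<^sub>i\<^sub>j\<close> and \<open>X\<^sup>-\<^sub>i\<^sub>j\<close>. All differentials are evaluated along curves \<open>g exp (t X)\<close> and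
  \<open>exp (t X) g\<close>. A Householder reflection shows that the projection is onto \<open>X\<^sub>k\<close>.
\<close>

section \<open>Differentials\<close>

text \<open>The main obstacle is that the bracket is a definite description over all local
  extensions of the two functions to matrix space, so its uniqueness must be proved before it can be
  computed. Uniqueness means that the bivector sees covectors only through their values on
  velocities of curves inside the group. At a point of the subgroup the mixed generators are not
  tangent to it, so their terms must cancel for arbitrary ambient covectors and not only for
  pulled-back differentials. The twist by \<open>det A\<close> repairs the determinant of
  \<open>B\<close>; it is put in the first column because that column differs from the last one as
  soon as \<open>m\<close> is at least 2. The map s is not a homomorphism in general, but it carries
  a rotation curve through x to a constant curve or to a rotation curve through s x, possibly with a
  changed phase, and this determines how the generators are mapped. As s is polynomial in the
  entries it is defined on all matrices, so composing a local extension with it gives a local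
  extension of the pullback.\<close>

lemma mat_norm_nonneg [simp]: "0 \<le> mat_norm n A"
  by (simp add: mat_norm_def)

lemma norm_index_le_mat_norm: "i < n \<Longrightarrow> j < n \<Longrightarrow> cmod (A $$ (i, j)) \<le> mat_norm n A"
  unfolding mat_norm_def by (rule member_le_L2_set) auto

lemma mat_norm_le_sum: "mat_norm n A \<le> (\<Sum>ij\<in>{..<n} \<times> {..<n}. cmod (A $$ ij))"
  unfolding mat_norm_def by (rule L2_set_le_sum) simp

lemma mat_norm_add_le:
  assumes "A \<in> carrier_mat n n" "B \<in> carrier_mat n n"
  shows "mat_norm n (A + B) \<le> mat_norm n A + mat_norm n B"
proof -
  have "mat_norm n (A + B) \<le> L2_set (\<lambda>ij. cmod (A $$ ij) + cmod (B $$ ij)) ({..<n} \<times> {..<n})"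
    unfolding mat_norm_def
    by (rule L2_set_mono) (use assms in \<open>auto intro: norm_triangle_ineq\<close>)
  also have "\<dots> \<le> mat_norm n A + mat_norm n B"
    unfolding mat_norm_def by (rule L2_set_triangle_ineq)
  finally show ?thesis .
qed

lemma mat_norm_smult:
  assumes "A \<in> carrier_mat n n"
  shows "mat_norm n (c \<cdot>\<^sub>m A) = cmod c * mat_norm n A"
  unfolding mat_norm_def
  by (subst L2_set_right_distrib) (use assms in \<open>auto intro!: L2_set_cong simp: norm_mult\<close>)

lemma diff_add_diff_cancel: "a - b - d = (a - b - c) + (c - d)" for a b c d :: real
  by simp

text \<open>Small \<open>n\<close>-by-\<open>n\<close> matrices in the Frobenius norm, packaged as a
  filter: the epsilon-delta clause of \<open>has_differential\<close> becomes a little-o statement,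
  and the Landau calculus yields the rules of differentiation.\<close>

definition near_zero :: "nat \<Rightarrow> complex mat filter" where
  "near_zero n = (INF \<delta>\<in>{0<..}. principal {H \<in> carrier_mat n n. mat_norm n H < \<delta>})"

lemma eventually_near_zero:
  "eventually P (near_zero n) \<longleftrightarrow> (\<exists>\<delta>>0. \<forall>H\<in>carrier_mat n n. mat_norm n H < \<delta> \<longrightarrow> P H)"
proof -
  have "eventually P (near_zero n) \<longleftrightarrow>
      (\<exists>\<delta>\<in>{0<..}. eventually P (principal {H \<in> carrier_mat n n. mat_norm n H < \<delta>}))"
    unfolding near_zero_def
  proof (rule eventually_INF_base)
    fix a b :: real assume "a \<in> {0<..}" "b \<in> {0<..}"
    then show "\<exists>x\<in>{0<..}. principal {H \<in> carrier_mat n n. mat_norm n H < x} \<le>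
       inf (principal {H \<in> carrier_mat n n. mat_norm n H < a})
         (principal {H \<in> carrier_mat n n. mat_norm n H < b})"
      by (intro bexI[of _ "min a b"]) auto
  qed auto
  then show ?thesis by (auto simp: eventually_principal)
qed

lemma eventually_near_zero_carrier: "eventually (\<lambda>H. H \<in> carrier_mat n n) (near_zero n)"
  by (auto simp: eventually_near_zero intro: exI[of _ 1])

lemma tendsto_mat_norm_near_zero: "(mat_norm n \<longlongrightarrow> 0) (near_zero n)"
  by (auto simp: tendsto_iff eventually_near_zero)

lemma filterlim_near_zero:
  assumes "eventually (\<lambda>x. K x \<in> carrier_mat n n) F" "((\<lambda>x. mat_norm n (K x)) \<longlongrightarrow> 0) F"
  shows "filterlim K (near_zero n) F"
  unfolding filterlim_iff eventually_near_zero
proof (intro allI impI)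
  fix P assume "\<exists>\<delta>>0. \<forall>H\<in>carrier_mat n n. mat_norm n H < \<delta> \<longrightarrow> P H"
  then obtain \<delta> where \<delta>: "\<delta> > 0" "\<And>H. H \<in> carrier_mat n n \<Longrightarrow> mat_norm n H < \<delta> \<Longrightarrow> P H" by auto
  have "eventually (\<lambda>x. mat_norm n (K x) < \<delta>) F"
    using assms(2) \<delta>(1) by (auto simp: tendsto_iff)
  with assms(1) show "\<forall>\<^sub>F x in F. P (K x)"
    by eventually_elim (use \<delta> in auto)
qed

lemma has_differential_iff_smallo:
  "has_differential n F A L \<longleftrightarrow>
     real_linear n L \<and> (\<lambda>H. F (A + H) - F A - L H) \<in> o[near_zero n](mat_norm n)"
  by (simp add: has_differential_def smallo_def eventually_near_zero)

section \<open>Real-linear functionals in matrix coordinates\<close>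

lemma real_linear_add:
  "real_linear n L \<Longrightarrow> X \<in> carrier_mat n n \<Longrightarrow> Y \<in> carrier_mat n n \<Longrightarrow> L (X + Y) = L X + L Y"
  by (simp add: real_linear_def)

lemma real_linear_scale:
  "real_linear n L \<Longrightarrow> X \<in> carrier_mat n n \<Longrightarrow> L (of_real c \<cdot>\<^sub>m X) = c * L X"
  by (simp add: real_linear_def)

lemma smult_zero_complex_mat: "(X :: complex mat) \<in> carrier_mat n n \<Longrightarrow> 0 \<cdot>\<^sub>m X = 0\<^sub>m n n"
  by auto

lemma real_linear_zero: "real_linear n L \<Longrightarrow> L (0\<^sub>m n n) = 0"
  using real_linear_scale[of n L "0\<^sub>m n n" 0] by (simp add: smult_zero_complex_mat)

lemma e_mat_carrier [simp]: "e_mat n i j \<in> carrier_mat n n"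
  by (simp add: e_mat_def)

lemma e_mat_dim [simp]: "dim_row (e_mat n i j) = n" "dim_col (e_mat n i j) = n"
  by (simp_all add: e_mat_def)

lemma e_mat_index [simp]:
  "a < n \<Longrightarrow> b < n \<Longrightarrow> e_mat n i j $$ (a, b) = (if a = i \<and> b = j then 1 else 0)"
  by (simp add: e_mat_def)

text \<open>An arbitrary finite support allows induction, one entry at a time. A support smaller
  than the whole square returns in \<open>real_linear_conj_skew\<close>, where only an off-diagonal
  block contributes.\<close>

lemma real_linear_supported_expansion:
  assumes L: "real_linear n L" and I: "finite I" "I \<subseteq> {..<n} \<times> {..<n}"
  shows "L (mat n n (\<lambda>ij. if ij \<in> I then f ij else 0)) =
    (\<Sum>(i, j)\<in>I. Re (f (i, j)) * L (e_mat n i j) + Im (f (i, j)) * L (\<i> \<cdot>\<^sub>m e_mat n i j))"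
  using I
proof (induction I rule: finite_induct)
  case empty
  have "mat n n (\<lambda>ij. if ij \<in> {} then f ij else 0) = 0\<^sub>m n n" by auto
  with real_linear_zero[OF L] show ?case by simp
next
  case (insert p I)
  obtain i j where p: "p = (i, j)" by force
  have ij: "i < n" "j < n" using insert p by auto
  let ?M = "\<lambda>I. mat n n (\<lambda>ij. if ij \<in> I then f ij else 0)"
  let ?E = "of_real (Re (f p)) \<cdot>\<^sub>m e_mat n i j + of_real (Im (f p)) \<cdot>\<^sub>m (\<i> \<cdot>\<^sub>m e_mat n i j)"
  have "?M (insert p I) = ?M I + ?E"
    using insert ij by (intro eq_matI) (auto simp: p complex_eq_iff)
  then have "L (?M (insert p I)) = L (?M I) + L ?E"
    using real_linear_add[OF L] by simp
  moreover have "L ?E = Re (f p) * L (e_mat n i j) + Im (f p) * L (\<i> \<cdot>\<^sub>m e_mat n i j)"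
    using real_linear_add[OF L] real_linear_scale[OF L] by simp
  moreover have "L (?M I) = (\<Sum>(i, j)\<in>I. Re (f (i, j)) * L (e_mat n i j) + Im (f (i, j)) * L (\<i> \<cdot>\<^sub>m e_mat n i j))"
    using insert.IH insert.prems by blast
  ultimately show ?case
    by (simp only: sum.insert[OF insert.hyps(1,2)]) (simp only: p prod.case add.commute)
qed

lemma real_linear_expansion:
  assumes L: "real_linear n L" and X: "X \<in> carrier_mat n n"
  shows "L X = (\<Sum>(i, j)\<in>{..<n} \<times> {..<n}.
    Re (X $$ (i, j)) * L (e_mat n i j) + Im (X $$ (i, j)) * L (\<i> \<cdot>\<^sub>m e_mat n i j))"
proof -
  have "X = mat n n (\<lambda>ij. if ij \<in> {..<n} \<times> {..<n} then X $$ ij else 0)"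
    using X by (intro eq_matI) auto
  then show ?thesis
    using real_linear_supported_expansion[OF L, of "{..<n} \<times> {..<n}" "\<lambda>ij. X $$ ij"] by auto
qed

lemma mat_norm_bigo:
  assumes "\<And>i j. i < m \<Longrightarrow> j < m \<Longrightarrow> (\<lambda>x. cmod (K x $$ (i, j))) \<in> O[F](g)"
  shows "(\<lambda>x. mat_norm m (K x)) \<in> O[F](g)"
proof -
  have "(\<lambda>x. \<Sum>ij\<in>{..<m} \<times> {..<m}. cmod (K x $$ ij)) \<in> O[F](g)"
    using assms by (intro big_sum_in_bigo) auto
  then show ?thesis
    by (rule landau_o.big.trans[rotated])
      (auto intro!: bigoI[of _ 1] always_eventually simp: sum_nonneg mat_norm_le_sum)
qed

lemma real_linear_bigo:
  assumes L: "real_linear n L"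
  shows "L \<in> O[near_zero n](mat_norm n)"
proof -
  have "(\<lambda>X. \<Sum>(i, j)\<in>{..<n} \<times> {..<n}.
      Re (X $$ (i, j)) * L (e_mat n i j) + Im (X $$ (i, j)) * L (\<i> \<cdot>\<^sub>m e_mat n i j))
      \<in> O[near_zero n](mat_norm n)"
  proof (rule big_sum_in_bigo, clarify)
    fix i j assume ij: "i < n" "j < n"
    have "(\<lambda>X. Re (X $$ (i, j))) \<in> O[near_zero n](mat_norm n)"
      using order_trans[OF abs_Re_le_cmod norm_index_le_mat_norm[OF ij]]
      by (intro bigoI[of _ 1] always_eventually allI) simp
    moreover have "(\<lambda>X. Im (X $$ (i, j))) \<in> O[near_zero n](mat_norm n)"
      using order_trans[OF abs_Im_le_cmod norm_index_le_mat_norm[OF ij]]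
      by (intro bigoI[of _ 1] always_eventually allI) simp
    ultimately show "(\<lambda>X. Re (X $$ (i, j)) * L (e_mat n i j) + Im (X $$ (i, j)) * L (\<i> \<cdot>\<^sub>m e_mat n i j))
      \<in> O[near_zero n](mat_norm n)"
      by (intro sum_in_bigo) simp_all
  qed
  moreover have "eventually (\<lambda>X. L X = (\<Sum>(i, j)\<in>{..<n} \<times> {..<n}.
      Re (X $$ (i, j)) * L (e_mat n i j) + Im (X $$ (i, j)) * L (\<i> \<cdot>\<^sub>m e_mat n i j))) (near_zero n)"
    using eventually_near_zero_carrier by eventually_elim (rule real_linear_expansion[OF L])
  ultimately show ?thesis by (rule landau_o.big.in_cong[THEN iffD2, rotated])
qed

section \<open>Sum, product and chain rules\<close>

lemma has_differential_increment_bigo: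
  assumes "has_differential n F A L"
  shows "(\<lambda>H. F (A + H) - F A) \<in> O[near_zero n](mat_norm n)"
proof -
  have "(\<lambda>H. F (A + H) - F A - L H) \<in> O[near_zero n](mat_norm n)" "L \<in> O[near_zero n](mat_norm n)"
    using assms unfolding has_differential_iff_smallo
    by (auto intro: real_linear_bigo landau_o.small_imp_big)
  from sum_in_bigo(1)[OF this] show ?thesis by simp
qed

lemma has_differential_const: "has_differential n (\<lambda>A. c) A (\<lambda>X. 0)"
  by (simp add: has_differential_iff_smallo real_linear_def)

lemma has_differential_add:
  assumes "has_differential n F A L" "has_differential n G A M"
  shows "has_differential n (\<lambda>A. F A + G A) A (\<lambda>X. L X + M X)"
proof -
  have "(\<lambda>H. (F (A + H) - F A - L H) + (G (A + H) - G A - M H)) \<in> o[near_zero n](mat_norm n)"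
    using assms unfolding has_differential_iff_smallo by (intro sum_in_smallo(1)) simp_all
  moreover have "real_linear n (\<lambda>X. L X + M X)"
    using assms unfolding has_differential_def real_linear_def by (auto simp: algebra_simps)
  ultimately show ?thesis unfolding has_differential_iff_smallo by (simp add: algebra_simps)
qed

text \<open>The increment of the product differs from its linear part by the two remainders,
  weighted by \<open>G A\<close> and \<open>F A\<close>, and by the product of both increments,
  which is quadratic in the norm.\<close>

lemma has_differential_mult:
  assumes F: "has_differential n F A L" and G: "has_differential n G A M"
  shows "has_differential n (\<lambda>A. F A * G A) A (\<lambda>X. F A * M X + L X * G A)"
proof -
  have "(\<lambda>H. (F (A + H) - F A) * (G (A + H) - G A)) \<in> o[near_zero n](mat_norm n)"
  proof -
    have "(\<lambda>H. (F (A + H) - F A) * (G (A + H) - G A)) \<in> O[near_zero n](\<lambda>H. mat_norm n H * mat_norm n H)"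
      using F G by (intro landau_o.big.mult has_differential_increment_bigo)
    moreover have "mat_norm n \<in> o[near_zero n](\<lambda>_. 1)"
      using tendsto_mat_norm_near_zero by (intro smalloI_tendsto) auto
    then have "(\<lambda>H. mat_norm n H * mat_norm n H) \<in> o[near_zero n](mat_norm n)"
      using landau_o.small_big_mult[of "mat_norm n" "near_zero n" "\<lambda>_. 1" "mat_norm n" "mat_norm n"]
      by (simp only: mult_1 landau_o.big_refl)
    ultimately show ?thesis by (rule landau_o.big_small_trans)
  qed
  moreover have "(\<lambda>H. F A * (G (A + H) - G A - M H)) \<in> o[near_zero n](mat_norm n)"
    using G unfolding has_differential_iff_smallo by simp
  moreover have "(\<lambda>H. G A * (F (A + H) - F A - L H)) \<in> o[near_zero n](mat_norm n)"
    using F unfolding has_differential_iff_smallo by simp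
  ultimately have "(\<lambda>H. (F (A + H) - F A) * (G (A + H) - G A) + F A * (G (A + H) - G A - M H)
      + G A * (F (A + H) - F A - L H)) \<in> o[near_zero n](mat_norm n)"
    by (intro sum_in_smallo)
  moreover have "(\<lambda>H. (F (A + H) - F A) * (G (A + H) - G A) + F A * (G (A + H) - G A - M H)
      + G A * (F (A + H) - F A - L H)) =
      (\<lambda>H. F (A + H) * G (A + H) - F A * G A - (F A * M H + L H * G A))"
    by (simp add: fun_eq_iff algebra_simps)
  moreover have "real_linear n (\<lambda>X. F A * M X + L X * G A)"
    using F G unfolding has_differential_def real_linear_def by (simp add: algebra_simps)
  ultimately show ?thesis unfolding has_differential_iff_smallo by simp
qed

text \<open>Differentials exist for real-valued functions only, so a matrix-valued map is controlled
  through the real and imaginary parts of its entries. This permits substituting its increment into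
  the remainder of an outer function, and it also gives continuity.\<close>

lemma has_differential_increment_mat_bigo:
  assumes A: "A \<in> carrier_mat n n"
    and G: "\<And>B. B \<in> carrier_mat n n \<Longrightarrow> G B \<in> carrier_mat m m"
    and R: "\<And>i j. i < m \<Longrightarrow> j < m \<Longrightarrow> has_differential n (\<lambda>B. Re (G B $$ (i, j))) A (LR i j)"
    and I: "\<And>i j. i < m \<Longrightarrow> j < m \<Longrightarrow> has_differential n (\<lambda>B. Im (G B $$ (i, j))) A (LI i j)"
  shows "(\<lambda>H. mat_norm m (G (A + H) - G A)) \<in> O[near_zero n](mat_norm n)"
    and "((\<lambda>H. mat_norm m (G (A + H) - G A)) \<longlongrightarrow> 0) (near_zero n)"
proof -
  define K where "K H = G (A + H) - G A" for H
  have KR: "Re (K H $$ (i, j)) = Re (G (A + H) $$ (i, j)) - Re (G A $$ (i, j))"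
    and KI: "Im (K H $$ (i, j)) = Im (G (A + H) $$ (i, j)) - Im (G A $$ (i, j))"
    if "i < m" "j < m" for i j H
    using that G[OF A] unfolding K_def by auto
  have entry: "(\<lambda>H. cmod (K H $$ (i, j))) \<in> O[near_zero n](mat_norm n)" if ij: "i < m" "j < m" for i j
  proof -
    have "(\<lambda>H. Re (K H $$ (i, j))) \<in> O[near_zero n](mat_norm n)"
         "(\<lambda>H. Im (K H $$ (i, j))) \<in> O[near_zero n](mat_norm n)"
      using has_differential_increment_bigo[OF R[OF ij]] has_differential_increment_bigo[OF I[OF ij]]
        KR[OF ij] KI[OF ij] by simp_all
    then have "(\<lambda>H. \<bar>Re (K H $$ (i, j))\<bar> + \<bar>Im (K H $$ (i, j))\<bar>) \<in> O[near_zero n](mat_norm n)"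
      by (intro sum_in_bigo) simp_all
    then show ?thesis
      by (rule landau_o.big.trans[rotated])
        (auto intro!: bigoI[of _ 1] always_eventually simp: cmod_le)
  qed
  show KO: "(\<lambda>H. mat_norm m (G (A + H) - G A)) \<in> O[near_zero n](mat_norm n)"
    unfolding K_def[symmetric] by (rule mat_norm_bigo) (use entry in simp)
  show "((\<lambda>H. mat_norm m (G (A + H) - G A)) \<longlongrightarrow> 0) (near_zero n)"
  proof -
    have "mat_norm n \<in> o[near_zero n](\<lambda>_. 1)"
      using tendsto_mat_norm_near_zero by (intro smalloI_tendsto) auto
    from landau_o.big_small_trans[OF KO this] show ?thesis
      by (auto dest: smalloD_tendsto)
  qed
qed

text \<open>The remainder is that of \<open>F\<close> at the increment of \<open>G\<close>, plus
  \<open>M\<close> applied to the remainders of the entries of \<open>G\<close>. The differential is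
  expanded over matrix units because such a sum of products stays inside
  \<open>smooth_closure\<close>.\<close>

lemma has_differential_compose:
  assumes A: "A \<in> carrier_mat n n"
    and G: "\<And>B. B \<in> carrier_mat n n \<Longrightarrow> G B \<in> carrier_mat m m"
    and R: "\<And>i j. i < m \<Longrightarrow> j < m \<Longrightarrow> has_differential n (\<lambda>B. Re (G B $$ (i, j))) A (LR i j)"
    and I: "\<And>i j. i < m \<Longrightarrow> j < m \<Longrightarrow> has_differential n (\<lambda>B. Im (G B $$ (i, j))) A (LI i j)"
    and F: "has_differential m F (G A) M"
  shows "has_differential n (\<lambda>B. F (G B)) A
    (\<lambda>X. \<Sum>(i, j)\<in>{..<m} \<times> {..<m}. LR i j X * M (e_mat m i j) + LI i j X * M (\<i> \<cdot>\<^sub>m e_mat m i j))"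
    (is "has_differential n _ A ?D")
proof -
  have M: "real_linear m M" using F by (simp add: has_differential_def)
  define K where "K H = G (A + H) - G A" for H
  have K: "K H \<in> carrier_mat m m" if "H \<in> carrier_mat n n" for H
    using G[of "A + H"] G[of A] A that unfolding K_def by (metis minus_carrier_mat)
  have KR: "Re (K H $$ (i, j)) = Re (G (A + H) $$ (i, j)) - Re (G A $$ (i, j))"
    and KI: "Im (K H $$ (i, j)) = Im (G (A + H) $$ (i, j)) - Im (G A $$ (i, j))"
    if "i < m" "j < m" for i j H
    using that G[OF A] unfolding K_def by auto
  have KO: "(\<lambda>H. mat_norm m (K H)) \<in> O[near_zero n](mat_norm n)"
    and "((\<lambda>H. mat_norm m (K H)) \<longlongrightarrow> 0) (near_zero n)"
    using has_differential_increment_mat_bigo[OF A G R I] by (simp_all add: K_def)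
  then have "filterlim K (near_zero m) (near_zero n)"
    by - (rule filterlim_near_zero, rule eventually_mono[OF eventually_near_zero_carrier K])
  then have "(\<lambda>H. F (G A + K H) - F (G A) - M (K H)) \<in> o[near_zero n](\<lambda>H. mat_norm m (K H))"
    by (rule landau_o.small.compose[OF conjunct2[OF F[unfolded has_differential_iff_smallo]]])
  then have rem1: "(\<lambda>H. F (G A + K H) - F (G A) - M (K H)) \<in> o[near_zero n](mat_norm n)"
    using KO by (rule landau_o.small_big_trans)
  let ?T = "\<lambda>i j H. (Re (K H $$ (i, j)) - LR i j H) * M (e_mat m i j) +
    (Im (K H $$ (i, j)) - LI i j H) * M (\<i> \<cdot>\<^sub>m e_mat m i j)"
  have rem2: "(\<lambda>H. \<Sum>(i, j)\<in>{..<m} \<times> {..<m}. ?T i j H) \<in> o[near_zero n](mat_norm n)"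
  proof (rule big_sum_in_smallo, clarify)
    fix i j assume ij: "i < m" "j < m"
    show "(\<lambda>H. ?T i j H) \<in> o[near_zero n](mat_norm n)"
      using R[OF ij] I[OF ij] KR[OF ij] KI[OF ij] unfolding has_differential_iff_smallo
      by (intro sum_in_smallo) simp_all
  qed
  have "eventually (\<lambda>H. F (G (A + H)) - F (G A) - ?D H =
      (F (G A + K H) - F (G A) - M (K H)) + (\<Sum>(i, j)\<in>{..<m} \<times> {..<m}. ?T i j H)) (near_zero n)"
    using eventually_near_zero_carrier
  proof eventually_elim
    case (elim H)
    have GH: "G A + K H = G (A + H)"
      using G[OF A] G[of "A + H"] A elim unfolding K_def by (intro eq_matI) auto
    have S: "(\<Sum>(i, j)\<in>{..<m} \<times> {..<m}. ?T i j H) = M (K H) - ?D H"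
      by (subst real_linear_expansion[OF M K[OF elim]])
        (simp add: sum_subtractf sum.distrib case_prod_unfold algebra_simps)
    show ?case unfolding S GH by (rule diff_add_diff_cancel)
  qed
  then have "(\<lambda>H. F (G (A + H)) - F (G A) - ?D H) \<in> o[near_zero n](mat_norm n)"
    by (rule landau_o.small.in_cong[THEN iffD2]) (rule sum_in_smallo(1)[OF rem1 rem2])
  moreover have "real_linear n ?D"
  proof -
    have lin: "real_linear n (LR i j)" "real_linear n (LI i j)" if "i < m" "j < m" for i j
      using R[OF that] I[OF that] by (simp_all add: has_differential_def)
    show ?thesis
      unfolding real_linear_def
    proof (intro conjI ballI allI)
      fix X Y :: "complex mat" assume XY: "X \<in> carrier_mat n n" "Y \<in> carrier_mat n n"
      show "?D (X + Y) = ?D X + ?D Y"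
        unfolding sum.distrib[symmetric]
        by (intro sum.cong refl) (auto simp: real_linear_add[OF lin(1)] real_linear_add[OF lin(2)] XY algebra_simps)
    next
      fix X :: "complex mat" and c assume X: "X \<in> carrier_mat n n"
      show "?D (complex_of_real c \<cdot>\<^sub>m X) = c * ?D X"
        unfolding sum_distrib_left
        by (intro sum.cong refl) (auto simp: real_linear_scale[OF lin(1)] real_linear_scale[OF lin(2)] X algebra_simps)
    qed
  qed
  ultimately show ?thesis
    by (intro has_differential_iff_smallo[THEN iffD2] conjI)
qed

section \<open>Smooth functions\<close>

lemma smooth_on_has_differential:
  assumes "smooth_on n W F"
  shows "\<exists>DF. (\<forall>A\<in>W. has_differential n F A (DF A)) \<and>
    (\<forall>X\<in>carrier_mat n n. smooth_on n W (\<lambda>A. DF A X))"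
  using assms by cases blast

text \<open>An up-to closure: it is stable under differentiation, so coinduction on
  \<^const>\<open>smooth_on\<close> yields that sums, products and composites of smooth functions are smooth.\<close>

inductive smooth_closure :: "nat \<Rightarrow> complex mat set \<Rightarrow> (complex mat \<Rightarrow> real) \<Rightarrow> bool"
  for n W where
  base: "smooth_on n W F \<Longrightarrow> smooth_closure n W F"
| add: "smooth_closure n W F \<Longrightarrow> smooth_closure n W G \<Longrightarrow> smooth_closure n W (\<lambda>A. F A + G A)"
| mult: "smooth_closure n W F \<Longrightarrow> smooth_closure n W G \<Longrightarrow> smooth_closure n W (\<lambda>A. F A * G A)"
| compose: "smooth_on m V F \<Longrightarrow> (\<And>A. A \<in> W \<Longrightarrow> G A \<in> V) \<Longrightarrow>
    (\<And>A. A \<in> carrier_mat n n \<Longrightarrow> G A \<in> carrier_mat m m) \<Longrightarrow>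
    (\<And>i j. i < m \<Longrightarrow> j < m \<Longrightarrow> smooth_closure n W (\<lambda>A. Re (G A $$ (i, j)))) \<Longrightarrow>
    (\<And>i j. i < m \<Longrightarrow> j < m \<Longrightarrow> smooth_closure n W (\<lambda>A. Im (G A $$ (i, j)))) \<Longrightarrow>
    smooth_closure n W (\<lambda>A. F (G A))"

lemma smooth_on_const: "smooth_on n W (\<lambda>A. c)"
proof -
  \<comment> \<open>Quantifying over all constants makes the claim stable under differentiation: the
    derivative of a constant is the constant 0.\<close>
  have "\<exists>c. F = (\<lambda>A. c) \<Longrightarrow> smooth_on n W F" for F
  proof (coinduction arbitrary: F)
    case smooth_on
    then show ?case
      by (intro exI[of _ F] exI[of _ "\<lambda>A X. 0"]) (auto intro: has_differential_const)
  qed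
  then show ?thesis by blast
qed

lemma has_differential_real_linear:
  assumes "real_linear n L" "A \<in> carrier_mat n n"
  shows "has_differential n L A L"
  using assms by (auto simp: has_differential_def real_linear_add intro!: exI[of _ 1])

lemma smooth_on_real_linear:
  assumes "real_linear n L" "W \<subseteq> carrier_mat n n"
  shows "smooth_on n W L"
  by (rule smooth_on.intros[of _ _ _ "\<lambda>A. L"])
    (use assms in \<open>auto intro: has_differential_real_linear smooth_on_const\<close>)

lemma smooth_closure_sum:
  assumes "finite I" "\<And>i. i \<in> I \<Longrightarrow> smooth_closure n W (F i)"
  shows "smooth_closure n W (\<lambda>A. \<Sum>i\<in>I. F i A)"
  using assms
  by (induction I rule: finite_induct)
    (auto intro: smooth_closure.base smooth_on_const smooth_closure.add)

text \<open>Skolemisation for entrywise differentials, whose existence is known for indices below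
  \<open>m\<close> only.\<close>

lemma choice_differentials:
  assumes "\<And>i j. i < m \<Longrightarrow> j < m \<Longrightarrow> \<exists>D. P i j D"
  shows "\<exists>D. \<forall>i<m. \<forall>j<m. P i j (D i j)"
proof (intro exI allI impI)
  show "P i j (SOME D. P i j D)" if "i < m" "j < m" for i j
    using assms[OF that] by (rule someI_ex)
qed

text \<open>Each rule of differentiation expresses the derivative by the generators again. In the
  \<open>compose\<close> case the directional derivatives of the outer function are
  \<open>smooth_on\<close> on \<open>V\<close>, so they can be composed with the same
  \<open>G\<close>.\<close>

lemma smooth_closure_step:
  assumes "smooth_closure n W F" and W: "W \<subseteq> carrier_mat n n"
  shows "\<exists>DF. (\<forall>A\<in>W. has_differential n F A (DF A)) \<and>
    (\<forall>X\<in>carrier_mat n n. smooth_closure n W (\<lambda>A. DF A X))"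
  using assms(1)
proof induction
  case (base F)
  then obtain DF where "\<forall>A\<in>W. has_differential n F A (DF A)"
      "\<forall>X\<in>carrier_mat n n. smooth_on n W (\<lambda>A. DF A X)"
    using smooth_on_has_differential by blast
  then show ?case by (intro exI[of _ DF]) (auto intro: smooth_closure.base)
next
  case (add F G)
  then obtain DF DG where
    "\<forall>A\<in>W. has_differential n F A (DF A)" "\<forall>X\<in>carrier_mat n n. smooth_closure n W (\<lambda>A. DF A X)"
    "\<forall>A\<in>W. has_differential n G A (DG A)" "\<forall>X\<in>carrier_mat n n. smooth_closure n W (\<lambda>A. DG A X)"
    by blast
  then show ?case
    by (intro exI[of _ "\<lambda>A X. DF A X + DG A X"])
      (auto intro: has_differential_add smooth_closure.add)
next
  case (mult F G)
  then obtain DF DG where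
    "\<forall>A\<in>W. has_differential n F A (DF A)" "\<forall>X\<in>carrier_mat n n. smooth_closure n W (\<lambda>A. DF A X)"
    "\<forall>A\<in>W. has_differential n G A (DG A)" "\<forall>X\<in>carrier_mat n n. smooth_closure n W (\<lambda>A. DG A X)"
    by blast
  then show ?case using mult.hyps
    by (intro exI[of _ "\<lambda>A X. F A * DG A X + DF A X * G A"])
      (auto intro!: has_differential_mult smooth_closure.add smooth_closure.mult)
next
  case (compose m V F G)
  obtain DF where DF: "\<And>B. B \<in> V \<Longrightarrow> has_differential m F B (DF B)"
      "\<And>X. X \<in> carrier_mat m m \<Longrightarrow> smooth_on m V (\<lambda>B. DF B X)"
    using smooth_on_has_differential[OF compose.hyps(1)] by blast
  have "\<exists>LR. \<forall>i<m. \<forall>j<m. (\<forall>A\<in>W. has_differential n (\<lambda>A. Re (G A $$ (i, j))) A (LR i j A)) \<and>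
      (\<forall>X\<in>carrier_mat n n. smooth_closure n W (\<lambda>A. LR i j A X))"
    by (rule choice_differentials) (rule compose.IH(1))
  then obtain LR where LR: "\<forall>i<m. \<forall>j<m.
      (\<forall>A\<in>W. has_differential n (\<lambda>A. Re (G A $$ (i, j))) A (LR i j A)) \<and>
      (\<forall>X\<in>carrier_mat n n. smooth_closure n W (\<lambda>A. LR i j A X))" ..
  have "\<exists>LI. \<forall>i<m. \<forall>j<m. (\<forall>A\<in>W. has_differential n (\<lambda>A. Im (G A $$ (i, j))) A (LI i j A)) \<and>
      (\<forall>X\<in>carrier_mat n n. smooth_closure n W (\<lambda>A. LI i j A X))"
    by (rule choice_differentials) (rule compose.IH(2))
  then obtain LI where LI: "\<forall>i<m. \<forall>j<m.
      (\<forall>A\<in>W. has_differential n (\<lambda>A. Im (G A $$ (i, j))) A (LI i j A)) \<and>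
      (\<forall>X\<in>carrier_mat n n. smooth_closure n W (\<lambda>A. LI i j A X))" ..
  let ?D = "\<lambda>A X. \<Sum>(i, j)\<in>{..<m} \<times> {..<m}.
    LR i j A X * DF (G A) (e_mat m i j) + LI i j A X * DF (G A) (\<i> \<cdot>\<^sub>m e_mat m i j)"
  have "has_differential n (\<lambda>A. F (G A)) A (?D A)" if A: "A \<in> W" for A
    by (rule has_differential_compose[where LR = "\<lambda>i j. LR i j A" and LI = "\<lambda>i j. LI i j A"])
      (use A W compose.hyps(2,3) LR LI DF(1) in auto)
  moreover have "smooth_closure n W (\<lambda>A. ?D A X)" if X: "X \<in> carrier_mat n n" for X
    unfolding case_prod_unfold
  proof (rule smooth_closure_sum)
    fix p assume "p \<in> {..<m} \<times> {..<m}"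
    then have ij: "fst p < m" "snd p < m" by auto
    have "smooth_closure n W (\<lambda>A. DF (G A) Y)" if "Y \<in> carrier_mat m m" for Y
      by (rule smooth_closure.compose[of m V "\<lambda>B. DF B Y"]) (use compose.hyps DF(2) that in auto)
    then show "smooth_closure n W (\<lambda>A. LR (fst p) (snd p) A X * DF (G A) (e_mat m (fst p) (snd p)) +
        LI (fst p) (snd p) A X * DF (G A) (\<i> \<cdot>\<^sub>m e_mat m (fst p) (snd p)))"
      using LR LI ij X by (intro smooth_closure.add smooth_closure.mult) auto
  qed simp
  ultimately show ?case by (intro exI[of _ ?D] conjI ballI)
qed

lemma smooth_on_if_smooth_closure:
  assumes "smooth_closure n W F" "W \<subseteq> carrier_mat n n"
  shows "smooth_on n W F"
  using assms(1)
proof (coinduction arbitrary: F)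
  case smooth_on
  then obtain DF where "\<forall>A\<in>W. has_differential n F A (DF A)"
      "\<forall>X\<in>carrier_mat n n. smooth_closure n W (\<lambda>A. DF A X)"
    using smooth_closure_step[OF _ assms(2)] by blast
  then show ?case by (intro exI[of _ F] exI[of _ DF]) auto
qed

lemma smooth_on_subset:
  assumes "smooth_on n W F" "W' \<subseteq> W"
  shows "smooth_on n W' F"
  using assms(1)
proof (coinduction arbitrary: F)
  case smooth_on
  then obtain DF where "\<forall>A\<in>W. has_differential n F A (DF A)"
      "\<forall>X\<in>carrier_mat n n. smooth_on n W (\<lambda>A. DF A X)"
    using smooth_on_has_differential by blast
  then show ?case using assms(2) by (intro exI[of _ F] exI[of _ DF]) auto
qed

lemma smooth_on_add:
  "W \<subseteq> carrier_mat n n \<Longrightarrow> smooth_on n W F \<Longrightarrow> smooth_on n W G \<Longrightarrow> smooth_on n W (\<lambda>A. F A + G A)"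
  by (rule smooth_on_if_smooth_closure) (rule smooth_closure.add[OF smooth_closure.base smooth_closure.base])

lemma smooth_on_mult:
  "W \<subseteq> carrier_mat n n \<Longrightarrow> smooth_on n W F \<Longrightarrow> smooth_on n W G \<Longrightarrow> smooth_on n W (\<lambda>A. F A * G A)"
  by (rule smooth_on_if_smooth_closure) (rule smooth_closure.mult[OF smooth_closure.base smooth_closure.base])

section \<open>Globally smooth functions and maps on matrix spaces\<close>

definition smooth_complex :: "nat \<Rightarrow> (complex mat \<Rightarrow> complex) \<Rightarrow> bool" where
  "smooth_complex n f \<longleftrightarrow>
     smooth_on n (carrier_mat n n) (\<lambda>A. Re (f A)) \<and> smooth_on n (carrier_mat n n) (\<lambda>A. Im (f A))"

lemma smooth_complex_const [simp, intro]: "smooth_complex n (\<lambda>A. c)"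
  by (simp add: smooth_complex_def smooth_on_const)

lemma smooth_complex_add:
  "smooth_complex n f \<Longrightarrow> smooth_complex n g \<Longrightarrow> smooth_complex n (\<lambda>A. f A + g A)"
  by (simp add: smooth_complex_def smooth_on_add)

lemma smooth_complex_mult:
  assumes "smooth_complex n f" "smooth_complex n g"
  shows "smooth_complex n (\<lambda>A. f A * g A)"
proof -
  have "smooth_on n (carrier_mat n n) (\<lambda>A. Re (f A) * Re (g A) + (- 1) * (Im (f A) * Im (g A)))"
    using assms by (intro smooth_on_add smooth_on_mult smooth_on_const) (auto simp: smooth_complex_def)
  moreover have "smooth_on n (carrier_mat n n) (\<lambda>A. Re (f A) * Im (g A) + Im (f A) * Re (g A))"
    using assms by (intro smooth_on_add smooth_on_mult smooth_on_const) (auto simp: smooth_complex_def)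
  ultimately show ?thesis by (simp add: smooth_complex_def)
qed

lemma smooth_complex_cnj:
  assumes "smooth_complex n f"
  shows "smooth_complex n (\<lambda>A. cnj (f A))"
proof -
  have "smooth_on n (carrier_mat n n) (\<lambda>A. (- 1) * Im (f A))"
    using assms by (intro smooth_on_mult smooth_on_const) (auto simp: smooth_complex_def)
  then show ?thesis using assms by (simp add: smooth_complex_def)
qed

lemma smooth_complex_index:
  assumes "i < n" "j < n"
  shows "smooth_complex n (\<lambda>A. A $$ (i, j))"
  unfolding smooth_complex_def
  by (intro conjI smooth_on_real_linear) (use assms in \<open>auto simp: real_linear_def\<close>)

lemma smooth_complex_sum:
  assumes "\<And>i. i \<in> I \<Longrightarrow> smooth_complex n (f i)"
  shows "smooth_complex n (\<lambda>A. \<Sum>i\<in>I. f i A)"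
  using assms by (induction I rule: infinite_finite_induct) (auto intro: smooth_complex_add)

lemma smooth_complex_prod:
  assumes "\<And>i. i \<in> I \<Longrightarrow> smooth_complex n (f i)"
  shows "smooth_complex n (\<lambda>A. \<Prod>i\<in>I. f i A)"
  using assms by (induction I rule: infinite_finite_induct) (auto intro: smooth_complex_mult)

lemma smooth_complex_det:
  assumes "\<And>i j. i < m \<Longrightarrow> j < m \<Longrightarrow> smooth_complex n (\<lambda>A. G i j A)"
  shows "smooth_complex n (\<lambda>A. det (mat m m (\<lambda>(i, j). G i j A)))"
proof -
  have "smooth_complex n (\<lambda>A. \<Sum>p\<in>{p. p permutes {0..<m}}. signof p * (\<Prod>i = 0..<m. G i (p i) A))"
    using assms
    by (intro smooth_complex_sum smooth_complex_mult smooth_complex_prod)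
      (auto dest: permutes_in_image)
  moreover have "det (mat m m (\<lambda>(i, j). G i j A)) =
      (\<Sum>p\<in>{p. p permutes {0..<m}}. signof p * (\<Prod>i = 0..<m. G i (p i) A))" for A
    by (subst det_def'[of _ m]) (auto intro!: sum.cong prod.cong simp: permutes_in_image)
  ultimately show ?thesis by simp
qed

text \<open>Smoothness on the whole matrix space can be demanded because the maps between groups
  below are restrictions of maps polynomial in the entries and their conjugates. No open domains
  have to be chosen for them.\<close>

definition smooth_map :: "nat \<Rightarrow> nat \<Rightarrow> (complex mat \<Rightarrow> complex mat) \<Rightarrow> bool" where
  "smooth_map n m G \<longleftrightarrow> (\<forall>A\<in>carrier_mat n n. G A \<in> carrier_mat m m) \<and>
     (\<forall>i<m. \<forall>j<m. smooth_complex n (\<lambda>A. G A $$ (i, j)))"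

lemma smooth_map_compose:
  assumes G: "smooth_map n m G" and F: "smooth_on m V F"
  shows "smooth_on n {A \<in> carrier_mat n n. G A \<in> V} (\<lambda>A. F (G A))"
proof (rule smooth_on_if_smooth_closure, rule smooth_closure.compose[OF F])
  let ?W = "{A \<in> carrier_mat n n. G A \<in> V}"
  have W: "?W \<subseteq> carrier_mat n n" by auto
  fix i j assume ij: "i < m" "j < m"
  have "smooth_on n (carrier_mat n n) (\<lambda>A. Re (G A $$ (i, j)))"
       "smooth_on n (carrier_mat n n) (\<lambda>A. Im (G A $$ (i, j)))"
    using G ij by (simp_all add: smooth_map_def smooth_complex_def)
  from this[THEN smooth_on_subset, OF W]
  show "smooth_closure n ?W (\<lambda>A. Re (G A $$ (i, j)))"
    and "smooth_closure n ?W (\<lambda>A. Im (G A $$ (i, j)))"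
    by (auto intro: smooth_closure.base)
qed (use G in \<open>auto simp: smooth_map_def\<close>)

text \<open>Metric balls in additive form, to match the increments in
  \<open>has_differential\<close>.\<close>

lemma openin_mat_topology:
  "openin (mat_topology n) U \<longleftrightarrow> U \<subseteq> carrier_mat n n \<and>
     (\<forall>A\<in>U. \<exists>\<delta>>0. \<forall>H\<in>carrier_mat n n. mat_norm n H < \<delta> \<longrightarrow> A + H \<in> U)"
proof -
  interpret Metric_space "carrier_mat n n" "mat_dist n" by (rule Metric_space_mat)
  have "mball A r \<subseteq> U \<longleftrightarrow> (\<forall>H\<in>carrier_mat n n. mat_norm n H < r \<longrightarrow> A + H \<in> U)"
    if A: "A \<in> carrier_mat n n" for A r
  proof
    assume L: "mball A r \<subseteq> U"
    show "\<forall>H\<in>carrier_mat n n. mat_norm n H < r \<longrightarrow> A + H \<in> U"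
    proof (intro ballI impI)
      fix H assume H: "H \<in> carrier_mat n n" "mat_norm n H < r"
      then have "A + H - A = H" using A by (intro eq_matI) auto
      then have "mat_dist n (A + H) A = mat_norm n H"
        using A H by (subst mat_dist_eq_norm) auto
      then show "A + H \<in> U" using L A H commute[of "A + H" A] by auto
    qed
  next
    assume R: "\<forall>H\<in>carrier_mat n n. mat_norm n H < r \<longrightarrow> A + H \<in> U"
    show "mball A r \<subseteq> U"
    proof
      fix B assume "B \<in> mball A r"
      then have B: "B \<in> carrier_mat n n" "mat_norm n (B - A) < r"
        using A commute[of A B] by (auto simp: mat_dist_eq_norm)
      moreover have "A + (B - A) = B" using A B by (intro eq_matI) auto
      ultimately show "B \<in> U" using R minus_carrier_mat[OF A, of B] by fastforce
    qed
  qed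
  then show ?thesis unfolding mat_topology_def openin_mtopology by (auto simp: subset_iff)
qed

lemma topspace_mat_topology [simp]: "topspace (mat_topology n) = carrier_mat n n"
  unfolding mat_topology_def using Metric_space.topspace_mtopology[OF Metric_space_mat] by simp

text \<open>Differentiability of the entries makes the increment of \<open>G\<close> tend to 0 along
  \<open>near_zero\<close>, which is openness of preimages in the form of
  \<open>openin_mat_topology\<close>.\<close>

lemma smooth_map_continuous:
  assumes G: "smooth_map n m G"
  shows "continuous_map (mat_topology n) (mat_topology m) G"
  unfolding continuous_map_def
proof (intro conjI allI impI)
  show "G \<in> topspace (mat_topology n) \<rightarrow> topspace (mat_topology m)"
    using G by (auto simp: smooth_map_def)
  fix V assume V: "openin (mat_topology m) V"
  show "openin (mat_topology n) {A \<in> topspace (mat_topology n). G A \<in> V}"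
    unfolding openin_mat_topology topspace_mat_topology
  proof (intro conjI ballI)
    fix A assume "A \<in> {A \<in> carrier_mat n n. G A \<in> V}"
    then have A: "A \<in> carrier_mat n n" "G A \<in> V" by auto
    obtain r where r: "r > 0" "\<And>H. H \<in> carrier_mat m m \<Longrightarrow> mat_norm m H < r \<Longrightarrow> G A + H \<in> V"
      using V A(2) unfolding openin_mat_topology by blast
    have R: "\<exists>D. has_differential n (\<lambda>B. Re (G B $$ (i, j))) A D"
      and I: "\<exists>D. has_differential n (\<lambda>B. Im (G B $$ (i, j))) A D" if "i < m" "j < m" for i j
    proof -
      have "smooth_on n (carrier_mat n n) (\<lambda>B. Re (G B $$ (i, j)))"
           "smooth_on n (carrier_mat n n) (\<lambda>B. Im (G B $$ (i, j)))"
        using G that by (auto simp: smooth_map_def smooth_complex_def)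
      from this[THEN smooth_on_has_differential]
      show "\<exists>D. has_differential n (\<lambda>B. Re (G B $$ (i, j))) A D"
        and "\<exists>D. has_differential n (\<lambda>B. Im (G B $$ (i, j))) A D"
        using A(1) by auto
    qed
    have "\<exists>LR. \<forall>i<m. \<forall>j<m. has_differential n (\<lambda>B. Re (G B $$ (i, j))) A (LR i j)"
      by (rule choice_differentials) (rule R)
    then obtain LR where LR: "\<forall>i<m. \<forall>j<m. has_differential n (\<lambda>B. Re (G B $$ (i, j))) A (LR i j)" ..
    have "\<exists>LI. \<forall>i<m. \<forall>j<m. has_differential n (\<lambda>B. Im (G B $$ (i, j))) A (LI i j)"
      by (rule choice_differentials) (rule I)
    then obtain LI where LI: "\<forall>i<m. \<forall>j<m. has_differential n (\<lambda>B. Im (G B $$ (i, j))) A (LI i j)" ..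
    have "((\<lambda>H. mat_norm m (G (A + H) - G A)) \<longlongrightarrow> 0) (near_zero n)"
      using G LR LI by (intro has_differential_increment_mat_bigo(2)[OF A(1), where LR = LR and LI = LI]) (simp_all add: smooth_map_def)
    then have "eventually (\<lambda>H. mat_norm m (G (A + H) - G A) < r) (near_zero n)"
      using r(1) by (auto simp: tendsto_iff)
    then obtain \<delta> where \<delta>: "\<delta> > 0"
        "\<And>H. H \<in> carrier_mat n n \<Longrightarrow> mat_norm n H < \<delta> \<Longrightarrow> mat_norm m (G (A + H) - G A) < r"
      unfolding eventually_near_zero by blast
    show "\<exists>\<delta>>0. \<forall>H\<in>carrier_mat n n. mat_norm n H < \<delta> \<longrightarrow> A + H \<in> {A \<in> carrier_mat n n. G A \<in> V}"
    proof (intro exI[of _ \<delta>] conjI ballI impI \<delta>(1))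
      fix H assume H: "H \<in> carrier_mat n n" "mat_norm n H < \<delta>"
      have carr: "G A \<in> carrier_mat m m" "G (A + H) \<in> carrier_mat m m"
        using G A(1) H(1) by (simp_all add: smooth_map_def)
      have "G A + (G (A + H) - G A) \<in> V"
        using r(2)[OF minus_carrier_mat[OF carr(1)] \<delta>(2)[OF H]] .
      moreover have "G A + (G (A + H) - G A) = G (A + H)"
        using carr by (intro eq_matI) auto
      ultimately show "A + H \<in> {A \<in> carrier_mat n n. G A \<in> V}" using A(1) H(1) by simp
    qed
  qed auto
qed

lemma openin_smooth_map_preimage:
  assumes "smooth_map n m G" "openin (mat_topology m) V"
  shows "openin (mat_topology n) {A \<in> carrier_mat n n. G A \<in> V}"
  using smooth_map_continuous[OF assms(1)] assms(2) by (auto simp: continuous_map_def)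

section \<open>Morphisms and quotients\<close>

text \<open>One direction of \<open>diffeomorphism\<close>: its equivalence for smooth functions
  will be obtained from such a map together with one for the inverse.\<close>

definition smooth_morphism ::
    "('a, 'm) smooth_space_scheme \<Rightarrow> ('b, 'n) smooth_space_scheme \<Rightarrow> ('a \<Rightarrow> 'b) \<Rightarrow> bool" where
  "smooth_morphism M N \<phi> \<longleftrightarrow> continuous_map (top_of M) (top_of N) \<phi> \<and>
     (\<forall>V f. openin (top_of N) V \<longrightarrow> f \<in> smooth_fun N V \<longrightarrow> f \<circ> \<phi> \<in> smooth_fun M (preimage M \<phi> V))"

text \<open>Functions in \<open>smooth_fun M U\<close> have arbitrary values outside
  \<open>U\<close>, and membership should ignore them. This matters because a composite such as
  \<open>f \<circ> \<phi> \<circ> \<psi>\<close> returns \<open>f\<close> only on the open set in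
  question.\<close>

definition smooth_fun_local :: "('a, 'm) smooth_space_scheme \<Rightarrow> bool" where
  "smooth_fun_local M \<longleftrightarrow> (\<forall>U f g. U \<subseteq> topspace (top_of M) \<longrightarrow> (\<forall>x\<in>U. f x = g x) \<longrightarrow>
     f \<in> smooth_fun M U \<longrightarrow> g \<in> smooth_fun M U)"

lemma smooth_fun_localD:
  "smooth_fun_local M \<Longrightarrow> f \<in> smooth_fun M U \<Longrightarrow> U \<subseteq> topspace (top_of M) \<Longrightarrow>
    (\<And>x. x \<in> U \<Longrightarrow> f x = g x) \<Longrightarrow> g \<in> smooth_fun M U"
  unfolding smooth_fun_local_def by blast

lemma smooth_morphism_in_topspace:
  "smooth_morphism M N \<phi> \<Longrightarrow> x \<in> topspace (top_of M) \<Longrightarrow> \<phi> x \<in> topspace (top_of N)"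
  by (auto simp: smooth_morphism_def continuous_map_def)

lemma openin_preimage:
  "smooth_morphism M N \<phi> \<Longrightarrow> openin (top_of N) V \<Longrightarrow> openin (top_of M) (preimage M \<phi> V)"
  by (auto simp: smooth_morphism_def continuous_map_def preimage_def)

lemma preimage_subset: "preimage M q V \<subseteq> topspace (top_of M)"
  by (auto simp: preimage_def)

text \<open>If \<open>f \<circ> \<phi>\<close> is smooth, pulling it back along
  \<open>\<psi>\<close> gives a function that agrees with \<open>f\<close> on \<open>V\<close>,
  because the two preimages undo each other.\<close>

lemma diffeomorphism_if_inverse_morphisms:
  assumes \<phi>: "smooth_morphism M N \<phi>" and \<psi>: "smooth_morphism N M \<psi>"
    and \<psi>\<phi>: "\<And>x. x \<in> topspace (top_of M) \<Longrightarrow> \<psi> (\<phi> x) = x"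
    and \<phi>\<psi>: "\<And>y. y \<in> topspace (top_of N) \<Longrightarrow> \<phi> (\<psi> y) = y"
    and N: "smooth_fun_local N"
  shows "diffeomorphism M N \<phi>"
  unfolding diffeomorphism_def
proof (intro conjI allI impI)
  show "homeomorphic_map (top_of M) (top_of N) \<phi>"
    unfolding homeomorphic_map_maps homeomorphic_maps_def
  proof (intro exI conjI ballI)
    show "continuous_map (top_of M) (top_of N) \<phi>" "continuous_map (top_of N) (top_of M) \<psi>"
      using \<phi> \<psi> by (simp_all add: smooth_morphism_def)
  qed (use \<psi>\<phi> \<phi>\<psi> in auto)
  fix V f assume V: "openin (top_of N) V"
  then have Vsub: "V \<subseteq> topspace (top_of N)" by (rule openin_subset)
  show "f \<in> smooth_fun N V \<longleftrightarrow> f \<circ> \<phi> \<in> smooth_fun M (preimage M \<phi> V)"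
  proof
    assume "f \<in> smooth_fun N V"
    then show "f \<circ> \<phi> \<in> smooth_fun M (preimage M \<phi> V)" using \<phi> V by (simp add: smooth_morphism_def)
  next
    assume "f \<circ> \<phi> \<in> smooth_fun M (preimage M \<phi> V)"
    then have "f \<circ> \<phi> \<circ> \<psi> \<in> smooth_fun N (preimage N \<psi> (preimage M \<phi> V))"
      using \<psi> openin_preimage[OF \<phi> V] by (simp add: smooth_morphism_def)
    moreover have "preimage N \<psi> (preimage M \<phi> V) = V"
      using Vsub \<phi>\<psi> smooth_morphism_in_topspace[OF \<psi>] by (auto simp: preimage_def)
    ultimately have "f \<circ> \<phi> \<circ> \<psi> \<in> smooth_fun N V" by simp
    then show "f \<in> smooth_fun N V"
      by (rule smooth_fun_localD[OF N _ Vsub]) (use Vsub \<phi>\<psi> in auto)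
  qed
qed

section \<open>Manifolds embedded in matrix spaces\<close>

lemma openin_top_of_embedded_space:
  "openin (top_of (embedded_space n \<iota> S)) U \<longleftrightarrow> (\<exists>W. openin (mat_topology n) W \<and> U = \<iota> -` W \<inter> S)"
  by (simp add: embedded_space_def openin_pullback_topology)

lemma topspace_embedded_space:
  assumes "\<And>x. x \<in> S \<Longrightarrow> \<iota> x \<in> carrier_mat n n"
  shows "topspace (top_of (embedded_space n \<iota> S)) = S"
  using assms by (auto simp: embedded_space_def topspace_pullback_topology)

lemma smooth_fun_embedded_space:
  "f \<in> smooth_fun (embedded_space n \<iota> S) U \<longleftrightarrow>
     (\<forall>x\<in>U. \<exists>W F. openin (mat_topology n) W \<and> \<iota> x \<in> W \<and>
         smooth_on n W F \<and> (\<forall>y \<in> U. \<iota> y \<in> W \<longrightarrow> f y = F (\<iota> y)))"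
  by (simp add: embedded_space_def)

lemma smooth_fun_local_embedded_space: "smooth_fun_local (embedded_space n \<iota> S)"
  unfolding smooth_fun_local_def smooth_fun_embedded_space
proof (intro allI impI ballI)
  fix U f g x assume "\<forall>x\<in>U. f x = g x" "x \<in> U"
    "\<forall>x\<in>U. \<exists>W F. openin (mat_topology n) W \<and> \<iota> x \<in> W \<and> smooth_on n W F \<and>
      (\<forall>y\<in>U. \<iota> y \<in> W \<longrightarrow> f y = F (\<iota> y))"
  then show "\<exists>W F. openin (mat_topology n) W \<and> \<iota> x \<in> W \<and> smooth_on n W F \<and>
      (\<forall>y\<in>U. \<iota> y \<in> W \<longrightarrow> g y = F (\<iota> y))"
    by simp
qed

text \<open>The ambient map \<open>G\<close> covers \<open>\<phi>\<close>: a local extension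
  \<open>F\<close> of \<open>f\<close> on \<open>W\<close> turns into the extension
  \<open>F \<circ> G\<close> of \<open>f \<circ> \<phi>\<close> on the preimage of
  \<open>W\<close>.\<close>

lemma smooth_morphism_embedded_space:
  assumes G: "smooth_map n m G" and \<phi>: "\<And>x. x \<in> S \<Longrightarrow> \<phi> x \<in> S'"
    and \<iota>: "\<And>x. x \<in> S \<Longrightarrow> \<iota> x \<in> carrier_mat n n"
    and \<iota>': "\<And>x. x \<in> S \<Longrightarrow> \<iota>' (\<phi> x) = G (\<iota> x)"
  shows "smooth_morphism (embedded_space n \<iota> S) (embedded_space m \<iota>' S') \<phi>"
proof -
  let ?M = "embedded_space n \<iota> S" and ?N = "embedded_space m \<iota>' S'"
  have top: "topspace (top_of ?M) = S" by (rule topspace_embedded_space[OF \<iota>])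
  show ?thesis
    unfolding smooth_morphism_def
  proof (intro conjI allI impI)
    show "continuous_map (top_of ?M) (top_of ?N) \<phi>"
      unfolding continuous_map_def
    proof (intro conjI allI impI)
      show "\<phi> \<in> topspace (top_of ?M) \<rightarrow> topspace (top_of ?N)"
        unfolding top using G \<phi> \<iota>
        by (auto simp: embedded_space_def topspace_pullback_topology smooth_map_def \<iota>')
      fix V assume "openin (top_of ?N) V"
      then obtain W where W: "openin (mat_topology m) W" "V = \<iota>' -` W \<inter> S'"
        unfolding openin_top_of_embedded_space by blast
      have "{x \<in> topspace (top_of ?M). \<phi> x \<in> V} = \<iota> -` {A \<in> carrier_mat n n. G A \<in> W} \<inter> S"
        unfolding top using \<phi> \<iota> by (auto simp: W(2) \<iota>')
      then show "openin (top_of ?M) {x \<in> topspace (top_of ?M). \<phi> x \<in> V}"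
        unfolding openin_top_of_embedded_space
        by (intro exI[of _ "{A \<in> carrier_mat n n. G A \<in> W}"] conjI openin_smooth_map_preimage[OF G W(1)])
    qed
  next
    fix V f assume f: "f \<in> smooth_fun ?N V"
    show "f \<circ> \<phi> \<in> smooth_fun ?M (preimage ?M \<phi> V)"
      unfolding smooth_fun_embedded_space
    proof
      fix x assume "x \<in> preimage ?M \<phi> V"
      then have x: "x \<in> S" "\<phi> x \<in> V" unfolding preimage_def top by auto
      obtain W F where W: "openin (mat_topology m) W" "\<iota>' (\<phi> x) \<in> W" "smooth_on m W F"
          "\<forall>y\<in>V. \<iota>' y \<in> W \<longrightarrow> f y = F (\<iota>' y)"
        using bspec[OF f[unfolded smooth_fun_embedded_space] x(2)] by (elim exE conjE) (rule that)
      show "\<exists>W F. openin (mat_topology n) W \<and> \<iota> x \<in> W \<and> smooth_on n W F \<and>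
          (\<forall>y\<in>preimage ?M \<phi> V. \<iota> y \<in> W \<longrightarrow> (f \<circ> \<phi>) y = F (\<iota> y))"
      proof (intro exI conjI ballI impI)
        show "openin (mat_topology n) {A \<in> carrier_mat n n. G A \<in> W}"
          by (rule openin_smooth_map_preimage[OF G W(1)])
        show "smooth_on n {A \<in> carrier_mat n n. G A \<in> W} (\<lambda>A. F (G A))"
          by (rule smooth_map_compose[OF G W(3)])
        show "\<iota> x \<in> {A \<in> carrier_mat n n. G A \<in> W}" using x W(2) \<iota> by (simp add: \<iota>')
        fix y assume "y \<in> preimage ?M \<phi> V" "\<iota> y \<in> {A \<in> carrier_mat n n. G A \<in> W}"
        then show "(f \<circ> \<phi>) y = F (G (\<iota> y))"
          using W(4) unfolding preimage_def top by (simp add: \<iota>')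
      qed
    qed
  qed
qed

section \<open>Quotients and the maps induced on them\<close>

lemma topspace_quotient_top [simp]: "topspace (quotient_top T q) = q ` topspace T"
proof (rule subset_antisym)
  show "topspace (quotient_top T q) \<subseteq> q ` topspace T"
    using iffD1[OF openin_quotient_top openin_topspace[of "quotient_top T q"]] by (rule conjunct1)
  have "{x \<in> topspace T. q x \<in> q ` topspace T} = topspace T" by blast
  then have "openin (quotient_top T q) (q ` topspace T)" by (simp add: openin_quotient_top)
  then show "q ` topspace T \<subseteq> topspace (quotient_top T q)" by (rule openin_subset)
qed

lemma quotient_poisson_simps [simp]:
  "top_of (quotient_poisson M q) = quotient_top (top_of M) q"
  "f \<in> smooth_fun (quotient_poisson M q) V \<longleftrightarrow> f \<circ> q \<in> smooth_fun M (preimage M q V)"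
  "bracket (quotient_poisson M q) V f h y = (THE c. \<forall>x \<in> preimage M q {y}.
         bracket M (preimage M q V) (f \<circ> q) (h \<circ> q) x = c)"
  by (simp_all only: quotient_poisson_def smooth_space.simps poisson_space.simps mem_Collect_eq)

lemma smooth_fun_local_quotient:
  assumes "smooth_fun_local M"
  shows "smooth_fun_local (quotient_poisson M q)"
  unfolding smooth_fun_local_def
proof (intro allI impI)
  fix U f g assume eq: "\<forall>x\<in>U. f x = g x" and f: "f \<in> smooth_fun (quotient_poisson M q) U"
  have "g \<circ> q \<in> smooth_fun M (preimage M q U)"
    by (rule smooth_fun_localD[OF assms f[unfolded quotient_poisson_simps] preimage_subset])
      (use eq in \<open>auto simp: preimage_def\<close>)
  then show "g \<in> smooth_fun (quotient_poisson M q) U" by simp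
qed

lemma smooth_morphism_quotient:
  assumes s: "smooth_morphism M M' s" and M: "smooth_fun_local M"
    and eq: "\<And>x. x \<in> topspace (top_of M) \<Longrightarrow> \<phi> (q x) = q' (s x)"
  shows "smooth_morphism (quotient_poisson M q) (quotient_poisson M' q') \<phi>"
proof -
  let ?Q = "quotient_poisson M q"
  \<comment> \<open>Both ways round the commutative square give the same set upstairs, and openness
    and smoothness on the quotient are tested there.\<close>
  have pre: "preimage M q (preimage ?Q \<phi> V) = preimage M s (preimage M' q' V)" for V
    unfolding preimage_def quotient_poisson_simps topspace_quotient_top
    by (rule Collect_cong) (simp add: eq smooth_morphism_in_topspace[OF s] cong: conj_cong)
  show ?thesis
    unfolding smooth_morphism_def quotient_poisson_simps
  proof (intro conjI allI impI)
    show "continuous_map (quotient_top (top_of M) q) (quotient_top (top_of M') q') \<phi>"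
      unfolding continuous_map_def topspace_quotient_top
    proof (intro conjI allI impI)
      show "\<phi> \<in> q ` topspace (top_of M) \<rightarrow> q' ` topspace (top_of M')"
        using eq smooth_morphism_in_topspace[OF s] by auto
      fix V assume "openin (quotient_top (top_of M') q') V"
      then have "openin (top_of M') (preimage M' q' V)"
        by (simp add: openin_quotient_top preimage_def)
      from openin_preimage[OF s this] show
        "openin (quotient_top (top_of M) q) {y \<in> q ` topspace (top_of M). \<phi> y \<in> V}"
        using pre[of V] by (auto simp: openin_quotient_top preimage_def)
    qed
  next
    fix V f assume V: "openin (quotient_top (top_of M') q') V"
      and f: "f \<circ> q' \<in> smooth_fun M' (preimage M' q' V)"
    have "openin (top_of M') (preimage M' q' V)"
      using V by (simp add: openin_quotient_top preimage_def)
    then have "f \<circ> q' \<circ> s \<in> smooth_fun M (preimage M s (preimage M' q' V))"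
      using s f by (simp add: smooth_morphism_def)
    then show "f \<circ> \<phi> \<circ> q \<in> smooth_fun M (preimage M q (preimage ?Q \<phi> V))"
      unfolding pre
      by (rule smooth_fun_localD[OF M _ preimage_subset]) (auto simp: preimage_def eq)
  qed
qed

text \<open>A section \<open>j\<close> of \<open>s\<close> suffices:
  \<open>s (j (s x)) = s x\<close> puts \<open>j (s x)\<close> and \<open>x\<close> into the same
  class of \<open>q\<close>, since \<open>q\<close> identifies exactly the points that
  \<open>q' \<circ> s\<close> identifies. Hence the map induced by \<open>j\<close> is a two-sided
  inverse of the one induced by \<open>s\<close>.\<close>

theorem poisson_diffeomorphic_quotients:
  assumes s: "smooth_morphism M M' s" and j: "smooth_morphism M' M j"
    and loc: "smooth_fun_local M" "smooth_fun_local M'"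
    and sj: "\<And>y. y \<in> topspace (top_of M') \<Longrightarrow> s (j y) = y"
    and q: "\<And>x y. x \<in> topspace (top_of M) \<Longrightarrow> y \<in> topspace (top_of M) \<Longrightarrow>
      q x = q y \<longleftrightarrow> q' (s x) = q' (s y)"
    and bracket_cong: "\<And>U f f' h h' x. (\<And>y. y \<in> U \<Longrightarrow> f y = f' y \<and> h y = h' y) \<Longrightarrow>
      bracket M U f h x = bracket M U f' h' x"
    and bracket: "\<And>U f h x. openin (top_of M') U \<Longrightarrow> f \<in> smooth_fun M' U \<Longrightarrow> h \<in> smooth_fun M' U \<Longrightarrow>
      x \<in> preimage M s U \<Longrightarrow> bracket M (preimage M s U) (f \<circ> s) (h \<circ> s) x = bracket M' U f h (s x)"
  shows "poisson_diffeomorphic (quotient_poisson M q) (quotient_poisson M' q')"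
proof -
  let ?Q = "quotient_poisson M q" and ?Q' = "quotient_poisson M' q'"
  let ?T = "topspace (top_of M)" and ?T' = "topspace (top_of M')"
  have sT: "s x \<in> ?T'" if "x \<in> ?T" for x using smooth_morphism_in_topspace[OF s that] .
  have jT: "j y \<in> ?T" if "y \<in> ?T'" for y using smooth_morphism_in_topspace[OF j that] .
  \<comment> \<open>The assumption \<open>q\<close> makes the value independent of the chosen
    representative.\<close>
  define \<phi> where "\<phi> C = q' (s (SOME x. x \<in> ?T \<and> q x = C))" for C
  define \<psi> where "\<psi> C = q (j (SOME y. y \<in> ?T' \<and> q' y = C))" for C
  have \<phi>: "\<phi> (q x) = q' (s x)" if x: "x \<in> ?T" for x
  proof -
    have "(SOME z. z \<in> ?T \<and> q z = q x) \<in> ?T \<and> q (SOME z. z \<in> ?T \<and> q z = q x) = q x"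
      by (rule someI[of _ x]) (use x in simp)
    then show ?thesis unfolding \<phi>_def using q x by blast
  qed
  have \<psi>: "\<psi> (q' y) = q (j y)" if y: "y \<in> ?T'" for y
  proof -
    define z where "z = (SOME z. z \<in> ?T' \<and> q' z = q' y)"
    have "z \<in> ?T' \<and> q' z = q' y"
      unfolding z_def by (rule someI[of _ y]) (use y in simp)
    then show ?thesis unfolding \<psi>_def z_def[symmetric] using q[OF jT jT] y sj by simp
  qed
  have "diffeomorphism ?Q ?Q' \<phi>"
  proof (rule diffeomorphism_if_inverse_morphisms)
    show "smooth_morphism ?Q ?Q' \<phi>" by (rule smooth_morphism_quotient[OF s loc(1)]) (rule \<phi>)
    show "smooth_morphism ?Q' ?Q \<psi>" by (rule smooth_morphism_quotient[OF j loc(2)]) (rule \<psi>)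
    show "smooth_fun_local ?Q'" by (rule smooth_fun_local_quotient[OF loc(2)])
    show "\<psi> (\<phi> C) = C" if "C \<in> topspace (top_of ?Q)" for C
      using that by (auto simp: \<phi> \<psi> sT jT sj q)
    show "\<phi> (\<psi> C) = C" if "C \<in> topspace (top_of ?Q')" for C
      using that by (auto simp: \<phi> \<psi> sT jT sj)
  qed
  moreover have "bracket ?Q (preimage ?Q \<phi> V) (f \<circ> \<phi>) (h \<circ> \<phi>) C = bracket ?Q' V f h (\<phi> C)"
    if V: "openin (top_of ?Q') V" and f: "f \<in> smooth_fun ?Q' V" and h: "h \<in> smooth_fun ?Q' V"
      and C: "C \<in> preimage ?Q \<phi> V" for V f h C
  proof -
    have pre: "preimage M q (preimage ?Q \<phi> V) = preimage M s (preimage M' q' V)"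
      unfolding preimage_def quotient_poisson_simps topspace_quotient_top
      by (rule Collect_cong) (simp add: \<phi> sT cong: conj_cong)
    have open': "openin (top_of M') (preimage M' q' V)"
      using V by (simp add: openin_quotient_top preimage_def)
    obtain x0 where x0: "x0 \<in> ?T" "C = q x0" using C by (auto simp: preimage_def)
    have CV: "\<phi> C \<in> V" using C by (simp add: preimage_def)
    \<comment> \<open>Each quotient bracket is a definite description of the value common to a
      fibre. Since \<open>s\<close> maps the one fibre onto the other, with preimages supplied by
      \<open>j\<close>, the two descriptions become identical.\<close>
    have fibre: "s ` preimage M q {C} = preimage M' q' {\<phi> C}"
    proof (intro subset_antisym subsetI)
      fix y assume "y \<in> s ` preimage M q {C}"
      then obtain x where "x \<in> ?T" "q x = C" "y = s x" by (auto simp: preimage_def)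
      then show "y \<in> preimage M' q' {\<phi> C}" using \<phi>[of x] sT by (simp add: preimage_def)
    next
      fix y assume "y \<in> preimage M' q' {\<phi> C}"
      then have y: "y \<in> ?T'" "q' y = \<phi> C" by (auto simp: preimage_def)
      have "q (j y) = C" using q[OF jT[OF y(1)] x0(1)] y sj x0 \<phi> by simp
      then have "j y \<in> preimage M q {C}" using jT y(1) by (simp add: preimage_def)
      then show "y \<in> s ` preimage M q {C}" using sj[OF y(1)] by (metis imageI)
    qed
    have br: "bracket M (preimage M q (preimage ?Q \<phi> V)) (f \<circ> \<phi> \<circ> q) (h \<circ> \<phi> \<circ> q) x =
        bracket M' (preimage M' q' V) (f \<circ> q') (h \<circ> q') (s x)" if x: "x \<in> preimage M q {C}" for x
    proof -
      have "bracket M (preimage M q (preimage ?Q \<phi> V)) (f \<circ> \<phi> \<circ> q) (h \<circ> \<phi> \<circ> q) x =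
          bracket M (preimage M s (preimage M' q' V)) (f \<circ> q' \<circ> s) (h \<circ> q' \<circ> s) x"
        unfolding pre by (rule bracket_cong) (auto simp: preimage_def \<phi>)
      also have "\<dots> = bracket M' (preimage M' q' V) (f \<circ> q') (h \<circ> q') (s x)"
        by (rule bracket[OF open']) (use f h x CV \<phi> sT in \<open>auto simp: preimage_def\<close>)
      finally show ?thesis .
    qed
    have "bracket ?Q (preimage ?Q \<phi> V) (f \<circ> \<phi>) (h \<circ> \<phi>) C = (THE c. \<forall>x \<in> preimage M q {C}.
         bracket M' (preimage M' q' V) (f \<circ> q') (h \<circ> q') (s x) = c)"
      using br by (simp add: comp_assoc)
    also have "\<dots> = (THE c. \<forall>y \<in> s ` preimage M q {C}.
         bracket M' (preimage M' q' V) (f \<circ> q') (h \<circ> q') y = c)"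
      by (simp only: ball_simps)
    also have "\<dots> = bracket ?Q' V f h (\<phi> C)" by (simp only: fibre quotient_poisson_simps)
    finally show ?thesis .
  qed
  ultimately show ?thesis
    unfolding poisson_diffeomorphic_def poisson_diffeomorphism_def by blast
qed

section \<open>Unitary matrices and their blocks\<close>

lemma index_mult_mat_sum:
  assumes "A \<in> carrier_mat l n" "B \<in> carrier_mat n m" "i < l" "j < m"
  shows "(A * B) $$ (i, j) = (\<Sum>a<n. A $$ (i, a) * B $$ (a, j))"
  using assms by (simp add: scalar_prod_def lessThan_atLeast0)

lemma mat_adjoint_index [simp]:
  "i < dim_col A \<Longrightarrow> j < dim_row A \<Longrightarrow> mat_adjoint A $$ (i, j) = cnj (A $$ (j, i))"
  by (simp add: mat_adjoint_def mat_of_rows_index)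

lemma mat_adjoint_dim [simp]:
  "dim_row (mat_adjoint A) = dim_col A" "dim_col (mat_adjoint A) = dim_row A"
  by (simp_all add: mat_adjoint_def)

lemma mat_adjoint_carrier [simp]: "A \<in> carrier_mat n m \<Longrightarrow> mat_adjoint A \<in> carrier_mat m n"
  by auto

lemma mat_adjoint_adjoint [simp]: "mat_adjoint (mat_adjoint A) = (A :: complex mat)"
  by (intro eq_matI) auto

lemma mat_adjoint_mult:
  assumes "(A :: complex mat) \<in> carrier_mat n n" "B \<in> carrier_mat n n"
  shows "mat_adjoint (A * B) = mat_adjoint B * mat_adjoint A"
proof (rule eq_matI)
  fix i j assume "i < dim_row (mat_adjoint B * mat_adjoint A)" "j < dim_col (mat_adjoint B * mat_adjoint A)"
  then have ij: "i < n" "j < n" using assms by auto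
  then have "mat_adjoint (A * B) $$ (i, j) = cnj ((A * B) $$ (j, i))"
    using assms by (intro mat_adjoint_index) auto
  also have "\<dots> = (\<Sum>a<n. mat_adjoint B $$ (i, a) * mat_adjoint A $$ (a, j))"
    unfolding index_mult_mat_sum[OF assms ij(2,1)] cnj_sum using assms ij by (intro sum.cong) auto
  finally show "mat_adjoint (A * B) $$ (i, j) = (mat_adjoint B * mat_adjoint A) $$ (i, j)"
    using assms ij by (subst index_mult_mat_sum[where n = n and m = n and l = n]) auto
qed (use assms in auto)

lemma U_set_carrier: "A \<in> U_set n \<Longrightarrow> A \<in> carrier_mat n n"
  by (simp add: U_set_def)

lemma SU_set_carrier: "A \<in> SU_set n \<Longrightarrow> A \<in> carrier_mat n n"
  by (simp add: SU_set_def U_set_def)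

lemma U_set_adjoint_mult: "A \<in> U_set n \<Longrightarrow> mat_adjoint A * A = 1\<^sub>m n"
  by (simp add: U_set_def)

lemma U_set_mult_adjoint: "A \<in> U_set n \<Longrightarrow> A * mat_adjoint A = 1\<^sub>m n"
  using mat_mult_left_right_inverse[of "mat_adjoint A" n A] by (simp add: U_set_def)

lemma U_set_cols:
  assumes "A \<in> U_set n" "i < n" "j < n"
  shows "(\<Sum>a<n. cnj (A $$ (a, i)) * A $$ (a, j)) = (if i = j then 1 else 0)"
proof -
  have "(mat_adjoint A * A) $$ (i, j) = (\<Sum>a<n. mat_adjoint A $$ (i, a) * A $$ (a, j))"
    using assms U_set_carrier[OF assms(1)] by (intro index_mult_mat_sum) auto
  also have "\<dots> = (\<Sum>a<n. cnj (A $$ (a, i)) * A $$ (a, j))"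
    using assms U_set_carrier[OF assms(1)] by (intro sum.cong) auto
  finally show ?thesis using U_set_adjoint_mult[OF assms(1)] assms by simp
qed

lemma U_set_rows:
  assumes "A \<in> U_set n" "i < n" "j < n"
  shows "(\<Sum>a<n. A $$ (i, a) * cnj (A $$ (j, a))) = (if i = j then 1 else 0)"
proof -
  have "(A * mat_adjoint A) $$ (i, j) = (\<Sum>a<n. A $$ (i, a) * mat_adjoint A $$ (a, j))"
    using assms U_set_carrier[OF assms(1)] by (intro index_mult_mat_sum) auto
  also have "\<dots> = (\<Sum>a<n. A $$ (i, a) * cnj (A $$ (j, a)))"
    using assms U_set_carrier[OF assms(1)] by (intro sum.cong) auto
  finally show ?thesis using U_set_mult_adjoint[OF assms(1)] assms by simp
qed

lemma U_setI:
  assumes A: "A \<in> carrier_mat n n"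
    and cols: "\<And>i j. i < n \<Longrightarrow> j < n \<Longrightarrow>
      (\<Sum>a<n. cnj (A $$ (a, i)) * A $$ (a, j)) = (if i = j then 1 else 0)"
  shows "A \<in> U_set n"
proof -
  have "mat_adjoint A * A = 1\<^sub>m n"
  proof (rule eq_matI)
    fix i j assume "i < dim_row (1\<^sub>m n :: complex mat)" "j < dim_col (1\<^sub>m n :: complex mat)"
    then have ij: "i < n" "j < n" by auto
    have "(mat_adjoint A * A) $$ (i, j) = (\<Sum>a<n. mat_adjoint A $$ (i, a) * A $$ (a, j))"
      using A ij by (intro index_mult_mat_sum) auto
    also have "\<dots> = (\<Sum>a<n. cnj (A $$ (a, i)) * A $$ (a, j))"
      using A ij by (intro sum.cong) auto
    finally show "(mat_adjoint A * A) $$ (i, j) = 1\<^sub>m n $$ (i, j)" using cols[OF ij] ij by simp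
  qed (use A in auto)
  then show ?thesis using A by (simp add: U_set_def)
qed

lemma U_set_mult:
  assumes "A \<in> U_set n" "B \<in> U_set n"
  shows "A * B \<in> U_set n"
proof -
  note A = U_set_carrier[OF assms(1)] and B = U_set_carrier[OF assms(2)]
  have "mat_adjoint (A * B) * (A * B) = mat_adjoint B * (mat_adjoint A * A * B)"
    unfolding mat_adjoint_mult[OF A B] using A B
    by (simp only: assoc_mult_mat[of _ n n _ n _ n] mult_carrier_mat[of _ n n _ n] mat_adjoint_carrier)
  also have "\<dots> = 1\<^sub>m n"
    using assms B by (simp add: U_set_adjoint_mult)
  finally show ?thesis using A B by (simp add: U_set_def)
qed

lemma U_set_adjoint: "A \<in> U_set n \<Longrightarrow> mat_adjoint A \<in> U_set n"
  using U_set_mult_adjoint[of A n] by (simp add: U_set_def)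

lemma U_set_one: "1\<^sub>m n \<in> U_set n"
proof -
  have "mat_adjoint (1\<^sub>m n) = (1\<^sub>m n :: complex mat)" by (intro eq_matI) auto
  then show ?thesis by (simp add: U_set_def)
qed

lemma SU_set_one: "1\<^sub>m n \<in> SU_set n"
  by (simp add: SU_set_def U_set_one)

lemma SU_set_mult: "A \<in> SU_set n \<Longrightarrow> B \<in> SU_set n \<Longrightarrow> A * B \<in> SU_set n"
  using det_mult[of A n B] by (simp add: SU_set_def U_set_mult U_set_carrier)

lemma SU_set_adjoint:
  assumes "A \<in> SU_set n"
  shows "mat_adjoint A \<in> SU_set n"
proof -
  have A: "A \<in> U_set n" "det A = 1" using assms by (auto simp: SU_set_def)
  have "det (mat_adjoint A * A) = det (mat_adjoint A) * det A"
    using U_set_carrier[OF A(1)] by (intro det_mult[of _ n]) auto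
  then have "det (mat_adjoint A) = 1" using A U_set_adjoint_mult[OF A(1)] by simp
  then show ?thesis using A by (simp add: SU_set_def U_set_adjoint)
qed

lemma U_set_det:
  assumes "A \<in> U_set n"
  shows "cnj (det A) * det A = 1"
proof -
  note A = U_set_carrier[OF assms]
  have "det (mat_adjoint A) = det (map_mat cnj (transpose_mat A))"
    using A by (intro arg_cong[of _ _ det] eq_matI) auto
  also have "\<dots> = cnj (det (transpose_mat A))"
    by (rule comm_ring_hom.hom_det) (unfold_locales, auto)
  finally have "det (mat_adjoint A) = cnj (det A)" using det_transpose[OF A] by simp
  moreover have "det (mat_adjoint A * A) = det (mat_adjoint A) * det A"
    using A by (intro det_mult[of _ n]) auto
  ultimately show ?thesis using U_set_adjoint_mult[OF assms] by simp
qed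

section \<open>Block-diagonal matrices and the groups \<open>K_set\<close>\<close>

definition block_diagonal :: "nat \<Rightarrow> nat \<Rightarrow> complex mat \<Rightarrow> bool" where
  "block_diagonal n k A \<longleftrightarrow> (\<forall>i<k. \<forall>j\<in>{k..<n}. A $$ (i, j) = 0 \<and> A $$ (j, i) = 0)"

definition sub_block :: "nat \<Rightarrow> nat \<Rightarrow> complex mat \<Rightarrow> complex mat" where
  "sub_block l d A = mat d d (\<lambda>(i, j). A $$ (l + i, l + j))"

lemma sub_block_carrier [simp]: "sub_block l d A \<in> carrier_mat d d"
  and sub_block_index [simp]: "i < d \<Longrightarrow> j < d \<Longrightarrow> sub_block l d A $$ (i, j) = A $$ (l + i, l + j)"
  and sub_block_dim [simp]: "dim_row (sub_block l d A) = d" "dim_col (sub_block l d A) = d"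
  by (simp_all add: sub_block_def)

declare diag_block_mat.simps(2) [simp del]

lemma diag_block_mat_two:
  assumes "A \<in> carrier_mat k k" "B \<in> carrier_mat m m"
  shows "diag_block_mat [A, B] = four_block_mat A (0\<^sub>m k m) (0\<^sub>m m k) (B :: complex mat)"
  using assms by (simp add: diag_block_mat.simps(2)[of A "[B]"])

lemma diag_block_mat_three:
  "diag_block_mat [A, diag_block_mat [B, C]] = diag_block_mat [A, B, C :: complex mat]"
  "diag_block_mat [diag_block_mat [A, B], C] = diag_block_mat [A, B, C]"
proof -
  show "diag_block_mat [A, diag_block_mat [B, C]] = diag_block_mat [A, B, C]"
    by (simp only: diag_block_mat.simps(2)[of A] diag_block_mat_singleton)
  have "diag_block_mat [diag_block_mat [A, B], C] = diag_block_mat ([A, B] @ [C])"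
    unfolding diag_block_mat_append by (simp only: diag_block_mat.simps(2)[of "diag_block_mat [A, B]"] diag_block_mat_singleton Let_def)
  then show "diag_block_mat [diag_block_mat [A, B], C] = diag_block_mat [A, B, C]" by simp
qed

lemma diag_block_mat_two_index:
  assumes "A \<in> carrier_mat k k" "B \<in> carrier_mat m m" "i < k + m" "j < k + m"
  shows "diag_block_mat [A, B :: complex mat] $$ (i, j) =
    (if i < k \<and> j < k then A $$ (i, j) else if k \<le> i \<and> k \<le> j then B $$ (i - k, j - k) else 0)"
  unfolding diag_block_mat_two[OF assms(1,2)] using assms by (subst index_mat_four_block(1)) auto

lemma diag_block_mat_two_carrier:
  assumes "A \<in> carrier_mat k k" "B \<in> carrier_mat m m"
  shows "diag_block_mat [A, B :: complex mat] \<in> carrier_mat (k + m) (k + m)"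
  unfolding diag_block_mat_two[OF assms] using assms by simp

lemma diag_block_mat_two_det:
  assumes "A \<in> carrier_mat k k" "B \<in> carrier_mat m m"
  shows "det (diag_block_mat [A, B :: complex mat]) = det A * det B"
  unfolding diag_block_mat_two[OF assms]
  by (rule det_four_block_mat_lower_left_zero) (use assms in auto)

lemma sum_lessThan_add:
  "(\<Sum>a<k + m. f a) = (\<Sum>a<k. f a) + (\<Sum>a<m. f (k + a :: nat) :: 'a :: comm_monoid_add)"
  by (induction m) (simp_all add: add.assoc)

lemma diag_block_mat_two_U:
  assumes "A \<in> U_set k" "B \<in> U_set m"
  shows "diag_block_mat [A, B] \<in> U_set (k + m)"
proof (rule U_setI)
  note carr = U_set_carrier[OF assms(1)] U_set_carrier[OF assms(2)]
  show "diag_block_mat [A, B] \<in> carrier_mat (k + m) (k + m)"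
    by (rule diag_block_mat_two_carrier[OF carr])
  fix i j assume ij: "i < k + m" "j < k + m"
  show "(\<Sum>a<k + m. cnj (diag_block_mat [A, B] $$ (a, i)) * diag_block_mat [A, B] $$ (a, j)) =
      (if i = j then 1 else 0)"
    using ij U_set_cols[OF assms(1), of i j] U_set_cols[OF assms(2), of "i - k" "j - k"]
    unfolding sum_lessThan_add
    by (cases "i < k"; cases "j < k") (auto simp: diag_block_mat_two_index[OF carr])
qed

lemma block_diagonal_diag_block_mat:
  assumes "A \<in> carrier_mat k k" "B \<in> carrier_mat m m"
  shows "block_diagonal (k + m) k (diag_block_mat [A, B])"
  unfolding block_diagonal_def by (auto simp: diag_block_mat_two_index[OF assms])

lemma block_diagonal_decompose:
  assumes "A \<in> carrier_mat (k + m) (k + m)" "block_diagonal (k + m) k A"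
  shows "A = diag_block_mat [sub_block 0 k A, sub_block k m A]"
proof (rule eq_matI)
  let ?D = "diag_block_mat [sub_block 0 k A, sub_block k m A]"
  have D: "?D \<in> carrier_mat (k + m) (k + m)" by (rule diag_block_mat_two_carrier) simp_all
  fix i j assume "i < dim_row ?D" "j < dim_col ?D"
  then have ij: "i < k + m" "j < k + m" using D by auto
  show "A $$ (i, j) = ?D $$ (i, j)"
    unfolding diag_block_mat_two_index[OF sub_block_carrier sub_block_carrier ij]
    using assms(2) ij by (auto simp: block_diagonal_def)
qed (use assms(1) diag_block_mat_two_carrier[OF sub_block_carrier sub_block_carrier, of 0 k A k m A] in auto)

lemma sub_block_U_set:
  assumes "A \<in> U_set (k + m)" "block_diagonal (k + m) k A"
  shows "sub_block 0 k A \<in> U_set k" "sub_block k m A \<in> U_set m"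
proof -
  show "sub_block 0 k A \<in> U_set k"
  proof (rule U_setI)
    fix i j assume ij: "i < k" "j < k"
    have "(\<Sum>a<m. cnj (A $$ (k + a, i)) * A $$ (k + a, j)) = 0"
      using assms(2) ij by (intro sum.neutral) (auto simp: block_diagonal_def)
    then show "(\<Sum>a<k. cnj (sub_block 0 k A $$ (a, i)) * sub_block 0 k A $$ (a, j)) = (if i = j then 1 else 0)"
      using U_set_cols[OF assms(1), of i j] ij unfolding sum_lessThan_add by simp
  qed simp
  show "sub_block k m A \<in> U_set m"
  proof (rule U_setI)
    fix i j assume ij: "i < m" "j < m"
    have "(\<Sum>a<k. cnj (A $$ (a, k + i)) * A $$ (a, k + j)) = 0"
      using assms(2) ij by (intro sum.neutral) (auto simp: block_diagonal_def)
    then show "(\<Sum>a<m. cnj (sub_block k m A $$ (a, i)) * sub_block k m A $$ (a, j)) = (if i = j then 1 else 0)"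
      using U_set_cols[OF assms(1), of "k + i" "k + j"] ij unfolding sum_lessThan_add by simp
  qed simp
qed

lemma S_blockI:
  "A = diag_block_mat As \<Longrightarrow> list_all2 (\<lambda>d A. A \<in> U_set d) ds As \<Longrightarrow> det A = 1 \<Longrightarrow> A \<in> S_block ds"
  unfolding S_block_def by auto

text \<open>Turns membership into a zero pattern, which can be checked entrywise for products,
  adjoints and rotations.\<close>

lemma K_set_iff:
  assumes "k \<le> n"
  shows "A \<in> K_set n k \<longleftrightarrow> A \<in> SU_set n \<and> block_diagonal n k A"
proof
  assume "A \<in> K_set n k"
  then obtain B C where BC: "B \<in> U_set k" "C \<in> U_set (n - k)" "A = diag_block_mat [B, C]" "det A = 1"
    unfolding K_set_def S_block_def by (auto simp: list_all2_Cons1)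
  then show "A \<in> SU_set n \<and> block_diagonal n k A"
    using diag_block_mat_two_U[OF BC(1,2)] block_diagonal_diag_block_mat[OF BC(1,2)[THEN U_set_carrier]] assms
    by (simp add: SU_set_def)
next
  assume A: "A \<in> SU_set n \<and> block_diagonal n k A"
  then have U: "A \<in> U_set (k + (n - k))" "block_diagonal (k + (n - k)) k A"
    using assms by (auto simp: SU_set_def)
  have "A = diag_block_mat [sub_block 0 k A, sub_block k (n - k) A]"
    by (rule block_diagonal_decompose[OF U_set_carrier[OF U(1)] U(2)])
  then show "A \<in> K_set n k"
    unfolding K_set_def by (rule S_blockI) (use A sub_block_U_set[OF U] in \<open>simp_all add: SU_set_def\<close>)
qed

text \<open>The zero patterns at \<open>k\<close> and at \<open>k + m\<close> together leave three
  blocks: the lower block of the first splitting is split once more, at \<open>m\<close>.\<close>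

lemma S_block_three:
  "S_block [k, m, 1] = K_set (k + m + 1) k \<inter> K_set (k + m + 1) (k + m)"
proof (intro subset_antisym subsetI)
  fix A assume "A \<in> S_block [k, m, 1]"
  then obtain B C D where BCD: "B \<in> U_set k" "C \<in> U_set m" "D \<in> U_set 1"
      "A = diag_block_mat [B, C, D]" "det A = 1"
    unfolding S_block_def by (auto simp: list_all2_Cons1)
  have A1: "A = diag_block_mat [B, diag_block_mat [C, D]]" and A2: "A = diag_block_mat [diag_block_mat [B, C], D]"
    using BCD(4) by (simp_all add: diag_block_mat_three)
  have CD: "diag_block_mat [C, D] \<in> U_set (m + 1)" and BC: "diag_block_mat [B, C] \<in> U_set (k + m)"
    using diag_block_mat_two_U BCD by blast+
  have "A \<in> SU_set (k + m + 1)"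
    using diag_block_mat_two_U[OF BC BCD(3)] BCD(5) unfolding A2[symmetric] by (simp add: SU_set_def)
  moreover have "block_diagonal (k + m + 1) k A"
    using block_diagonal_diag_block_mat[OF U_set_carrier[OF BCD(1)] U_set_carrier[OF CD]]
    unfolding A1[symmetric] by (simp add: add.assoc)
  moreover have "block_diagonal (k + m + 1) (k + m) A"
    using block_diagonal_diag_block_mat[OF U_set_carrier[OF BC] U_set_carrier[OF BCD(3)]]
    unfolding A2[symmetric] by simp
  ultimately show "A \<in> K_set (k + m + 1) k \<inter> K_set (k + m + 1) (k + m)"
    by (simp add: K_set_iff)
next
  fix A assume "A \<in> K_set (k + m + 1) k \<inter> K_set (k + m + 1) (k + m)"
  then have A: "A \<in> U_set (k + (m + 1))" "det A = 1" "block_diagonal (k + (m + 1)) k A"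
      "block_diagonal (k + m + 1) (k + m) A"
    by (auto simp: K_set_iff SU_set_def add.assoc)
  define B where "B = sub_block k (m + 1) A"
  have B: "B \<in> U_set (m + 1)" unfolding B_def by (rule sub_block_U_set[OF A(1,3)])
  have Bd: "block_diagonal (m + 1) m B"
    using A(4) unfolding B_def by (auto simp: block_diagonal_def)
  have "A = diag_block_mat [sub_block 0 k A, B]"
    unfolding B_def by (rule block_diagonal_decompose[OF U_set_carrier[OF A(1)] A(3)])
  also have "B = diag_block_mat [sub_block 0 m B, sub_block m 1 B]"
    by (rule block_diagonal_decompose[OF U_set_carrier[OF B] Bd])
  finally have "A = diag_block_mat [sub_block 0 k A, sub_block 0 m B, sub_block m 1 B]"
    by (simp add: diag_block_mat_three)
  then show "A \<in> S_block [k, m, 1]"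
    by (rule S_blockI) (use A(2) sub_block_U_set(1)[OF A(1,3)] sub_block_U_set[OF B Bd] in simp_all)
qed

lemma block_diagonal_adjoint:
  "A \<in> carrier_mat n n \<Longrightarrow> k \<le> n \<Longrightarrow> block_diagonal n k A \<Longrightarrow> block_diagonal n k (mat_adjoint A)"
  unfolding block_diagonal_def by auto

lemma block_diagonal_mult:
  assumes "A \<in> carrier_mat n n" "B \<in> carrier_mat n n" "k \<le> n" "block_diagonal n k A" "block_diagonal n k B"
  shows "block_diagonal n k (A * B)"
  unfolding block_diagonal_def
proof (intro allI impI ballI)
  fix i j assume ij: "i < k" "j \<in> {k..<n}"
  have "A $$ (i, a) * B $$ (a, j) = 0" "A $$ (j, a) * B $$ (a, i) = 0" if "a < n" for a
    using assms(4,5) ij that unfolding block_diagonal_def by (cases "a < k"; auto)+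
  then show "(A * B) $$ (i, j) = 0 \<and> (A * B) $$ (j, i) = 0"
    using ij assms(3) by (auto simp: index_mult_mat_sum[OF assms(1,2)] simp del: index_mult_mat intro!: sum.neutral)
qed

lemma K_set_mult: "k \<le> n \<Longrightarrow> A \<in> K_set n k \<Longrightarrow> B \<in> K_set n k \<Longrightarrow> A * B \<in> K_set n k"
  by (simp add: K_set_iff SU_set_mult block_diagonal_mult SU_set_carrier)

lemma K_set_adjoint: "k \<le> n \<Longrightarrow> A \<in> K_set n k \<Longrightarrow> mat_adjoint A \<in> K_set n k"
  by (simp add: K_set_iff SU_set_adjoint block_diagonal_adjoint SU_set_carrier)

lemma K_set_one: "k \<le> n \<Longrightarrow> 1\<^sub>m n \<in> K_set n k"
  by (auto simp: K_set_iff SU_set_one block_diagonal_def)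

section \<open>Cosets and last columns\<close>

lemma l_coset_mat_lie_group: "A <#\<^bsub>mat_lie_group n S\<^esub> H = {A * B | B. B \<in> H}"
  by (auto simp: l_coset_def mat_lie_group_def)

text \<open>The remaining entry of the last column has modulus one, so orthogonality of this column
  to the others clears the last row as well.\<close>

lemma K_set_last_if_last_col:
  assumes A: "A \<in> SU_set n" and n: "0 < n" and col: "\<And>i. i < n - 1 \<Longrightarrow> A $$ (i, n - 1) = 0"
  shows "A \<in> K_set n (n - 1)"
proof -
  have U: "A \<in> U_set n" using A by (simp add: SU_set_def)
  have "(\<Sum>a<n. cnj (A $$ (a, n - 1)) * A $$ (a, n - 1)) =
      (\<Sum>a<n. if a = n - 1 then cnj (A $$ (a, n - 1)) * A $$ (a, n - 1) else 0)"
    using col by (intro sum.cong) auto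
  then have corner: "cnj (A $$ (n - 1, n - 1)) * A $$ (n - 1, n - 1) = 1"
    using U_set_cols[OF U, of "n - 1" "n - 1"] n by simp
  have row: "A $$ (n - 1, j) = 0" if j: "j < n - 1" for j
  proof -
    have "(\<Sum>a<n. cnj (A $$ (a, n - 1)) * A $$ (a, j)) =
        (\<Sum>a<n. if a = n - 1 then cnj (A $$ (a, n - 1)) * A $$ (a, j) else 0)"
      using col by (intro sum.cong) auto
    then have "cnj (A $$ (n - 1, n - 1)) * A $$ (n - 1, j) = 0"
      using U_set_cols[OF U, of "n - 1" j] n j by simp
    then show ?thesis using corner by auto
  qed
  have "j = n - 1" if "j \<in> {n - 1..<n}" for j using that by auto
  then have "block_diagonal n (n - 1) A"
    unfolding block_diagonal_def using col row by blast
  then show ?thesis using A by (simp add: K_set_iff)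
qed

text \<open>The last column of \<open>mat_adjoint x * y\<close> consists of the inner products of
  the columns of \<open>x\<close> with the last column of \<open>y\<close>. All but the final one
  vanish exactly when the last column of \<open>y\<close> is a multiple of that of \<open>x\<close>.
  The group \<open>G\<close> is left general because the criterion serves both \<open>K_set\<close>
  and \<open>SU_set\<close>.\<close>

lemma coset_eq_iff_last_col:
  assumes G: "G \<subseteq> SU_set n" and n: "0 < n"
    and mult: "\<And>A B. A \<in> G \<Longrightarrow> B \<in> G \<Longrightarrow> A * B \<in> G"
    and adj: "\<And>A. A \<in> G \<Longrightarrow> mat_adjoint A \<in> G" and one: "1\<^sub>m n \<in> G"
    and x: "x \<in> G" and y: "y \<in> G"
  shows "x <#\<^bsub>mat_lie_group n G\<^esub> (G \<inter> K_set n (n - 1)) = y <#\<^bsub>mat_lie_group n G\<^esub> (G \<inter> K_set n (n - 1)) \<longleftrightarrow>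
    (\<exists>c. \<forall>i<n. y $$ (i, n - 1) = c * x $$ (i, n - 1))"
    (is "?L \<longleftrightarrow> ?R")
proof
  let ?H = "G \<inter> K_set n (n - 1)"
  have xU: "x \<in> U_set n" and xc: "x \<in> carrier_mat n n" and yc: "y \<in> carrier_mat n n"
    using x y G by (auto simp: SU_set_def U_set_def)
  have assoc: "A * (B * C) = A * B * C" if "A \<in> carrier_mat n n" "B \<in> carrier_mat n n" "C \<in> carrier_mat n n"
    for A B C :: "complex mat" using that by simp
  have Gc: "A \<in> carrier_mat n n" if "A \<in> G" for A using that G SU_set_carrier by blast
  show ?R if ?L
  proof -
    have "y * 1\<^sub>m n \<in> y <#\<^bsub>mat_lie_group n G\<^esub> ?H"
      unfolding l_coset_mat_lie_group using one K_set_one[of "n - 1" n] by auto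
    then have "y \<in> x <#\<^bsub>mat_lie_group n G\<^esub> ?H" using \<open>?L\<close> yc by simp
    then obtain h where h: "h \<in> ?H" "y = x * h" unfolding l_coset_mat_lie_group by auto
    have hc: "h \<in> carrier_mat n n" using h Gc by auto
    have "h $$ (a, n - 1) = 0" if "a < n - 1" for a
      using h n that by (auto simp: K_set_iff block_diagonal_def)
    then have "(\<Sum>a<n. x $$ (i, a) * h $$ (a, n - 1)) =
        (\<Sum>a<n. if a = n - 1 then x $$ (i, a) * h $$ (a, n - 1) else 0)" for i
      by (intro sum.cong) auto
    then have "y $$ (i, n - 1) = h $$ (n - 1, n - 1) * x $$ (i, n - 1)" if "i < n" for i
      unfolding h(2) using that n by (subst index_mult_mat_sum[OF xc hc]) (auto simp: mult.commute)
    then show ?R by blast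
  qed
  show ?L if ?R
  proof -
    obtain c where c: "\<And>i. i < n \<Longrightarrow> y $$ (i, n - 1) = c * x $$ (i, n - 1)" using \<open>?R\<close> by blast
    define h where "h = mat_adjoint x * y"
    have hG: "h \<in> G" unfolding h_def by (intro mult adj x y)
    have "h $$ (a, n - 1) = 0" if a: "a < n - 1" for a
    proof -
      have "h $$ (a, n - 1) = (\<Sum>b<n. mat_adjoint x $$ (a, b) * y $$ (b, n - 1))"
        unfolding h_def by (rule index_mult_mat_sum[of _ n n _ n]) (use a n xc yc in auto)
      also have "\<dots> = (\<Sum>b<n. c * (cnj (x $$ (b, a)) * x $$ (b, n - 1)))"
        by (intro sum.cong refl) (use a xc c in auto)
      also have "\<dots> = c * (\<Sum>b<n. cnj (x $$ (b, a)) * x $$ (b, n - 1))"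
        by (rule sum_distrib_left[symmetric])
      also have "\<dots> = 0" using U_set_cols[OF xU, of a "n - 1"] a by simp
      finally show ?thesis .
    qed
    then have "h \<in> K_set n (n - 1)" by (rule K_set_last_if_last_col[OF subsetD[OF G hG] n])
    then have h: "h \<in> ?H" using hG by simp
    have h': "mat_adjoint h \<in> ?H" using h adj K_set_adjoint[of "n - 1" n] by simp
    have hU: "h \<in> U_set n" using hG G by (auto simp: SU_set_def)
    have hc: "h \<in> carrier_mat n n" using Gc hG .
    have yx: "y = x * h"
      unfolding h_def assoc[OF xc mat_adjoint_carrier[OF xc] yc] U_set_mult_adjoint[OF xU] using yc by simp
    have "x * h * mat_adjoint h = x"
      unfolding assoc[OF xc hc mat_adjoint_carrier[OF hc], symmetric] U_set_mult_adjoint[OF hU] using xc by simp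
    then have xy: "x = y * mat_adjoint h" unfolding yx by (rule sym)
    have Hmult: "A * B \<in> ?H" if "A \<in> ?H" "B \<in> ?H" for A B
      using that mult K_set_mult[of "n - 1" n A B] by auto
    have "x * B \<in> y <#\<^bsub>mat_lie_group n G\<^esub> ?H" if B: "B \<in> ?H" for B
    proof -
      have "x * B = y * (mat_adjoint h * B)"
        unfolding assoc[OF yc mat_adjoint_carrier[OF hc] Gc[OF IntD1[OF B]]] xy[symmetric] ..
      with Hmult[OF h' B] show ?thesis unfolding l_coset_mat_lie_group by blast
    qed
    moreover have "y * B \<in> x <#\<^bsub>mat_lie_group n G\<^esub> ?H" if B: "B \<in> ?H" for B
    proof -
      have "y * B = x * (h * B)"
        unfolding assoc[OF xc hc Gc[OF IntD1[OF B]]] yx[symmetric] ..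
      then show ?thesis unfolding l_coset_mat_lie_group using Hmult[OF h B] by blast
    qed
    ultimately show ?L
      unfolding l_coset_mat_lie_group by (intro subset_antisym subsetI) (auto simp del: One_nat_def)
  qed
qed

section \<open>One-parameter groups\<close>

text \<open>Taking \<open>u\<close> to be the imaginary unit gives \<open>X_plus\<close>, and
  \<open>u = 1\<close> gives \<open>X_minus\<close>. Other \<open>u\<close> fill the real plane they
  span and arise when a generator is conjugated by a diagonal unitary matrix.\<close>

definition skew :: "nat \<Rightarrow> complex \<Rightarrow> nat \<Rightarrow> nat \<Rightarrow> complex mat" where
  "skew n u i j = mat n n (\<lambda>(a, b).
     (if a = i \<and> b = j then u else 0) - (if a = j \<and> b = i then cnj u else 0))"

lemma skew_carrier [simp]: "skew n u i j \<in> carrier_mat n n"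
  and skew_dim [simp]: "dim_row (skew n u i j) = n" "dim_col (skew n u i j) = n"
  by (simp_all add: skew_def)

lemma skew_index:
  "a < n \<Longrightarrow> b < n \<Longrightarrow> skew n u i j $$ (a, b) =
    (if a = i \<and> b = j then u else 0) - (if a = j \<and> b = i then cnj u else 0)"
  by (simp add: skew_def)

lemma X_plus_eq_skew: "X_plus n i j = skew n \<i> i j"
proof (rule eq_matI)
  have if_eq: "\<i> * ((if P then 1 else 0) + (if Q then 1 else 0)) = (if P then \<i> else 0) - (if Q then cnj \<i> else 0)"
    for P Q by (simp add: complex_eq_iff)
  fix a b assume "a < dim_row (skew n \<i> i j)" "b < dim_col (skew n \<i> i j)"
  then have ab: "a < n" "b < n" by auto
  have "X_plus n i j $$ (a, b) = \<i> * ((if a = i \<and> b = j then 1 else 0) + (if a = j \<and> b = i then 1 else 0))"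
    unfolding X_plus_def using ab by simp
  also have "\<dots> = skew n \<i> i j $$ (a, b)"
    unfolding skew_index[OF ab] by (rule if_eq)
  finally show "X_plus n i j $$ (a, b) = skew n \<i> i j $$ (a, b)" .
qed (simp_all add: X_plus_def)

lemma X_minus_eq_skew: "X_minus n i j = skew n 1 i j"
  by (rule eq_matI) (auto simp: X_minus_def skew_index)

text \<open>The one-parameter group \<open>t \<mapsto> exp (t X)\<close> for \<open>X = skew n u i j\<close> with \<open>|u| = 1\<close>.\<close>

definition rot :: "nat \<Rightarrow> complex \<Rightarrow> nat \<Rightarrow> nat \<Rightarrow> real \<Rightarrow> complex mat" where
  "rot n u i j t = mat n n (\<lambda>(a, b).
     if a = b then (if a = i \<or> a = j then of_real (cos t) else 1)
     else if a = i \<and> b = j then u * of_real (sin t)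
     else if a = j \<and> b = i then - cnj u * of_real (sin t) else 0)"

lemma rot_carrier [simp]: "rot n u i j t \<in> carrier_mat n n"
  and rot_dim [simp]: "dim_row (rot n u i j t) = n" "dim_col (rot n u i j t) = n"
  by (simp_all add: rot_def)

lemma rot_index:
  "a < n \<Longrightarrow> b < n \<Longrightarrow> rot n u i j t $$ (a, b) =
     (if a = b then (if a = i \<or> a = j then of_real (cos t) else 1)
     else if a = i \<and> b = j then u * of_real (sin t)
     else if a = j \<and> b = i then - cnj u * of_real (sin t) else 0)"
  by (simp add: rot_def)

lemma mult_rot_index:
  assumes M: "M \<in> carrier_mat n n" and ij: "i < n" "j < n" "i \<noteq> j" and pq: "p < n" "q < n"
  shows "(M * rot n u i j t) $$ (p, q) =
    (if q = i then of_real (cos t) * M $$ (p, i) - cnj u * of_real (sin t) * M $$ (p, j)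
     else if q = j then u * of_real (sin t) * M $$ (p, i) + of_real (cos t) * M $$ (p, j)
     else M $$ (p, q))"
proof -
  have "(M * rot n u i j t) $$ (p, q) = (\<Sum>a<n. M $$ (p, a) * rot n u i j t $$ (a, q))"
    by (rule index_mult_mat_sum) (use M pq in auto)
  also have "\<dots> = (\<Sum>a<n. (if a = i then (if q = i then of_real (cos t) * M $$ (p, i) else
        if q = j then u * of_real (sin t) * M $$ (p, i) else 0) else 0) +
      (if a = j then (if q = i then - cnj u * of_real (sin t) * M $$ (p, j) else
        if q = j then of_real (cos t) * M $$ (p, j) else 0) else 0) +
      (if a = q then (if q = i \<or> q = j then 0 else M $$ (p, q)) else 0))"
    using pq ij by (intro sum.cong) (auto simp: rot_index)
  also have "\<dots> = (if q = i then of_real (cos t) * M $$ (p, i) - cnj u * of_real (sin t) * M $$ (p, j)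
     else if q = j then u * of_real (sin t) * M $$ (p, i) + of_real (cos t) * M $$ (p, j)
     else M $$ (p, q))"
    unfolding sum.distrib using pq ij by simp
  finally show ?thesis .
qed

lemma rot_mult_index:
  assumes M: "M \<in> carrier_mat n n" and ij: "i < n" "j < n" "i \<noteq> j" and pq: "p < n" "q < n"
  shows "(rot n u i j t * M) $$ (p, q) =
    (if p = i then of_real (cos t) * M $$ (i, q) + u * of_real (sin t) * M $$ (j, q)
     else if p = j then - cnj u * of_real (sin t) * M $$ (i, q) + of_real (cos t) * M $$ (j, q)
     else M $$ (p, q))"
proof -
  have "(rot n u i j t * M) $$ (p, q) = (\<Sum>a<n. rot n u i j t $$ (p, a) * M $$ (a, q))"
    by (rule index_mult_mat_sum) (use M pq in auto)
  also have "\<dots> = (\<Sum>a<n. (if a = i then (if p = i then of_real (cos t) * M $$ (i, q) else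
        if p = j then - cnj u * of_real (sin t) * M $$ (i, q) else 0) else 0) +
      (if a = j then (if p = i then u * of_real (sin t) * M $$ (j, q) else
        if p = j then of_real (cos t) * M $$ (j, q) else 0) else 0) +
      (if a = p then (if p = i \<or> p = j then 0 else M $$ (p, q)) else 0))"
    using pq ij by (intro sum.cong) (auto simp: rot_index)
  also have "\<dots> = (if p = i then of_real (cos t) * M $$ (i, q) + u * of_real (sin t) * M $$ (j, q)
     else if p = j then - cnj u * of_real (sin t) * M $$ (i, q) + of_real (cos t) * M $$ (j, q)
     else M $$ (p, q))"
    unfolding sum.distrib using pq ij by simp
  finally show ?thesis .
qed

lemma rot_add:
  assumes "i < n" "j < n" "i \<noteq> j" and u: "u * cnj u = 1"
  shows "rot n u i j s * rot n u i j t = rot n u i j (s + t)"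
proof (rule eq_matI)
  fix p q assume "p < dim_row (rot n u i j (s + t))" "q < dim_col (rot n u i j (s + t))"
  then have pq: "p < n" "q < n" by auto
  have u': "u * (cnj u * z) = z" "cnj u * (u * z) = z" for z
    using u by (simp_all add: mult.assoc[symmetric] mult.commute)
  show "(rot n u i j s * rot n u i j t) $$ (p, q) = rot n u i j (s + t) $$ (p, q)"
    unfolding mult_rot_index[OF rot_carrier assms(1-3) pq]
    using assms(1-3) pq by (auto simp: rot_index cos_add sin_add algebra_simps u')
qed auto

lemma rot_zero: "rot n u i j 0 = 1\<^sub>m n"
  by (intro eq_matI) (auto simp: rot_index)

lemma rot_adjoint: "i \<noteq> j \<Longrightarrow> mat_adjoint (rot n u i j t) = rot n u i j (- t)"
  by (intro eq_matI) (auto simp: rot_index)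

lemma rot_U_set:
  assumes "i < n" "j < n" "i \<noteq> j" "u * cnj u = 1"
  shows "rot n u i j t \<in> U_set n"
  using rot_add[OF assms, of "- t" t] assms by (simp add: U_set_def rot_adjoint rot_zero)

lemma det_rot:
  assumes "i < n" "j < n" "i \<noteq> j" "u * cnj u = 1"
  shows "det (rot n u i j t) = 1"
proof -
  have dm: "det (A * B) = det A * det B" if "A \<in> carrier_mat n n" "B \<in> carrier_mat n n" for A B :: "complex mat"
    using that by (rule det_mult)
  \<comment> \<open>conjugation by the reflection \<open>D\<close> in the \<open>i\<close>-th coordinate inverts the rotation\<close>
  define D :: "complex mat" where "D = mat n n (\<lambda>(a, b). if a = b then (if a = i then - 1 else 1) else 0)"
  have D: "D \<in> carrier_mat n n" by (simp add: D_def)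
  have DM: "(D * M) $$ (p, q) = (if p = i then - M $$ (p, q) else M $$ (p, q))"
    if M: "M \<in> carrier_mat n n" and pq: "p < n" "q < n" for M p q
  proof -
    have "(D * M) $$ (p, q) = (\<Sum>a<n. D $$ (p, a) * M $$ (a, q))"
      by (rule index_mult_mat_sum[OF D M pq])
    also have "\<dots> = (\<Sum>a<n. if a = p then (if p = i then - M $$ (p, q) else M $$ (p, q)) else 0)"
      using pq by (intro sum.cong) (auto simp: D_def)
    finally show ?thesis using pq by simp
  qed
  have MD: "(M * D) $$ (p, q) = (if q = i then - M $$ (p, q) else M $$ (p, q))"
    if M: "M \<in> carrier_mat n n" and pq: "p < n" "q < n" for M p q
  proof -
    have "(M * D) $$ (p, q) = (\<Sum>a<n. M $$ (p, a) * D $$ (a, q))"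
      by (rule index_mult_mat_sum[OF M D pq])
    also have "\<dots> = (\<Sum>a<n. if a = q then (if q = i then - M $$ (p, q) else M $$ (p, q)) else 0)"
      using pq by (intro sum.cong) (auto simp: D_def)
    finally show ?thesis using pq by simp
  qed
  have "D * D = 1\<^sub>m n"
    by (rule eq_matI) (use D in \<open>auto simp: DM[OF D] simp del: index_mult_mat(1)\<close>, auto simp: D_def)
  then have DD: "det D * det D = 1" using dm[OF D D] by simp
  have inv: "det (rot n u i j t) = det (rot n u i j (- t))" for t
  proof -
    have "D * rot n u i j t = rot n u i j (- t) * D"
      by (rule eq_matI) (use D assms(3) in \<open>auto simp: DM MD rot_index simp del: index_mult_mat(1)\<close>)
    then have "det D * det (rot n u i j t) = det (rot n u i j (- t)) * det D"
      using dm[OF D rot_carrier[of n u i j t]] dm[OF rot_carrier[of n u i j "- t"] D] by (simp only:)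
    moreover have "det D \<noteq> 0" using DD by auto
    ultimately show ?thesis by (simp add: mult.commute)
  qed
  have sq: "det (rot n u i j t) * det (rot n u i j t) = 1" for t
    using dm[OF rot_carrier[of n u i j t] rot_carrier[of n u i j "- t"]] unfolding rot_add[OF assms] inv[of t, symmetric]
    by (simp add: rot_zero)
  \<comment> \<open>By \<open>sq\<close> every determinant squares to 1, which leaves the sign open.
    The sign is settled by writing the rotation by \<open>t\<close> as the square of the rotation by
    \<open>t / 2\<close>.\<close>
  have "det (rot n u i j (t / 2 + t / 2)) = 1"
    unfolding rot_add[OF assms, symmetric] dm[OF rot_carrier rot_carrier] by (rule sq)
  then show ?thesis by simp
qed

lemma rot_SU_set:
  "i < n \<Longrightarrow> j < n \<Longrightarrow> i \<noteq> j \<Longrightarrow> u * cnj u = 1 \<Longrightarrow> rot n u i j t \<in> SU_set n"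
  by (simp add: SU_set_def rot_U_set det_rot)

text \<open>The common shape of all curves below: translates of \<open>rot\<close> are affine in sin
  t and 1 - cos t. The second coefficient vanishes to second order at 0, so the velocity there is
  \<open>X\<close>.\<close>

definition curve :: "complex mat \<Rightarrow> complex mat \<Rightarrow> complex mat \<Rightarrow> real \<Rightarrow> complex mat" where
  "curve A X Y t = A + (of_real (sin t) \<cdot>\<^sub>m X + of_real (1 - cos t) \<cdot>\<^sub>m Y)"

text \<open>The diagonal entries cos t = 1 - (1 - cos t) account for the last matrix.\<close>

lemma rot_eq_curve:
  assumes "i < n" "j < n" "i \<noteq> j"
  shows "rot n u i j t = curve (1\<^sub>m n) (skew n u i j) (- (e_mat n i i + e_mat n j j)) t"
  unfolding curve_def using assms by (intro eq_matI) (auto simp: rot_index skew_index)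

lemma mult_curve:
  assumes "G \<in> carrier_mat n n" "A \<in> carrier_mat n n" "X \<in> carrier_mat n n" "Y \<in> carrier_mat n n"
  shows "G * curve A X Y t = curve (G * A) (G * X) (G * Y) t"
  unfolding curve_def
  using assms by (simp add: mult_add_distrib_mat[of _ n n _ n] mult_smult_distrib[of _ n n _ n])

lemma curve_mult:
  assumes "G \<in> carrier_mat n n" "A \<in> carrier_mat n n" "X \<in> carrier_mat n n" "Y \<in> carrier_mat n n"
  shows "curve A X Y t * G = curve (A * G) (X * G) (Y * G) t"
  unfolding curve_def
  using assms by (simp add: add_mult_distrib_mat[of _ n n _ _ n] mult_smult_assoc_mat[of _ n n _ n])

lemma curve_zero:
  assumes "A \<in> carrier_mat n n" "X \<in> carrier_mat n n" "Y \<in> carrier_mat n n"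
  shows "curve A X Y 0 = A"
  unfolding curve_def using assms by (intro eq_matI) auto

text \<open>A bound linear in \<open>t\<close> turns an error that is little-o of the matrix norm
  into one that is little-o of \<open>t\<close>.\<close>

lemma mat_norm_curve_le:
  assumes "X \<in> carrier_mat n n" "Y \<in> carrier_mat n n"
  shows "mat_norm n (of_real (sin t) \<cdot>\<^sub>m X + of_real (1 - cos t) \<cdot>\<^sub>m Y) \<le> (mat_norm n X + mat_norm n Y) * \<bar>t\<bar>"
proof -
  have s: "\<bar>sin t\<bar> \<le> \<bar>t\<bar>" by (rule abs_sin_x_le_abs_x)
  have "1 - cos t = 2 * (sin (t / 2))\<^sup>2" using cos_double_sin[of "t / 2"] by simp
  also have "\<dots> \<le> 2 * \<bar>sin (t / 2)\<bar>"
    using mult_right_mono[OF abs_sin_le_one[of "t / 2"] abs_ge_zero[of "sin (t / 2)"]]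
    by (simp add: power2_eq_square)
  also have "\<dots> \<le> \<bar>t\<bar>" using abs_sin_x_le_abs_x[of "t / 2"] by simp
  finally have c: "\<bar>1 - cos t\<bar> \<le> \<bar>t\<bar>" by simp
  have "mat_norm n (of_real (sin t) \<cdot>\<^sub>m X + of_real (1 - cos t) \<cdot>\<^sub>m Y) \<le>
      mat_norm n (of_real (sin t) \<cdot>\<^sub>m X) + mat_norm n (of_real (1 - cos t) \<cdot>\<^sub>m Y)"
    using assms by (intro mat_norm_add_le) auto
  also have "\<dots> = \<bar>sin t\<bar> * mat_norm n X + \<bar>1 - cos t\<bar> * mat_norm n Y"
    unfolding mat_norm_smult[OF assms(1)] mat_norm_smult[OF assms(2)] norm_of_real ..
  also have "\<dots> \<le> \<bar>t\<bar> * mat_norm n X + \<bar>t\<bar> * mat_norm n Y"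
    using s c by (intro add_mono mult_right_mono) auto
  finally show ?thesis by (simp add: algebra_simps)
qed

lemma filterlim_curve:
  assumes "X \<in> carrier_mat n n" "Y \<in> carrier_mat n n"
  shows "filterlim (\<lambda>t. of_real (sin t) \<cdot>\<^sub>m X + of_real (1 - cos t) \<cdot>\<^sub>m Y) (near_zero n) (at 0)"
proof (rule filterlim_near_zero)
  show "\<forall>\<^sub>F t in at 0. of_real (sin t) \<cdot>\<^sub>m X + of_real (1 - cos t) \<cdot>\<^sub>m Y \<in> carrier_mat n n"
    using assms by simp
  have "((\<lambda>t. (mat_norm n X + mat_norm n Y) * \<bar>t\<bar>) \<longlongrightarrow> 0) (at 0)"
    by (auto intro!: tendsto_eq_intros)
  then show "((\<lambda>t. mat_norm n (of_real (sin t) \<cdot>\<^sub>m X + of_real (1 - cos t) \<cdot>\<^sub>m Y)) \<longlongrightarrow> 0) (at 0)"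
    by (rule Lim_null_comparison[rotated]) (use mat_norm_curve_le[OF assms] in \<open>auto simp: always_eventually\<close>)
qed

lemma eventually_curve_in_open:
  assumes "openin (mat_topology n) W" "A \<in> W" "X \<in> carrier_mat n n" "Y \<in> carrier_mat n n"
  shows "\<forall>\<^sub>F t in at 0. curve A X Y t \<in> W"
proof -
  have "eventually (\<lambda>H. A + H \<in> W) (near_zero n)"
    using assms(1,2) unfolding openin_mat_topology eventually_near_zero by blast
  then show ?thesis
    using filterlim_curve[OF assms(3,4)] unfolding filterlim_iff curve_def by blast
qed

text \<open>Reduces values of a differential to ordinary derivatives in one variable, whose
  uniqueness is then available.\<close>

lemma has_differential_curve:
  assumes F: "has_differential n F A L" and A: "A \<in> carrier_mat n n"
    and XY: "X \<in> carrier_mat n n" "Y \<in> carrier_mat n n"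
  shows "((\<lambda>t. F (curve A X Y t)) has_real_derivative L X) (at 0)"
proof -
  let ?H = "\<lambda>t. of_real (sin t) \<cdot>\<^sub>m X + of_real (1 - cos t) \<cdot>\<^sub>m Y"
  have L: "real_linear n L" using F by (simp add: has_differential_def)
  have "(\<lambda>t. F (A + ?H t) - F A - L (?H t)) \<in> o[at 0](\<lambda>t. mat_norm n (?H t))"
    by (rule landau_o.small.compose[OF conjunct2[OF F[unfolded has_differential_iff_smallo]] filterlim_curve[OF XY]])
  moreover have "(\<lambda>t. mat_norm n (?H t)) \<in> O[at 0](\<lambda>t. t)"
    using mat_norm_curve_le[OF XY] by (intro bigoI[of _ "mat_norm n X + mat_norm n Y"]) (auto simp: always_eventually)
  ultimately have "(\<lambda>t. F (A + ?H t) - F A - L (?H t)) \<in> o[at 0](\<lambda>t. t)"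
    by (rule landau_o.small_big_trans)
  then have rem: "((\<lambda>t. (F (A + ?H t) - F A - L (?H t)) / t) \<longlongrightarrow> 0) (at 0)"
    by (rule smalloD_tendsto)
  have "((\<lambda>t. sin t * L X + (1 - cos t) * L Y) has_real_derivative L X) (at 0)"
    by (auto intro!: derivative_eq_intros)
  then have lin: "((\<lambda>t. (sin t * L X + (1 - cos t) * L Y) / t) \<longlongrightarrow> L X) (at 0)"
    by (simp add: has_field_derivative_iff)
  have LH: "L (?H t) = sin t * L X + (1 - cos t) * L Y" for t
    using real_linear_add[OF L, of "of_real (sin t) \<cdot>\<^sub>m X" "of_real (1 - cos t) \<cdot>\<^sub>m Y"]
      real_linear_scale[OF L XY(1), of "sin t"] real_linear_scale[OF L XY(2), of "1 - cos t"] XY by simp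
  have "((\<lambda>t. (F (curve A X Y t) - F (curve A X Y 0)) / t) \<longlongrightarrow> L X) (at 0)"
    using tendsto_add[OF rem lin] unfolding curve_zero[OF A XY] unfolding LH curve_def
    by (simp add: add_divide_distrib[symmetric])
  then show ?thesis unfolding has_field_derivative_iff by simp
qed

section \<open>The standard bivector\<close>

definition bivector_term ::
    "nat \<Rightarrow> complex mat \<Rightarrow> (complex mat \<Rightarrow> real) \<Rightarrow> (complex mat \<Rightarrow> real) \<Rightarrow> nat \<Rightarrow> nat \<Rightarrow> real" where
  "bivector_term n g \<alpha> \<beta> i j =
     wedge (g * skew n \<i> i j) (g * skew n 1 i j) \<alpha> \<beta> -
     wedge (skew n \<i> i j * g) (skew n 1 i j * g) \<alpha> \<beta>"

lemma std_bivector_eq_sum: "std_bivector n g \<alpha> \<beta> = (\<Sum>j<n. \<Sum>i<j. bivector_term n g \<alpha> \<beta> i j)"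
  unfolding std_bivector_def bivector_term_def X_plus_eq_skew X_minus_eq_skew
  by (simp only: sum_subtractf)

text \<open>Pairs are sorted by their position relative to \<open>k\<close>: both indices below,
  only the smaller one below, neither below.\<close>

lemma sum_triangle_add:
  fixes f :: "nat \<Rightarrow> nat \<Rightarrow> 'a :: comm_monoid_add"
  shows "(\<Sum>j<k + m. \<Sum>i<j. f i j) = (\<Sum>j<k. \<Sum>i<j. f i j) + (\<Sum>j<m. \<Sum>i<k. f i (k + j)) +
     (\<Sum>j<m. \<Sum>i<j. f (k + i) (k + j))"
  by (simp add: sum_lessThan_add sum.distrib add.assoc)

lemma bivector_term_cong:
  assumes "\<And>u. u = 1 \<or> u = \<i> \<Longrightarrow> \<alpha> (g * skew n u i j) = \<alpha>' (g * skew n u i j)"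
    and "\<And>u. u = 1 \<or> u = \<i> \<Longrightarrow> \<alpha> (skew n u i j * g) = \<alpha>' (skew n u i j * g)"
    and "\<And>u. u = 1 \<or> u = \<i> \<Longrightarrow> \<beta> (g * skew n u i j) = \<beta>' (g * skew n u i j)"
    and "\<And>u. u = 1 \<or> u = \<i> \<Longrightarrow> \<beta> (skew n u i j * g) = \<beta>' (skew n u i j * g)"
  shows "bivector_term n g \<alpha> \<beta> i j = bivector_term n g \<alpha>' \<beta>' i j"
  unfolding bivector_term_def wedge_def using assms by (simp only: simp_thms)

text \<open>If \<open>\<alpha>\<close> is the real part of a complex-linear form on the plane of the \<open>X\<^sub>u\<close>, the wedge is the
  imaginary part of a Hermitian form; this makes its unitary invariance visible.\<close>

lemma wedge_eq_Im:
  assumes "\<And>u. \<alpha> (X u) = Re (u * a)" "\<And>u. \<beta> (X u) = Re (u * b)"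
  shows "wedge (X \<i>) (X 1) \<alpha> \<beta> = Im (cnj a * b)"
  unfolding wedge_def assms by simp

text \<open>Parseval: a matrix \<open>V\<close> with orthonormal rows preserves the Hermitian form.
  The index type is arbitrary because \<open>V\<close> will be indexed by pairs.\<close>

lemma sum_unitary:
  fixes V :: "'i \<Rightarrow> 'i \<Rightarrow> complex"
  assumes I: "finite I"
    and V: "\<And>p p'. p \<in> I \<Longrightarrow> p' \<in> I \<Longrightarrow> (\<Sum>q\<in>I. cnj (V p q) * V p' q) = (if p = p' then 1 else 0)"
  shows "(\<Sum>q\<in>I. cnj (\<Sum>p\<in>I. V p q * a p) * (\<Sum>p\<in>I. V p q * b p)) = (\<Sum>p\<in>I. cnj (a p) * b p)"
proof -
  have "(\<Sum>q\<in>I. cnj (\<Sum>p\<in>I. V p q * a p) * (\<Sum>p\<in>I. V p q * b p)) =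
      (\<Sum>q\<in>I. \<Sum>p\<in>I. \<Sum>p'\<in>I. cnj (a p) * b p' * (cnj (V p q) * V p' q))"
    unfolding cnj_sum sum_product by (intro sum.cong refl) (simp add: mult_ac)
  also have "\<dots> = (\<Sum>p\<in>I. \<Sum>p'\<in>I. \<Sum>q\<in>I. cnj (a p) * b p' * (cnj (V p q) * V p' q))"
    by (subst sum.swap) (intro sum.cong refl sum.swap)
  also have "\<dots> = (\<Sum>p\<in>I. \<Sum>p'\<in>I. if p = p' then cnj (a p) * b p' else 0)"
    unfolding sum_distrib_left[symmetric] by (intro sum.cong refl) (simp add: V)
  also have "\<dots> = (\<Sum>p\<in>I. cnj (a p) * b p)"
    using I by (intro sum.cong refl) simp
  finally show ?thesis .
qed

lemma skew_eq_combination: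
  "skew n w i j = of_real (Re w) \<cdot>\<^sub>m skew n 1 i j + of_real (Im w) \<cdot>\<^sub>m skew n \<i> i j"
proof (rule eq_matI)
  have if_eq: "(if P then w else 0) - (if Q then cnj w else 0) =
    of_real (Re w) * ((if P then 1 else 0) - (if Q then cnj 1 else 0)) +
    of_real (Im w) * ((if P then \<i> else 0) - (if Q then cnj \<i> else 0))" for P Q
    by (simp add: complex_eq_iff)
  fix a b assume "a < dim_row (of_real (Re w) \<cdot>\<^sub>m skew n 1 i j + of_real (Im w) \<cdot>\<^sub>m skew n \<i> i j)"
    "b < dim_col (of_real (Re w) \<cdot>\<^sub>m skew n 1 i j + of_real (Im w) \<cdot>\<^sub>m skew n \<i> i j)"
  then have ab: "a < n" "b < n" by auto
  then have "(of_real (Re w) \<cdot>\<^sub>m skew n 1 i j + of_real (Im w) \<cdot>\<^sub>m skew n \<i> i j) $$ (a, b) =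
      of_real (Re w) * skew n 1 i j $$ (a, b) + of_real (Im w) * skew n \<i> i j $$ (a, b)"
    by simp
  then show "skew n w i j $$ (a, b) = (of_real (Re w) \<cdot>\<^sub>m skew n 1 i j + of_real (Im w) \<cdot>\<^sub>m skew n \<i> i j) $$ (a, b)"
    unfolding skew_index[OF ab] if_eq[symmetric] by (rule sym)
qed simp_all

text \<open>On a real plane parametrised by \<open>w\<close>, a real-linear form is the real part of
  a complex-linear one. The minus sign in the coefficient comes from Re (i (p + i q)) = - q.\<close>

lemma real_linear_mult_skew:
  assumes L: "real_linear n \<alpha>" and g: "g \<in> carrier_mat n n"
  shows "\<alpha> (g * skew n w i j) = Re (w * Complex (\<alpha> (g * skew n 1 i j)) (- \<alpha> (g * skew n \<i> i j)))"
proof -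
  have "g * skew n w i j = of_real (Re w) \<cdot>\<^sub>m (g * skew n 1 i j) + of_real (Im w) \<cdot>\<^sub>m (g * skew n \<i> i j)"
    unfolding skew_eq_combination[of n w] using g
    by (simp add: mult_add_distrib_mat[of _ n n _ n] mult_smult_distrib[of _ n n _ n])
  then show ?thesis
    using real_linear_add[OF L, of "of_real (Re w) \<cdot>\<^sub>m (g * skew n 1 i j)" "of_real (Im w) \<cdot>\<^sub>m (g * skew n \<i> i j)"]
      real_linear_scale[OF L, of "g * skew n 1 i j"] real_linear_scale[OF L, of "g * skew n \<i> i j"]
      mult_carrier_mat[OF g skew_carrier, of 1 i j] mult_carrier_mat[OF g skew_carrier, of \<i> i j]
    by simp
qed

lemma real_linear_skew_mult:
  assumes L: "real_linear n \<alpha>" and g: "g \<in> carrier_mat n n"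
  shows "\<alpha> (skew n w i j * g) = Re (w * Complex (\<alpha> (skew n 1 i j * g)) (- \<alpha> (skew n \<i> i j * g)))"
proof -
  have "skew n w i j * g = of_real (Re w) \<cdot>\<^sub>m (skew n 1 i j * g) + of_real (Im w) \<cdot>\<^sub>m (skew n \<i> i j * g)"
    unfolding skew_eq_combination[of n w] using g
    by (simp add: add_mult_distrib_mat[of _ n n _ _ n] mult_smult_assoc_mat[of _ n n _ n])
  then show ?thesis
    using real_linear_add[OF L, of "of_real (Re w) \<cdot>\<^sub>m (skew n 1 i j * g)" "of_real (Im w) \<cdot>\<^sub>m (skew n \<i> i j * g)"]
      real_linear_scale[OF L, of "skew n 1 i j * g"] real_linear_scale[OF L, of "skew n \<i> i j * g"]
      mult_carrier_mat[OF skew_carrier g, of 1 i j] mult_carrier_mat[OF skew_carrier g, of \<i> i j]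
    by simp
qed

text \<open>Every generator is the skew-Hermitian part, up to a factor, of a multiple of a matrix
  unit. This lets a functional of generators be expanded as a functional of an unconstrained
  matrix.\<close>

lemma e_mat_skew:
  "u \<cdot>\<^sub>m e_mat n a b - mat_adjoint (u \<cdot>\<^sub>m e_mat n a b) = skew n u a b"
proof (rule eq_matI)
  have if_eq: "u * (if P then 1 else 0) - cnj (u * (if Q then 1 else 0)) =
    (if P then u else 0) - (if Q then cnj u else 0)" for P Q by simp
  fix p q assume "p < dim_row (skew n u a b)" "q < dim_col (skew n u a b)"
  then have pq: "p < n" "q < n" by auto
  then have "(u \<cdot>\<^sub>m e_mat n a b - mat_adjoint (u \<cdot>\<^sub>m e_mat n a b)) $$ (p, q) =
      u * e_mat n a b $$ (p, q) - cnj (u * e_mat n a b $$ (q, p))"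
    by (simp del: e_mat_index)
  also have "\<dots> = skew n u a b $$ (p, q)"
    unfolding skew_index[OF pq] e_mat_index[OF pq] e_mat_index[OF pq(2,1)] if_eq conj_commute[of "q = a"] ..
  finally show "(u \<cdot>\<^sub>m e_mat n a b - mat_adjoint (u \<cdot>\<^sub>m e_mat n a b)) $$ (p, q) = skew n u a b $$ (p, q)" .
qed simp_all

lemma mult_skew_index:
  assumes x: "x \<in> carrier_mat n n" and ij: "i < n" "j < n" and pq: "p < n" "q < n"
  shows "(x * skew n u i j) $$ (p, q) = (if q = j then u * x $$ (p, i) else 0) - (if q = i then cnj u * x $$ (p, j) else 0)"
proof -
  have "(x * skew n u i j) $$ (p, q) = (\<Sum>a<n. x $$ (p, a) * skew n u i j $$ (a, q))"
    by (rule index_mult_mat_sum[OF x skew_carrier pq])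
  also have "\<dots> = (\<Sum>a<n. (if a = i then (if q = j then u * x $$ (p, i) else 0) else 0) -
      (if a = j then (if q = i then cnj u * x $$ (p, j) else 0) else 0))"
    using pq by (intro sum.cong) (auto simp: skew_index algebra_simps)
  also have "\<dots> = (if q = j then u * x $$ (p, i) else 0) - (if q = i then cnj u * x $$ (p, j) else 0)"
    unfolding sum_subtractf using ij by simp
  finally show ?thesis .
qed

text \<open>For block-diagonal unitary \<open>x\<close> with blocks \<open>A\<close>, \<open>B\<close>, conjugation by \<open>x\<close> acts on the
  off-diagonal block by the unitary map \<open>Z \<mapsto> A Z B\<^sup>*\<close>.\<close>

lemma real_linear_conj_skew:
  assumes L: "real_linear (k + m) \<alpha>" and x: "x \<in> U_set (k + m)" "block_diagonal (k + m) k x"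
    and ij: "i < k" "j < m"
  shows "\<alpha> (x * skew (k + m) u i (k + j)) =
    Re (u * (\<Sum>(a, b)\<in>{..<k} \<times> {..<m}. x $$ (a, i) * cnj (x $$ (k + b, k + j)) *
      Complex (\<alpha> (skew (k + m) 1 a (k + b) * x)) (- \<alpha> (skew (k + m) \<i> a (k + b) * x))))"
proof -
  let ?n = "k + m"
  let ?I = "(\<lambda>(a, b). (a, k + b)) ` ({..<k} \<times> {..<m})"
  have xc: "x \<in> carrier_mat ?n ?n" using x U_set_carrier by blast
  \<comment> \<open>Subtracting the adjoint makes any \<open>Z\<close> skew-Hermitian, so
    \<open>L\<close> is real-linear on all matrices and its expansion over matrix units is an
    expansion over generators.\<close>
  define L where "L Z = \<alpha> ((Z - mat_adjoint Z) * x)" for Z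
  \<comment> \<open>The matrix \<open>Z\<close> is \<open>u\<close> times column \<open>i\<close> of
    \<open>x\<close> times the conjugate transpose of column \<open>k + j\<close>, chosen so that
    \<open>Z - mat_adjoint Z\<close> is the generator conjugated by \<open>x\<close>.
    Block-diagonality of \<open>x\<close> confines this outer product to the upper right
    block.\<close>
  define f where "f = (\<lambda>(a, b). u * x $$ (a, i) * cnj (x $$ (b, k + j)))"
  define Z where "Z = mat ?n ?n (\<lambda>p. if p \<in> ?I then f p else 0)"
  have Zc: "Z \<in> carrier_mat ?n ?n" by (simp add: Z_def)
  have I: "(a, b) \<in> ?I \<longleftrightarrow> a < k \<and> k \<le> b" if "b < ?n" for a b
  proof
    assume "a < k \<and> k \<le> b"
    then show "(a, b) \<in> ?I" using that by (intro image_eqI[of _ _ "(a, b - k)"]) auto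
  qed auto
  have Z: "Z $$ (a, b) = u * x $$ (a, i) * cnj (x $$ (b, k + j))" if "a < ?n" "b < ?n" for a b
    using that x(2) ij unfolding Z_def f_def block_diagonal_def by (auto simp: I)
  have "real_linear ?n L"
    unfolding real_linear_def
  proof (intro conjI ballI allI)
    fix X Y :: "complex mat" assume XY: "X \<in> carrier_mat ?n ?n" "Y \<in> carrier_mat ?n ?n"
    have "X + Y - mat_adjoint (X + Y) = (X - mat_adjoint X) + (Y - mat_adjoint Y)"
      using XY by (intro eq_matI) auto
    moreover have "X - mat_adjoint X \<in> carrier_mat ?n ?n" "Y - mat_adjoint Y \<in> carrier_mat ?n ?n"
      using XY by (auto intro: minus_carrier_mat)
    ultimately show "L (X + Y) = L X + L Y"
      unfolding L_def using real_linear_add[OF assms(1)] xc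
      by (simp add: add_mult_distrib_mat[of _ ?n ?n _ _ ?n])
  next
    fix X :: "complex mat" and c assume X: "X \<in> carrier_mat ?n ?n"
    have "of_real c \<cdot>\<^sub>m X - mat_adjoint (of_real c \<cdot>\<^sub>m X) = of_real c \<cdot>\<^sub>m (X - mat_adjoint X)"
      using X by (intro eq_matI) (auto simp: algebra_simps)
    moreover have "X - mat_adjoint X \<in> carrier_mat ?n ?n"
      using X by (auto intro: minus_carrier_mat)
    ultimately show "L (of_real c \<cdot>\<^sub>m X) = c * L X"
      unfolding L_def using real_linear_scale[OF assms(1)] xc
      by (simp add: mult_smult_assoc_mat[of _ ?n ?n _ ?n])
  qed
  then have "L Z = (\<Sum>(a, b)\<in>?I. Re (f (a, b)) * L (e_mat ?n a b) + Im (f (a, b)) * L (\<i> \<cdot>\<^sub>m e_mat ?n a b))"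
    unfolding Z_def by (rule real_linear_supported_expansion) auto
  also have "\<dots> = (\<Sum>(a, b)\<in>{..<k} \<times> {..<m}.
      Re (f (a, k + b)) * L (e_mat ?n a (k + b)) + Im (f (a, k + b)) * L (\<i> \<cdot>\<^sub>m e_mat ?n a (k + b)))"
    by (subst sum.reindex) (auto simp: inj_on_def case_prod_unfold)
  also have "\<dots> = (\<Sum>(a, b)\<in>{..<k} \<times> {..<m}. Re (u * (x $$ (a, i) * cnj (x $$ (k + b, k + j)) *
      Complex (\<alpha> (skew ?n 1 a (k + b) * x)) (- \<alpha> (skew ?n \<i> a (k + b) * x)))))"
  proof (intro sum.cong refl, clarify)
    fix a b assume ab: "a < k" "b < m"
    have "1 \<cdot>\<^sub>m e_mat ?n a (k + b) = e_mat ?n a (k + b)" by (rule eq_matI) simp_all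
    then have "e_mat ?n a (k + b) - mat_adjoint (e_mat ?n a (k + b)) = skew ?n 1 a (k + b)"
      using e_mat_skew[of 1 ?n a "k + b"] by (simp only:)
    then have "L (e_mat ?n a (k + b)) = \<alpha> (skew ?n 1 a (k + b) * x)" by (simp add: L_def)
    moreover have "L (\<i> \<cdot>\<^sub>m e_mat ?n a (k + b)) = \<alpha> (skew ?n \<i> a (k + b) * x)"
      unfolding L_def e_mat_skew ..
    ultimately show "Re (f (a, k + b)) * L (e_mat ?n a (k + b)) + Im (f (a, k + b)) * L (\<i> \<cdot>\<^sub>m e_mat ?n a (k + b)) =
      Re (u * (x $$ (a, i) * cnj (x $$ (k + b, k + j)) *
      Complex (\<alpha> (skew ?n 1 a (k + b) * x)) (- \<alpha> (skew ?n \<i> a (k + b) * x))))"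
      unfolding f_def by (simp add: mult.assoc[symmetric])
  qed
  also have "\<dots> = Re (u * (\<Sum>(a, b)\<in>{..<k} \<times> {..<m}. x $$ (a, i) * cnj (x $$ (k + b, k + j)) *
      Complex (\<alpha> (skew ?n 1 a (k + b) * x)) (- \<alpha> (skew ?n \<i> a (k + b) * x))))"
    unfolding sum_distrib_left Re_sum case_prod_unfold ..
  finally have LZ: "L Z = \<dots>" .
  \<comment> \<open>Multiplication by \<open>x\<close> turns the conjugated columns into Kronecker
    deltas, by orthonormality of the columns of \<open>x\<close>.\<close>
  have "(Z - mat_adjoint Z) * x = x * skew ?n u i (k + j)"
  proof (rule eq_matI)
    fix p q assume "p < dim_row (x * skew ?n u i (k + j))" "q < dim_col (x * skew ?n u i (k + j))"
    then have pq: "p < ?n" "q < ?n" using xc by auto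
    have ij': "i < ?n" "k + j < ?n" using ij by auto
    have "((Z - mat_adjoint Z) * x) $$ (p, q) = (\<Sum>b<?n. (Z - mat_adjoint Z) $$ (p, b) * x $$ (b, q))"
      by (rule index_mult_mat_sum[OF _ xc pq]) (use Zc in \<open>auto intro: minus_carrier_mat\<close>)
    also have "\<dots> = (\<Sum>b<?n. u * x $$ (p, i) * (cnj (x $$ (b, k + j)) * x $$ (b, q)) -
        cnj u * x $$ (p, k + j) * (cnj (x $$ (b, i)) * x $$ (b, q)))"
      using Zc pq by (intro sum.cong refl) (simp add: Z algebra_simps)
    also have "\<dots> = u * x $$ (p, i) * (if k + j = q then 1 else 0) - cnj u * x $$ (p, k + j) * (if i = q then 1 else 0)"
      unfolding sum_subtractf sum_distrib_left[symmetric] U_set_cols[OF x(1) ij'(2) pq(2)] U_set_cols[OF x(1) ij'(1) pq(2)] ..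
    also have "\<dots> = (x * skew ?n u i (k + j)) $$ (p, q)"
      unfolding mult_skew_index[OF xc ij' pq] by auto
    finally show "((Z - mat_adjoint Z) * x) $$ (p, q) = (x * skew ?n u i (k + j)) $$ (p, q)" .
  qed (use xc Zc in auto)
  then show ?thesis using LZ unfolding L_def by (simp only:)
qed

text \<open>The coefficients of a covector for left translation arise from those for right
  translation through \<open>V\<close>, the tensor product of \<open>A\<close> with the conjugate of
  \<open>B\<close>. As \<open>V\<close> is unitary, the Hermitian forms have equal totals. The
  covectors are arbitrary, so this disposes of directions not tangent to
  \<open>K_set\<close>.\<close>

lemma sum_off_diagonal_bivector_terms:
  assumes L: "real_linear (k + m) \<alpha>" "real_linear (k + m) \<beta>"
    and x: "x \<in> U_set (k + m)" "block_diagonal (k + m) k x"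
  shows "(\<Sum>j<m. \<Sum>i<k. bivector_term (k + m) x \<alpha> \<beta> i (k + j)) = 0"
proof -
  let ?n = "k + m" and ?I = "{..<k} \<times> {..<m}"
  have xc: "x \<in> carrier_mat ?n ?n" using x U_set_carrier by blast
  define c where "c \<gamma> p = Complex (\<gamma> (skew ?n 1 (fst p) (k + snd p) * x)) (- \<gamma> (skew ?n \<i> (fst p) (k + snd p) * x))"
    for \<gamma> :: "complex mat \<Rightarrow> real" and p
  define V where "V p q = x $$ (fst p, fst q) * cnj (x $$ (k + snd p, k + snd q))" for p q :: "nat \<times> nat"
  have left: "\<gamma> (x * skew ?n u (fst q) (k + snd q)) = Re (u * (\<Sum>p\<in>?I. V p q * c \<gamma> p))"
    if "real_linear ?n \<gamma>" "q \<in> ?I" for \<gamma> q u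
    using real_linear_conj_skew[OF that(1) x, of "fst q" "snd q" u] that(2)
    unfolding V_def c_def case_prod_unfold by auto
  have right: "\<gamma> (skew ?n u (fst q) (k + snd q) * x) = Re (u * c \<gamma> q)"
    if "real_linear ?n \<gamma>" for \<gamma> q u
    unfolding c_def by (rule real_linear_skew_mult[OF that xc])
  have V: "(\<Sum>q\<in>?I. cnj (V p q) * V p' q) = (if p = p' then 1 else 0)" if p: "p \<in> ?I" "p' \<in> ?I" for p p'
  proof -
    have A: "(\<Sum>i<k. x $$ (fst p', i) * cnj (x $$ (fst p, i))) = (if fst p' = fst p then 1 else 0)"
      using U_set_rows[OF sub_block_U_set(1)[OF x], of "fst p'" "fst p"] p by auto
    have B: "(\<Sum>j<m. x $$ (k + snd p, k + j) * cnj (x $$ (k + snd p', k + j))) = (if snd p = snd p' then 1 else 0)"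
      using U_set_rows[OF sub_block_U_set(2)[OF x], of "snd p" "snd p'"] p by auto
    have "(\<Sum>q\<in>?I. cnj (V p q) * V p' q) = (\<Sum>i<k. \<Sum>j<m. (x $$ (fst p', i) * cnj (x $$ (fst p, i))) *
        (x $$ (k + snd p, k + j) * cnj (x $$ (k + snd p', k + j))))"
      unfolding sum.cartesian_product V_def case_prod_unfold by (intro sum.cong refl) (simp add: mult_ac)
    also have "\<dots> = (if fst p' = fst p then 1 else 0) * (if snd p = snd p' then 1 else 0)"
      unfolding sum_product[symmetric] A B ..
    also have "\<dots> = (if p = p' then 1 else 0)" by (auto simp: prod_eq_iff)
    finally show ?thesis .
  qed
  have "(\<Sum>j<m. \<Sum>i<k. bivector_term ?n x \<alpha> \<beta> i (k + j)) =
      (\<Sum>q\<in>?I. bivector_term ?n x \<alpha> \<beta> (fst q) (k + snd q))"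
    by (subst sum.swap) (simp add: sum.cartesian_product case_prod_unfold)
  also have "\<dots> = (\<Sum>q\<in>?I. Im (cnj (\<Sum>p\<in>?I. V p q * c \<alpha> p) * (\<Sum>p\<in>?I. V p q * c \<beta> p)) - Im (cnj (c \<alpha> q) * c \<beta> q))"
  proof (rule sum.cong[OF refl])
    fix q assume q: "q \<in> ?I"
    have "wedge (x * skew ?n \<i> (fst q) (k + snd q)) (x * skew ?n 1 (fst q) (k + snd q)) \<alpha> \<beta> =
        Im (cnj (\<Sum>p\<in>?I. V p q * c \<alpha> p) * (\<Sum>p\<in>?I. V p q * c \<beta> p))"
      by (rule wedge_eq_Im) (rule left[OF L(1) q] left[OF L(2) q])+
    moreover have "wedge (skew ?n \<i> (fst q) (k + snd q) * x) (skew ?n 1 (fst q) (k + snd q) * x) \<alpha> \<beta> =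
        Im (cnj (c \<alpha> q) * c \<beta> q)"
      by (rule wedge_eq_Im) (rule right[OF L(1)] right[OF L(2)])+
    ultimately show "bivector_term ?n x \<alpha> \<beta> (fst q) (k + snd q) =
        Im (cnj (\<Sum>p\<in>?I. V p q * c \<alpha> p) * (\<Sum>p\<in>?I. V p q * c \<beta> p)) - Im (cnj (c \<alpha> q) * c \<beta> q)"
      unfolding bivector_term_def by (simp only:)
  qed
  also have "\<dots> = Im ((\<Sum>q\<in>?I. cnj (\<Sum>p\<in>?I. V p q * c \<alpha> p) * (\<Sum>p\<in>?I. V p q * c \<beta> p)) -
      (\<Sum>q\<in>?I. cnj (c \<alpha> q) * c \<beta> q))"
    by (simp only: sum_subtractf Im_sum minus_complex.sel)
  also have "\<dots> = 0" by (subst sum_unitary[of ?I V]) (simp_all add: V)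
  finally show ?thesis .
qed

lemma std_bivector_block_diagonal:
  assumes "real_linear (k + m) \<alpha>" "real_linear (k + m) \<beta>" "x \<in> U_set (k + m)" "block_diagonal (k + m) k x"
  shows "std_bivector (k + m) x \<alpha> \<beta> = (\<Sum>j<k. \<Sum>i<j. bivector_term (k + m) x \<alpha> \<beta> i j) +
    (\<Sum>j<m. \<Sum>i<j. bivector_term (k + m) x \<alpha> \<beta> (k + i) (k + j))"
  unfolding std_bivector_eq_sum sum_triangle_add[of _ k m] sum_off_diagonal_bivector_terms[OF assms] by simp

section \<open>Tangent directions and tangency of the bivector\<close>

definition tangent_to :: "nat \<Rightarrow> complex mat set \<Rightarrow> complex mat \<Rightarrow> complex mat \<Rightarrow> bool" where
  "tangent_to n S g X \<longleftrightarrow> X \<in> carrier_mat n n \<and> (\<exists>Y\<in>carrier_mat n n. \<forall>t. curve g X Y t \<in> S)"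

lemma mult_rot_eq_curve:
  assumes "g \<in> carrier_mat n n" "i < n" "j < n" "i \<noteq> j"
  shows "g * rot n u i j t = curve g (g * skew n u i j) (g * - (e_mat n i i + e_mat n j j)) t"
  unfolding rot_eq_curve[OF assms(2-4)] using assms(1) by (subst mult_curve[of _ n]) auto

lemma rot_mult_eq_curve:
  assumes "g \<in> carrier_mat n n" "i < n" "j < n" "i \<noteq> j"
  shows "rot n u i j t * g = curve g (skew n u i j * g) (- (e_mat n i i + e_mat n j j) * g) t"
  unfolding rot_eq_curve[OF assms(2-4)] using assms(1) by (subst curve_mult[of _ n]) auto

lemma tangent_to_mult_skew:
  assumes "g \<in> carrier_mat n n" "i < n" "j < n" "i \<noteq> j" "\<And>t. g * rot n u i j t \<in> S"
  shows "tangent_to n S g (g * skew n u i j)"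
  unfolding tangent_to_def
proof (intro conjI bexI allI)
  show "curve g (g * skew n u i j) (g * - (e_mat n i i + e_mat n j j)) t \<in> S" for t
    using assms(5)[of t] unfolding mult_rot_eq_curve[OF assms(1-4)] .
qed (use assms(1) in auto)

lemma tangent_to_skew_mult:
  assumes "g \<in> carrier_mat n n" "i < n" "j < n" "i \<noteq> j" "\<And>t. rot n u i j t * g \<in> S"
  shows "tangent_to n S g (skew n u i j * g)"
  unfolding tangent_to_def
proof (intro conjI bexI allI)
  show "curve g (skew n u i j * g) (- (e_mat n i i + e_mat n j j) * g) t \<in> S" for t
    using assms(5)[of t] unfolding rot_mult_eq_curve[OF assms(1-4)] .
qed (use assms(1) in auto)

text \<open>Tangency of the bivector to \<open>S\<close>, dually: ambient covectors that agree on
  the velocities recorded by \<open>tangent_to\<close> give the same value. This makes the bracket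
  independent of the chosen extensions.\<close>

definition poisson_tangent :: "nat \<Rightarrow> complex mat set \<Rightarrow> complex mat \<Rightarrow> bool" where
  "poisson_tangent n S g \<longleftrightarrow> (\<forall>\<alpha> \<alpha>' \<beta> \<beta>'.
     real_linear n \<alpha> \<longrightarrow> real_linear n \<alpha>' \<longrightarrow> real_linear n \<beta> \<longrightarrow> real_linear n \<beta>' \<longrightarrow>
     (\<forall>X. tangent_to n S g X \<longrightarrow> \<alpha> X = \<alpha>' X \<and> \<beta> X = \<beta>' X) \<longrightarrow>
     std_bivector n g \<alpha> \<beta> = std_bivector n g \<alpha>' \<beta>')"

lemma unit_mult_cnj: "u = 1 \<or> u = \<i> \<Longrightarrow> u * cnj u = 1"
  by auto

lemma poisson_tangent_SU_set:
  assumes g: "g \<in> SU_set n"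
  shows "poisson_tangent n (SU_set n) g"
  unfolding poisson_tangent_def
proof (intro allI impI)
  fix \<alpha> \<alpha>' \<beta> \<beta>' :: "complex mat \<Rightarrow> real"
  assume eq: "\<forall>X. tangent_to n (SU_set n) g X \<longrightarrow> \<alpha> X = \<alpha>' X \<and> \<beta> X = \<beta>' X"
  note gc = SU_set_carrier[OF g]
  show "std_bivector n g \<alpha> \<beta> = std_bivector n g \<alpha>' \<beta>'"
    unfolding std_bivector_eq_sum
  proof (intro sum.cong refl)
    fix j i assume "j \<in> {..<n}" "i \<in> {..<j}"
    then have ij: "i < n" "j < n" "i \<noteq> j" by auto
    have t: "tangent_to n (SU_set n) g (g * skew n u i j)" "tangent_to n (SU_set n) g (skew n u i j * g)"
      if "u = 1 \<or> u = \<i>" for u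
      using SU_set_mult rot_SU_set[OF ij unit_mult_cnj[OF that]] g
      by (auto intro!: tangent_to_mult_skew[OF gc ij] tangent_to_skew_mult[OF gc ij])
    show "bivector_term n g \<alpha> \<beta> i j = bivector_term n g \<alpha>' \<beta>' i j"
      by (rule bivector_term_cong) (use eq t in blast)+
  qed
qed

lemma rot_block_diagonal:
  assumes "i < n" "j < n" "i \<noteq> j" "i < k \<longleftrightarrow> j < k"
  shows "block_diagonal n k (rot n u i j t)"
  unfolding block_diagonal_def using assms by (auto simp: rot_index)

lemma rot_K_set:
  assumes "i < n" "j < n" "i \<noteq> j" "i < k \<longleftrightarrow> j < k" "k \<le> n" "u * cnj u = 1"
  shows "rot n u i j t \<in> K_set n k"
  using rot_block_diagonal[OF assms(1-4)] rot_SU_set[OF assms(1-3,6)] by (simp add: K_set_iff[OF assms(5)])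

text \<open>Rotations mixing the two blocks leave \<open>K_set\<close>, but their terms sum to 0 for
  all covectors. The remaining generators are velocities of rotations inside \<open>K_set\<close>.
  This is the sense in which \<open>K_set\<close> is a Poisson submanifold.\<close>

lemma poisson_tangent_K_set:
  assumes g: "g \<in> K_set (k + m) k"
  shows "poisson_tangent (k + m) (K_set (k + m) k) g"
  unfolding poisson_tangent_def
proof (intro allI impI)
  let ?n = "k + m" and ?K = "K_set (k + m) k"
  fix \<alpha> \<alpha>' \<beta> \<beta>' :: "complex mat \<Rightarrow> real"
  assume L: "real_linear ?n \<alpha>" "real_linear ?n \<alpha>'" "real_linear ?n \<beta>" "real_linear ?n \<beta>'"
    and eq: "\<forall>X. tangent_to ?n ?K g X \<longrightarrow> \<alpha> X = \<alpha>' X \<and> \<beta> X = \<beta>' X"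
  have g': "g \<in> U_set ?n" "block_diagonal ?n k g"
    using g by (auto simp: K_set_iff SU_set_def)
  note gc = U_set_carrier[OF g'(1)]
  have terms: "bivector_term ?n g \<alpha> \<beta> i j = bivector_term ?n g \<alpha>' \<beta>' i j"
    if ij: "i < ?n" "j < ?n" "i \<noteq> j" "i < k \<longleftrightarrow> j < k" for i j
  proof -
    have t: "tangent_to ?n ?K g (g * skew ?n u i j)" "tangent_to ?n ?K g (skew ?n u i j * g)"
      if "u = 1 \<or> u = \<i>" for u
      using K_set_mult[OF le_add1] rot_K_set[OF ij le_add1 unit_mult_cnj[OF that]] g
      by (auto intro!: tangent_to_mult_skew[OF gc ij(1-3)] tangent_to_skew_mult[OF gc ij(1-3)])
    show ?thesis by (rule bivector_term_cong) (use eq t in blast)+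
  qed
  show "std_bivector ?n g \<alpha> \<beta> = std_bivector ?n g \<alpha>' \<beta>'"
    unfolding std_bivector_block_diagonal[OF L(1,3) g'] std_bivector_block_diagonal[OF L(2,4) g']
    by (intro arg_cong2[of _ _ _ _ "(+)"] sum.cong refl terms) auto
qed

section \<open>The Poisson bracket\<close>

lemma std_poisson_simps [simp]:
  "top_of (std_poisson n S) = top_of (embedded_space n (\<lambda>A. A) S)"
  "smooth_fun (std_poisson n S) = smooth_fun (embedded_space n (\<lambda>A. A) S)"
  by (simp_all add: std_poisson_def)

lemma openin_std_poisson:
  "openin (top_of (std_poisson n S)) U \<longleftrightarrow> (\<exists>W. openin (mat_topology n) W \<and> U = W \<inter> S)"
  by (simp add: openin_top_of_embedded_space vimage_def)

lemma topspace_std_poisson: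
  "S \<subseteq> carrier_mat n n \<Longrightarrow> topspace (top_of (std_poisson n S)) = S"
  unfolding std_poisson_simps by (rule topspace_embedded_space) auto

text \<open>The condition in \<open>std_poisson\<close> for a single function, so that extensions of
  the two functions can be found on different open sets and intersected afterwards.\<close>

definition extends_at ::
    "nat \<Rightarrow> complex mat set \<Rightarrow> (complex mat \<Rightarrow> real) \<Rightarrow> complex mat \<Rightarrow>
     complex mat set \<Rightarrow> (complex mat \<Rightarrow> real) \<Rightarrow> (complex mat \<Rightarrow> real) \<Rightarrow> bool" where
  "extends_at n U f g W F \<alpha> \<longleftrightarrow> openin (mat_topology n) W \<and> g \<in> W \<and> smooth_on n W F \<and>
     (\<forall>x\<in>U \<inter> W. f x = F x) \<and> has_differential n F g \<alpha>"

lemma bracket_std_poisson: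
  "bracket (std_poisson n S) U f h g = (THE c. \<forall>W F H \<alpha> \<beta>.
     extends_at n U f g W F \<alpha> \<and> extends_at n U h g W H \<beta> \<longrightarrow> std_bivector n g \<alpha> \<beta> = c)"
  unfolding std_poisson_def poisson_space.simps extends_at_def
  by (rule arg_cong[of _ _ The], rule ext, rule iffI) blast+

lemma bracket_std_poisson_cong:
  assumes "\<And>y. y \<in> U \<Longrightarrow> f y = f' y \<and> h y = h' y"
  shows "bracket (std_poisson n S) U f h x = bracket (std_poisson n S) U f' h' x"
proof -
  have "extends_at n U f x W F \<alpha> \<longleftrightarrow> extends_at n U f' x W F \<alpha>"
       "extends_at n U h x W F \<alpha> \<longleftrightarrow> extends_at n U h' x W F \<alpha>" for W F \<alpha>
    using assms unfolding extends_at_def by auto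
  then show ?thesis unfolding bracket_std_poisson by simp
qed

lemma ex_extends_at:
  assumes "f \<in> smooth_fun (embedded_space n (\<lambda>A. A) S) U" "g \<in> U"
  shows "\<exists>W F \<alpha>. extends_at n U f g W F \<alpha>"
proof -
  from bspec[OF assms(1)[unfolded smooth_fun_embedded_space] assms(2)]
  obtain W F where W: "openin (mat_topology n) W" "g \<in> W" "smooth_on n W F"
      "\<forall>y\<in>U. y \<in> W \<longrightarrow> f y = F y"
    by (elim exE conjE) (rule that)
  from smooth_on_has_differential[OF W(3)] obtain DF where
    "\<forall>A\<in>W. has_differential n F A (DF A)" by blast
  then have "extends_at n U f g W F (DF g)" using W unfolding extends_at_def by auto
  then show ?thesis by blast
qed

lemma extends_at_subset:
  assumes "extends_at n U f g W F \<alpha>" "openin (mat_topology n) V" "g \<in> V"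
  shows "extends_at n U f g (W \<inter> V) F \<alpha>"
  using assms smooth_on_subset[of n W F "W \<inter> V"] unfolding extends_at_def by auto

lemma extends_at_real_linear: "extends_at n U f g W F \<alpha> \<Longrightarrow> real_linear n \<alpha>"
  by (simp add: extends_at_def has_differential_def)

text \<open>Near 0 the curve stays in \<open>U\<close> and in both domains, where both extensions
  equal \<open>f\<close>; hence they have the same derivative along it.\<close>

lemma extends_at_tangent_eq:
  assumes F: "extends_at n U f g W F \<alpha>" and F': "extends_at n U f g W' F' \<alpha>'"
    and U: "openin (top_of (std_poisson n S)) U" "g \<in> U" and X: "tangent_to n S g X"
  shows "\<alpha> X = \<alpha>' X"
proof -
  obtain V where V: "openin (mat_topology n) V" "U = V \<inter> S" using U(1) unfolding openin_std_poisson by blast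
  obtain Y where Y: "X \<in> carrier_mat n n" "Y \<in> carrier_mat n n" "\<And>t. curve g X Y t \<in> S"
    using X unfolding tangent_to_def by blast
  have W: "openin (mat_topology n) W" "g \<in> W" "openin (mat_topology n) W'" "g \<in> W'"
    using F F' by (simp_all add: extends_at_def)
  have FU: "\<forall>x\<in>U \<inter> W. f x = F x" "\<forall>x\<in>U \<inter> W'. f x = F' x"
    using F F' by (simp_all add: extends_at_def)
  have g: "g \<in> carrier_mat n n" using W(1,2) unfolding openin_mat_topology by blast
  have gV: "g \<in> V" using U(2) V(2) by simp
  have "\<forall>\<^sub>F t in at 0. curve g X Y t \<in> W \<and> curve g X Y t \<in> W' \<and> curve g X Y t \<in> V"
    using eventually_curve_in_open[OF W(1,2) Y(1,2)] eventually_curve_in_open[OF W(3,4) Y(1,2)]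
      eventually_curve_in_open[OF V(1) gV Y(1,2)] by eventually_elim blast
  then have "\<forall>\<^sub>F t in nhds 0. curve g X Y t \<in> W \<and> curve g X Y t \<in> W' \<and> curve g X Y t \<in> V"
    unfolding eventually_nhds_conv_at curve_zero[OF g Y(1,2)] using W gV by simp
  then have eq: "\<forall>\<^sub>F t in nhds 0. F (curve g X Y t) = F' (curve g X Y t)"
  proof eventually_elim
    case (elim t)
    then have "curve g X Y t \<in> U \<inter> W" "curve g X Y t \<in> U \<inter> W'" using V(2) Y(3) by simp_all
    then have "f (curve g X Y t) = F (curve g X Y t)" "f (curve g X Y t) = F' (curve g X Y t)"
      using FU by blast+
    then show ?case by (rule trans[OF sym])
  qed
  have D: "((\<lambda>t. F (curve g X Y t)) has_real_derivative \<alpha> X) (at 0)"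
    by (rule has_differential_curve[OF _ g Y(1,2)]) (use F in \<open>simp add: extends_at_def\<close>)
  have D': "((\<lambda>t. F' (curve g X Y t)) has_real_derivative \<alpha>' X) (at 0)"
    by (rule has_differential_curve[OF _ g Y(1,2)]) (use F' in \<open>simp add: extends_at_def\<close>)
  have "((\<lambda>t. F' (curve g X Y t)) has_real_derivative \<alpha> X) (at 0)"
    using D DERIV_cong_ev[OF refl eq refl] by blast
  then show ?thesis using D' by (rule DERIV_unique)
qed

lemma bracket_std_poisson_eq:
  assumes F: "extends_at n U f g W F \<alpha>" and H: "extends_at n U h g W' H \<beta>"
    and U: "openin (top_of (std_poisson n S)) U" "g \<in> U" and S: "poisson_tangent n S g"
  shows "bracket (std_poisson n S) U f h g = std_bivector n g \<alpha> \<beta>"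
  unfolding bracket_std_poisson
proof (rule the_equality)
  show "\<forall>V F' H' \<alpha>' \<beta>'. extends_at n U f g V F' \<alpha>' \<and> extends_at n U h g V H' \<beta>' \<longrightarrow>
      std_bivector n g \<alpha>' \<beta>' = std_bivector n g \<alpha> \<beta>"
  proof (intro allI impI)
    fix V F' H' \<alpha>' \<beta>' assume E: "extends_at n U f g V F' \<alpha>' \<and> extends_at n U h g V H' \<beta>'"
    have "\<forall>X. tangent_to n S g X \<longrightarrow> \<alpha>' X = \<alpha> X \<and> \<beta>' X = \<beta> X"
      using extends_at_tangent_eq[OF conjunct1[OF E] F U] extends_at_tangent_eq[OF conjunct2[OF E] H U] by simp
    then show "std_bivector n g \<alpha>' \<beta>' = std_bivector n g \<alpha> \<beta>"
      using S E F H extends_at_real_linear unfolding poisson_tangent_def by blast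
  qed
  fix c assume c: "\<forall>V F' H' \<alpha>' \<beta>'. extends_at n U f g V F' \<alpha>' \<and> extends_at n U h g V H' \<beta>' \<longrightarrow>
      std_bivector n g \<alpha>' \<beta>' = c"
  \<comment> \<open>The bracket asks for both extensions on one open set, so both are restricted to
    the intersection.\<close>
  have "extends_at n U f g (W \<inter> W') F \<alpha>"
    by (rule extends_at_subset[OF F]) (use H in \<open>simp_all add: extends_at_def\<close>)
  moreover have "extends_at n U h g (W' \<inter> W) H \<beta>"
    by (rule extends_at_subset[OF H]) (use F in \<open>simp_all add: extends_at_def\<close>)
  ultimately show "c = std_bivector n g \<alpha> \<beta>"
    using c[rule_format, of "W \<inter> W'" F \<alpha> H \<beta>] by (simp add: Int_commute)
qed

section \<open>The Poisson map onto the special unitary group of the last block\<close>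

text \<open>Right multiplication by diag (z, 1, ..., 1). It adjusts the determinant and keeps the
  last column as soon as there are two columns.\<close>

definition scale_first_col :: "nat \<Rightarrow> complex \<Rightarrow> complex mat \<Rightarrow> complex mat" where
  "scale_first_col m z A = mat m m (\<lambda>(a, b). A $$ (a, b) * (if b = 0 then z else 1))"

lemma scale_first_col_carrier [simp]: "scale_first_col m z A \<in> carrier_mat m m"
  and scale_first_col_dim [simp]: "dim_row (scale_first_col m z A) = m" "dim_col (scale_first_col m z A) = m"
  and scale_first_col_index: "a < m \<Longrightarrow> b < m \<Longrightarrow>
    scale_first_col m z A $$ (a, b) = A $$ (a, b) * (if b = 0 then z else 1)"
  by (simp_all add: scale_first_col_def)

lemma scale_first_col_U_set:
  assumes A: "A \<in> U_set m" and z: "cnj z * z = 1"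
  shows "scale_first_col m z A \<in> U_set m"
proof (rule U_setI)
  fix i j assume ij: "i < m" "j < m"
  let ?d = "\<lambda>b. if b = 0 then z else (1 :: complex)"
  have "(\<Sum>a<m. cnj (scale_first_col m z A $$ (a, i)) * scale_first_col m z A $$ (a, j)) =
      (\<Sum>a<m. (cnj (?d i) * ?d j) * (cnj (A $$ (a, i)) * A $$ (a, j)))"
    using ij by (intro sum.cong refl) (simp add: scale_first_col_index mult_ac)
  also have "\<dots> = (cnj (?d i) * ?d j) * (if i = j then 1 else 0)"
    unfolding sum_distrib_left[symmetric] U_set_cols[OF A ij] ..
  also have "\<dots> = (if i = j then 1 else 0)" using z by auto
  finally show "(\<Sum>a<m. cnj (scale_first_col m z A $$ (a, i)) * scale_first_col m z A $$ (a, j)) =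
      (if i = j then 1 else 0)" .
qed simp

lemma det_scale_first_col:
  assumes A: "A \<in> carrier_mat m m" and m: "0 < m"
  shows "det (scale_first_col m z A) = z * det A"
proof -
  obtain l where l: "m = 1 + l" using m by (metis Suc_pred plus_1_eq_Suc)
  define Z where "Z = mat 1 1 (\<lambda>_. z)"
  have Z: "Z \<in> carrier_mat 1 1" by (simp add: Z_def)
  let ?D = "diag_block_mat [Z, 1\<^sub>m l]"
  have D: "?D \<in> carrier_mat m m" unfolding l by (rule diag_block_mat_two_carrier[OF Z one_carrier_mat])
  have Di: "?D $$ (a, b) = (if a = b then (if b = 0 then z else 1) else 0)" if "a < m" "b < m" for a b
    using that unfolding l by (subst diag_block_mat_two_index[OF Z one_carrier_mat]) (auto simp: Z_def)
  have "A * ?D = scale_first_col m z A"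
  proof (rule eq_matI)
    fix a b assume "a < dim_row (scale_first_col m z A)" "b < dim_col (scale_first_col m z A)"
    then have ab: "a < m" "b < m" by auto
    have "(A * ?D) $$ (a, b) = (\<Sum>c<m. A $$ (a, c) * ?D $$ (c, b))"
      by (rule index_mult_mat_sum[OF A D ab])
    also have "\<dots> = (\<Sum>c<m. if c = b then A $$ (a, b) * (if b = 0 then z else 1) else 0)"
      using ab by (intro sum.cong refl) (simp add: Di)
    also have "\<dots> = scale_first_col m z A $$ (a, b)" using ab by (simp add: scale_first_col_index)
    finally show "(A * ?D) $$ (a, b) = scale_first_col m z A $$ (a, b)" .
  qed (use A D in auto)
  then have "det (scale_first_col m z A) = det A * det ?D" using det_mult[OF A D] by simp
  also have "det ?D = z"
    unfolding diag_block_mat_two_det[OF Z one_carrier_mat] by (simp only: det_single[OF Z] det_one mult_1_right) (simp add: Z_def)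
  finally show ?thesis by simp
qed

text \<open>The map \<open>diag (A, B) \<mapsto> B diag (det A, 1, ..., 1)\<close>, extended polynomially to all matrices.\<close>

definition corner_twist :: "nat \<Rightarrow> nat \<Rightarrow> complex mat \<Rightarrow> complex mat" where
  "corner_twist k m A = scale_first_col m (det (sub_block 0 k A)) (sub_block k m A)"

lemma corner_twist_carrier [simp]: "corner_twist k m A \<in> carrier_mat m m"
  and corner_twist_dim [simp]: "dim_row (corner_twist k m A) = m" "dim_col (corner_twist k m A) = m"
  by (simp_all add: corner_twist_def)

lemma corner_twist_index:
  "a < m \<Longrightarrow> b < m \<Longrightarrow> corner_twist k m A $$ (a, b) =
     A $$ (k + a, k + b) * (if b = 0 then det (sub_block 0 k A) else 1)"
  by (simp add: corner_twist_def scale_first_col_index)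

lemma smooth_map_corner_twist: "smooth_map (k + m) m (corner_twist k m)"
  unfolding smooth_map_def
proof (intro conjI ballI allI impI corner_twist_carrier)
  fix a b assume ab: "a < m" "b < m"
  have "smooth_complex (k + m) (\<lambda>A. det (sub_block 0 k A))"
    unfolding sub_block_def by (rule smooth_complex_det) (simp add: smooth_complex_index)
  then have "smooth_complex (k + m) (\<lambda>A. if b = 0 then det (sub_block 0 k A) else 1)"
    by (cases "b = 0") simp_all
  then show "smooth_complex (k + m) (\<lambda>A. corner_twist k m A $$ (a, b))"
    unfolding corner_twist_index[OF ab]
    by (rule smooth_complex_mult[rotated]) (use ab in \<open>simp add: smooth_complex_index\<close>)
qed

text \<open>The determinant of the upper block has modulus one, so scaling by it keeps the lower
  block unitary and completes the determinant of that block to \<open>det x = 1\<close>.\<close>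

lemma corner_twist_SU_set:
  assumes x: "x \<in> K_set (k + m) k" and m: "0 < m"
  shows "corner_twist k m x \<in> SU_set m"
proof -
  have x': "x \<in> U_set (k + m)" "block_diagonal (k + m) k x" "det x = 1"
    using x by (auto simp: K_set_iff SU_set_def)
  have "det x = det (sub_block 0 k x) * det (sub_block k m x)"
    by (subst block_diagonal_decompose[OF U_set_carrier[OF x'(1)] x'(2)])
      (rule diag_block_mat_two_det[OF sub_block_carrier sub_block_carrier])
  then show ?thesis
    unfolding SU_set_def corner_twist_def
    using scale_first_col_U_set[OF sub_block_U_set(2)[OF x'(1,2)] U_set_det[OF sub_block_U_set(1)[OF x'(1,2)]]]
      det_scale_first_col[OF sub_block_carrier m] x'(3) by simp
qed

text \<open>A rotation within the first \<open>k\<close> coordinates has determinant one, hence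
  preserves the scaling factor, and it does not touch the lower block.\<close>

lemma corner_twist_mult_rot_upper:
  assumes x: "x \<in> carrier_mat (k + m) (k + m)" and ij: "i < k" "j < k" "i \<noteq> j" and u: "u * cnj u = 1"
  shows "corner_twist k m (x * rot (k + m) u i j t) = corner_twist k m x"
    and "corner_twist k m (rot (k + m) u i j t * x) = corner_twist k m x"
proof -
  have ij': "i < k + m" "j < k + m" using ij by auto
  have "sub_block 0 k (x * rot (k + m) u i j t) = sub_block 0 k x * rot k u i j t"
    by (rule eq_matI) (use ij in \<open>simp_all add: mult_rot_index[OF x ij' ij(3)] mult_rot_index[OF sub_block_carrier ij]
      del: index_mult_mat(1)\<close>)
  then have "det (sub_block 0 k (x * rot (k + m) u i j t)) = det (sub_block 0 k x)"
    using det_mult[OF sub_block_carrier rot_carrier] det_rot[OF ij u] by simp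
  then show "corner_twist k m (x * rot (k + m) u i j t) = corner_twist k m x"
    by (intro eq_matI) (use ij in \<open>simp_all add: corner_twist_index mult_rot_index[OF x ij' ij(3)]
      del: index_mult_mat(1)\<close>)
  have "sub_block 0 k (rot (k + m) u i j t * x) = rot k u i j t * sub_block 0 k x"
    by (rule eq_matI) (use ij in \<open>simp_all add: rot_mult_index[OF x ij' ij(3)] rot_mult_index[OF sub_block_carrier ij]
      del: index_mult_mat(1)\<close>)
  then have "det (sub_block 0 k (rot (k + m) u i j t * x)) = det (sub_block 0 k x)"
    using det_mult[OF rot_carrier sub_block_carrier] det_rot[OF ij u] by simp
  then show "corner_twist k m (rot (k + m) u i j t * x) = corner_twist k m x"
    by (intro eq_matI) (use ij in \<open>simp_all add: corner_twist_index rot_mult_index[OF x ij' ij(3)]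
      del: index_mult_mat(1)\<close>)
qed

text \<open>Row operations commute with the scaling of a column.\<close>

lemma corner_twist_rot_mult_lower:
  assumes x: "x \<in> carrier_mat (k + m) (k + m)" and ij: "i < m" "j < m" "i \<noteq> j"
  shows "corner_twist k m (rot (k + m) u (k + i) (k + j) t * x) = rot m u i j t * corner_twist k m x"
proof (rule eq_matI)
  let ?R = "rot (k + m) u (k + i) (k + j) t"
  have ij': "k + i < k + m" "k + j < k + m" "k + i \<noteq> k + j" using ij by auto
  have d: "sub_block 0 k (?R * x) = sub_block 0 k x"
    by (rule eq_matI) (simp_all add: rot_mult_index[OF x ij'] del: index_mult_mat(1))
  fix a b assume "a < dim_row (rot m u i j t * corner_twist k m x)" "b < dim_col (rot m u i j t * corner_twist k m x)"
  then have ab: "a < m" "b < m" by auto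
  have "(?R * x) $$ (k + a, k + b) =
      (if a = i then of_real (cos t) * x $$ (k + i, k + b) + u * of_real (sin t) * x $$ (k + j, k + b)
       else if a = j then - cnj u * of_real (sin t) * x $$ (k + i, k + b) + of_real (cos t) * x $$ (k + j, k + b)
       else x $$ (k + a, k + b))"
    using rot_mult_index[OF x ij', of "k + a" "k + b" u t] ab by (simp only: add_less_cancel_left add_left_cancel)
  then show "corner_twist k m (?R * x) $$ (a, b) = (rot m u i j t * corner_twist k m x) $$ (a, b)"
    unfolding corner_twist_index[OF ab] d rot_mult_index[OF corner_twist_carrier ij ab]
    using ab ij by (simp add: corner_twist_index algebra_simps del: index_mult_mat(1))
qed auto

text \<open>With \<open>D\<close> the diagonal matrix of the \<open>d b\<close>, a rotation
  \<open>R\<close> moves past it by \<open>R * D = D * (mat_adjoint D * R * D)\<close>. The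
  conjugate is again a rotation in the same plane, with phase multiplied by
  \<open>cnj (d i) * d j\<close>.\<close>

lemma corner_twist_mult_rot_lower:
  assumes x: "x \<in> carrier_mat (k + m) (k + m)" and ij: "i < m" "j < m" "i \<noteq> j"
    and d: "d = (\<lambda>b. if b = 0 then det (sub_block 0 k x) else 1)" and d1: "\<And>b. cnj (d b) * d b = 1"
  shows "corner_twist k m (x * rot (k + m) u (k + i) (k + j) t) =
    corner_twist k m x * rot m (u * (cnj (d i) * d j)) i j t"
proof (rule eq_matI)
  let ?R = "rot (k + m) u (k + i) (k + j) t" and ?R' = "rot m (u * (cnj (d i) * d j)) i j t"
  have ij': "k + i < k + m" "k + j < k + m" "k + i \<noteq> k + j" using ij by auto
  have s: "sub_block 0 k (x * ?R) = sub_block 0 k x"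
    by (rule eq_matI) (simp_all add: mult_rot_index[OF x ij'] del: index_mult_mat(1))
  have ct: "corner_twist k m x $$ (a, b) = x $$ (k + a, k + b) * d b" if "a < m" "b < m" for a b
    unfolding corner_twist_index[OF that] d ..
  define w where "w = u * (cnj (d i) * d j)"
  have "cnj w * d j = cnj u * d i * (cnj (d j) * d j)" unfolding w_def by (simp add: mult_ac)
  then have w1: "cnj w * d j = cnj u * d i" unfolding d1 by simp
  have "w * d i = u * d j * (cnj (d i) * d i)" unfolding w_def by (simp add: mult_ac)
  then have w2: "w * d i = u * d j" unfolding d1 by simp
  have ac: "p * s * (y * q) = p * q * (s * y)" for p q s y :: complex by (simp add: mult_ac)
  fix a b assume "a < dim_row (corner_twist k m x * ?R')" "b < dim_col (corner_twist k m x * ?R')"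
  then have ab: "a < m" "b < m" by auto
  have "corner_twist k m (x * ?R) $$ (a, b) = (x * ?R) $$ (k + a, k + b) * d b"
    unfolding corner_twist_index[OF ab] s d ..
  also have "(x * ?R) $$ (k + a, k + b) =
      (if b = i then of_real (cos t) * x $$ (k + a, k + i) - cnj u * of_real (sin t) * x $$ (k + a, k + j)
       else if b = j then u * of_real (sin t) * x $$ (k + a, k + i) + of_real (cos t) * x $$ (k + a, k + j)
       else x $$ (k + a, k + b))"
    using mult_rot_index[OF x ij', of "k + a" "k + b" u t] ab by (simp only: add_less_cancel_left add_left_cancel)
  also have "\<dots> * d b = (if b = i then of_real (cos t) * (x $$ (k + a, k + i) * d i) -
        cnj w * of_real (sin t) * (x $$ (k + a, k + j) * d j)
      else if b = j then w * of_real (sin t) * (x $$ (k + a, k + i) * d i) +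
        of_real (cos t) * (x $$ (k + a, k + j) * d j)
      else x $$ (k + a, k + b) * d b)"
    unfolding ac[of "cnj w"] ac[of w] w1 w2 by (simp add: algebra_simps)
  also have "\<dots> = (corner_twist k m x * ?R') $$ (a, b)"
    unfolding w_def[symmetric] mult_rot_index[OF corner_twist_carrier ij ab]
      ct[OF ab(1) ij(1)] ct[OF ab(1) ij(2)] ct[OF ab] ..
  finally show "corner_twist k m (x * ?R) $$ (a, b) = (corner_twist k m x * ?R') $$ (a, b)" .
qed auto

text \<open>Both sides are the derivative at 0 of one function of \<open>t\<close>, so the
  differentials are compared without computing the differential of \<open>s\<close>.\<close>

lemma has_differential_along_map:
  assumes F: "has_differential m F (s x) \<alpha>" and Fs: "has_differential n (\<lambda>A. F (s A)) x \<alpha>'"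
    and x: "x \<in> carrier_mat n n" "X \<in> carrier_mat n n" "Y \<in> carrier_mat n n"
    and sx: "s x \<in> carrier_mat m m" "X' \<in> carrier_mat m m" "Y' \<in> carrier_mat m m"
    and c: "\<And>t. s (curve x X Y t) = curve (s x) X' Y' t"
  shows "\<alpha>' X = \<alpha> X'"
proof -
  have "((\<lambda>t. F (s (curve x X Y t))) has_real_derivative \<alpha>' X) (at 0)"
    using has_differential_curve[OF Fs x] .
  moreover have "((\<lambda>t. F (s (curve x X Y t))) has_real_derivative \<alpha> X') (at 0)"
    unfolding c using has_differential_curve[OF F sx] .
  ultimately show ?thesis by (rule DERIV_unique)
qed

lemma std_bivector_corner_twist:
  assumes x: "x \<in> K_set (k + m) k"
    and F: "has_differential m F (corner_twist k m x) \<alpha>"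
      "has_differential (k + m) (\<lambda>A. F (corner_twist k m A)) x \<alpha>'"
    and H: "has_differential m H (corner_twist k m x) \<beta>"
      "has_differential (k + m) (\<lambda>A. H (corner_twist k m A)) x \<beta>'"
  shows "std_bivector (k + m) x \<alpha>' \<beta>' = std_bivector m (corner_twist k m x) \<alpha> \<beta>"
proof -
  let ?n = "k + m" and ?s = "corner_twist k m"
  have x': "x \<in> U_set ?n" "block_diagonal ?n k x" using x by (auto simp: K_set_iff SU_set_def)
  note xc = U_set_carrier[OF x'(1)]
  have L: "real_linear m \<alpha>" "real_linear m \<beta>" "real_linear ?n \<alpha>'" "real_linear ?n \<beta>'"
    using F H by (simp_all add: has_differential_def)
  define d where "d = (\<lambda>b :: nat. if b = 0 then det (sub_block 0 k x) else 1)"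
  have d1: "cnj (d b) * d b = 1" for b
    using U_set_det[OF sub_block_U_set(1)[OF x']] by (simp add: d_def)
  have E: "- (e_mat l i i + e_mat l j j) \<in> carrier_mat l l" for l i j by simp
  note carr = mult_carrier_mat[of _ ?n ?n _ ?n] mult_carrier_mat[of _ m m _ m] xc E
  have upper: "\<gamma>' (x * skew ?n u i j) = 0" "\<gamma>' (skew ?n u i j * x) = 0"
    if G: "has_differential m G (?s x) \<gamma>" "has_differential ?n (\<lambda>A. G (?s A)) x \<gamma>'"
      and ij: "i < k" "j < k" "i \<noteq> j" and u: "u = 1 \<or> u = \<i>" for G \<gamma> \<gamma>' i j u
  proof -
    have ij': "i < ?n" "j < ?n" "i \<noteq> j" using ij by auto
    have "real_linear m \<gamma>" using G(1) by (simp add: has_differential_def)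
    then have z: "\<gamma> (0\<^sub>m m m) = 0" by (rule real_linear_zero)
    \<comment> \<open>The twist is constant along rotations of the upper block, and a constant is a
      \<open>curve\<close> with zero velocity.\<close>
    have c0: "curve (?s x) (0\<^sub>m m m) (0\<^sub>m m m) t = ?s x" for t
      unfolding curve_def by (rule eq_matI) auto
    have "\<gamma>' (x * skew ?n u i j) = \<gamma> (0\<^sub>m m m)"
    proof (rule has_differential_along_map[OF G xc])
      show "?s (curve x (x * skew ?n u i j) (x * - (e_mat ?n i i + e_mat ?n j j)) t) =
          curve (?s x) (0\<^sub>m m m) (0\<^sub>m m m) t" for t
        unfolding mult_rot_eq_curve[OF xc ij', symmetric] c0
        by (rule corner_twist_mult_rot_upper(1)[OF xc ij unit_mult_cnj[OF u]])
    qed (simp_all add: carr)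
    then show "\<gamma>' (x * skew ?n u i j) = 0" using z by simp
    have "\<gamma>' (skew ?n u i j * x) = \<gamma> (0\<^sub>m m m)"
    proof (rule has_differential_along_map[OF G xc])
      show "?s (curve x (skew ?n u i j * x) (- (e_mat ?n i i + e_mat ?n j j) * x) t) =
          curve (?s x) (0\<^sub>m m m) (0\<^sub>m m m) t" for t
        unfolding rot_mult_eq_curve[OF xc ij', symmetric] c0
        by (rule corner_twist_mult_rot_upper(2)[OF xc ij unit_mult_cnj[OF u]])
    qed (simp_all add: carr)
    then show "\<gamma>' (skew ?n u i j * x) = 0" using z by simp
  qed
  have lower: "\<gamma>' (x * skew ?n u (k + i) (k + j)) = \<gamma> (?s x * skew m (u * (cnj (d i) * d j)) i j)"
      "\<gamma>' (skew ?n u (k + i) (k + j) * x) = \<gamma> (skew m u i j * ?s x)"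
    if G: "has_differential m G (?s x) \<gamma>" "has_differential ?n (\<lambda>A. G (?s A)) x \<gamma>'"
      and ij: "i < m" "j < m" "i \<noteq> j" for G \<gamma> \<gamma>' i j u
  proof -
    have ij': "k + i < ?n" "k + j < ?n" "k + i \<noteq> k + j" using ij by auto
    show "\<gamma>' (x * skew ?n u (k + i) (k + j)) = \<gamma> (?s x * skew m (u * (cnj (d i) * d j)) i j)"
    proof (rule has_differential_along_map[OF G xc])
      show "?s (curve x (x * skew ?n u (k + i) (k + j)) (x * - (e_mat ?n (k + i) (k + i) + e_mat ?n (k + j) (k + j))) t) =
          curve (?s x) (?s x * skew m (u * (cnj (d i) * d j)) i j) (?s x * - (e_mat m i i + e_mat m j j)) t" for t
        unfolding mult_rot_eq_curve[OF xc ij', symmetric] mult_rot_eq_curve[OF corner_twist_carrier ij, symmetric]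
        by (rule corner_twist_mult_rot_lower[OF xc ij d_def d1])
    qed (simp_all add: carr)
    show "\<gamma>' (skew ?n u (k + i) (k + j) * x) = \<gamma> (skew m u i j * ?s x)"
    proof (rule has_differential_along_map[OF G xc])
      show "?s (curve x (skew ?n u (k + i) (k + j) * x) (- (e_mat ?n (k + i) (k + i) + e_mat ?n (k + j) (k + j)) * x) t) =
          curve (?s x) (skew m u i j * ?s x) (- (e_mat m i i + e_mat m j j) * ?s x) t" for t
        unfolding rot_mult_eq_curve[OF xc ij', symmetric] rot_mult_eq_curve[OF corner_twist_carrier ij, symmetric]
        by (rule corner_twist_rot_mult_lower[OF xc ij])
    qed (simp_all add: carr)
  qed
  have "bivector_term ?n x \<alpha>' \<beta>' i j = 0" if "i < j" "j < k" for i j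
    using upper[OF F, of i j] upper[OF H, of i j] that
    unfolding bivector_term_def wedge_def by simp
  moreover have "bivector_term ?n x \<alpha>' \<beta>' (k + i) (k + j) = bivector_term m (?s x) \<alpha> \<beta> i j"
    if "i < j" "j < m" for i j
  proof -
    have ij: "i < m" "j < m" "i \<noteq> j" using that by auto
    \<comment> \<open>The phase by which the twist turns the plane of the two generators. It has
      modulus one and therefore drops out of the Hermitian form.\<close>
    define w where "w = cnj (d i) * d j"
    have w: "cnj w * w = 1"
    proof -
      have "cnj w * w = (cnj (d i) * d i) * (cnj (d j) * d j)" unfolding w_def by (simp add: mult_ac)
      then show ?thesis unfolding d1 by simp
    qed
    define a where "a \<gamma> = Complex (\<gamma> (?s x * skew m 1 i j)) (- \<gamma> (?s x * skew m \<i> i j))"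
      for \<gamma> :: "complex mat \<Rightarrow> real"
    have a: "\<gamma> (?s x * skew m v i j) = Re (v * a \<gamma>)" if "real_linear m \<gamma>" for \<gamma> v
      unfolding a_def by (rule real_linear_mult_skew[OF that corner_twist_carrier])
    have "wedge (x * skew ?n \<i> (k + i) (k + j)) (x * skew ?n 1 (k + i) (k + j)) \<alpha>' \<beta>' =
        Im (cnj (w * a \<alpha>) * (w * a \<beta>))"
      by (rule wedge_eq_Im)
        (simp_all only: lower(1)[OF F ij] lower(1)[OF H ij] a[OF L(1)] a[OF L(2)] w_def mult.assoc)
    also have "cnj (w * a \<alpha>) * (w * a \<beta>) = (cnj w * w) * (cnj (a \<alpha>) * a \<beta>)" by (simp add: mult_ac)
    also have "Im \<dots> = wedge (?s x * skew m \<i> i j) (?s x * skew m 1 i j) \<alpha> \<beta>"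
      unfolding w mult_1 by (rule wedge_eq_Im[symmetric]) (rule a[OF L(1)] a[OF L(2)])+
    finally show ?thesis
      unfolding bivector_term_def wedge_def lower(2)[OF F ij] lower(2)[OF H ij] by simp
  qed
  ultimately show ?thesis
    unfolding std_bivector_block_diagonal[OF L(3,4) x'] std_bivector_eq_sum[of m] by simp
qed

text \<open>Composing a local extension of \<open>f\<close> with the globally defined twist extends
  the pullback of \<open>f\<close>. Both brackets can then be computed from matching extensions and
  compared by \<open>std_bivector_corner_twist\<close>.\<close>

lemma bracket_corner_twist:
  assumes m: "0 < m" and U: "openin (top_of (std_poisson m (SU_set m))) U"
    and f: "f \<in> smooth_fun (std_poisson m (SU_set m)) U" and h: "h \<in> smooth_fun (std_poisson m (SU_set m)) U"
    and P: "P = preimage (std_poisson (k + m) (K_set (k + m) k)) (corner_twist k m) U"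
    and open_P: "openin (top_of (std_poisson (k + m) (K_set (k + m) k))) P" and x: "x \<in> P"
  shows "bracket (std_poisson (k + m) (K_set (k + m) k)) P (f \<circ> corner_twist k m) (h \<circ> corner_twist k m) x =
    bracket (std_poisson m (SU_set m)) U f h (corner_twist k m x)"
proof -
  let ?n = "k + m" and ?s = "corner_twist k m" and ?K = "K_set (k + m) k"
  have Kc: "?K \<subseteq> carrier_mat ?n ?n" using SU_set_carrier by (auto simp: K_set_iff)
  have xK: "x \<in> ?K" and sU: "?s x \<in> U" using x Kc unfolding P preimage_def topspace_std_poisson[OF Kc] by auto
  have sP: "?s y \<in> U" if "y \<in> P" for y using that unfolding P preimage_def by auto
  have lift: "\<exists>\<gamma>'. extends_at ?n P (g \<circ> ?s) x {A \<in> carrier_mat ?n ?n. ?s A \<in> W} (\<lambda>A. G (?s A)) \<gamma>'"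
    if "extends_at m U g (?s x) W G \<gamma>" for g W G \<gamma>
  proof -
    let ?W = "{A \<in> carrier_mat ?n ?n. ?s A \<in> W}"
    have G: "openin (mat_topology m) W" "?s x \<in> W" "smooth_on m W G" "\<forall>y\<in>U \<inter> W. g y = G y"
      using that by (simp_all add: extends_at_def)
    have sm: "smooth_on ?n ?W (\<lambda>A. G (?s A))"
      by (rule smooth_map_compose[OF smooth_map_corner_twist G(3)])
    have xW: "x \<in> ?W" using xK Kc G(2) by auto
    from smooth_on_has_differential[OF sm] xW obtain \<gamma>' where "has_differential ?n (\<lambda>A. G (?s A)) x \<gamma>'" by blast
    then have "extends_at ?n P (g \<circ> ?s) x ?W (\<lambda>A. G (?s A)) \<gamma>'"
      unfolding extends_at_def using sm xW openin_smooth_map_preimage[OF smooth_map_corner_twist G(1)] G(4) sP by auto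
    then show ?thesis by blast
  qed
  obtain W F \<alpha> where F: "extends_at m U f (?s x) W F \<alpha>"
    using ex_extends_at[OF f[unfolded std_poisson_simps] sU] by blast
  obtain V H \<beta> where H: "extends_at m U h (?s x) V H \<beta>"
    using ex_extends_at[OF h[unfolded std_poisson_simps] sU] by blast
  obtain \<alpha>' where F': "extends_at ?n P (f \<circ> ?s) x {A \<in> carrier_mat ?n ?n. ?s A \<in> W} (\<lambda>A. F (?s A)) \<alpha>'"
    using lift[OF F] by blast
  obtain \<beta>' where H': "extends_at ?n P (h \<circ> ?s) x {A \<in> carrier_mat ?n ?n. ?s A \<in> V} (\<lambda>A. H (?s A)) \<beta>'"
    using lift[OF H] by blast
  have "std_bivector ?n x \<alpha>' \<beta>' = std_bivector m (?s x) \<alpha> \<beta>"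
    by (rule std_bivector_corner_twist[OF xK, of F _ _ H]) (use F H F' H' in \<open>simp_all add: extends_at_def\<close>)
  then show ?thesis
    unfolding bracket_std_poisson_eq[OF F' H' open_P x poisson_tangent_K_set[OF xK]]
      bracket_std_poisson_eq[OF F H U sU poisson_tangent_SU_set[OF corner_twist_SU_set[OF xK m]]] .
qed

lemma smooth_morphism_std_poisson:
  assumes "smooth_map n m G" "S \<subseteq> carrier_mat n n" "\<And>x. x \<in> S \<Longrightarrow> G x \<in> S'"
  shows "smooth_morphism (std_poisson n S) (std_poisson m S') G"
proof -
  have "smooth_morphism (embedded_space n (\<lambda>A. A) S) (embedded_space m (\<lambda>A. A) S') G"
    by (rule smooth_morphism_embedded_space[OF assms(1)]) (use assms(2,3) in auto)
  then show ?thesis by (simp add: smooth_morphism_def preimage_def)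
qed

lemma smooth_fun_local_std_poisson: "smooth_fun_local (std_poisson n S)"
  using smooth_fun_local_embedded_space[of n "\<lambda>A. A" S] by (simp add: smooth_fun_local_def)

section \<open>The section of the twist and the Poisson diffeomorphism\<close>

definition corner_embed :: "nat \<Rightarrow> nat \<Rightarrow> complex mat \<Rightarrow> complex mat" where
  "corner_embed k m B = mat (k + m) (k + m) (\<lambda>(a, b).
     if k \<le> a \<and> k \<le> b then B $$ (a - k, b - k) else if a = b then 1 else 0)"

lemma corner_embed_carrier [simp]: "corner_embed k m B \<in> carrier_mat (k + m) (k + m)"
  and corner_embed_dim [simp]: "dim_row (corner_embed k m B) = k + m" "dim_col (corner_embed k m B) = k + m"
  and corner_embed_index: "a < k + m \<Longrightarrow> b < k + m \<Longrightarrow> corner_embed k m B $$ (a, b) =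
    (if k \<le> a \<and> k \<le> b then B $$ (a - k, b - k) else if a = b then 1 else 0)"
  by (simp_all add: corner_embed_def)

lemma smooth_map_corner_embed: "smooth_map m (k + m) (corner_embed k m)"
  unfolding smooth_map_def
proof (intro conjI ballI allI impI corner_embed_carrier)
  fix a b assume ab: "a < k + m" "b < k + m"
  show "smooth_complex m (\<lambda>A. corner_embed k m A $$ (a, b))"
  proof (cases "k \<le> a \<and> k \<le> b")
    case True
    then have "a - k < m" "b - k < m" using ab by auto
    then show ?thesis unfolding corner_embed_index[OF ab] if_P[OF True] by (rule smooth_complex_index)
  next
    case False
    show ?thesis unfolding corner_embed_index[OF ab] if_not_P[OF False] by (rule smooth_complex_const)
  qed
qed

lemma corner_embed_K_set:
  assumes B: "B \<in> SU_set m"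
  shows "corner_embed k m B \<in> K_set (k + m) k"
proof -
  have U: "B \<in> U_set m" "det B = 1" using B by (auto simp: SU_set_def)
  have eq: "corner_embed k m B = diag_block_mat [1\<^sub>m k, B]"
  proof (rule eq_matI)
    have D: "diag_block_mat [1\<^sub>m k, B] \<in> carrier_mat (k + m) (k + m)"
      by (rule diag_block_mat_two_carrier[OF one_carrier_mat SU_set_carrier[OF B]])
    show "dim_row (corner_embed k m B) = dim_row (diag_block_mat [1\<^sub>m k, B])"
      "dim_col (corner_embed k m B) = dim_col (diag_block_mat [1\<^sub>m k, B])" using D by auto
    fix a b assume "a < dim_row (diag_block_mat [1\<^sub>m k, B])" "b < dim_col (diag_block_mat [1\<^sub>m k, B])"
    then have ab: "a < k + m" "b < k + m" using D by auto
    show "corner_embed k m B $$ (a, b) = diag_block_mat [1\<^sub>m k, B] $$ (a, b)"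
      unfolding corner_embed_index[OF ab] diag_block_mat_two_index[OF one_carrier_mat SU_set_carrier[OF B] ab]
      by auto
  qed
  have "det (corner_embed k m B) = 1"
    unfolding eq diag_block_mat_two_det[OF one_carrier_mat SU_set_carrier[OF B]] using U by simp
  then show ?thesis
    unfolding K_set_iff[OF le_add1] SU_set_def eq
    using diag_block_mat_two_U[OF U_set_one U(1)] block_diagonal_diag_block_mat[OF one_carrier_mat SU_set_carrier[OF B]]
    by simp
qed

lemma corner_twist_embed:
  assumes B: "B \<in> carrier_mat m m"
  shows "corner_twist k m (corner_embed k m B) = B"
proof -
  have "sub_block 0 k (corner_embed k m B) = 1\<^sub>m k"
    by (rule eq_matI) (simp_all add: corner_embed_index)
  then have "det (sub_block 0 k (corner_embed k m B)) = 1" by simp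
  then show ?thesis
    by (intro eq_matI) (use B in \<open>simp_all add: corner_twist_index corner_embed_index\<close>)
qed

text \<open>For \<open>m = 1\<close> the last column would be column 0, the one that the twist
  rescales.\<close>

lemma corner_twist_last_col:
  assumes "2 \<le> m" "i < m"
  shows "corner_twist k m x $$ (i, m - 1) = x $$ (k + i, k + m - 1)"
  using assms by (simp add: corner_twist_index)

text \<open>The first \<open>k\<close> entries of the last column vanish on \<open>K_set\<close>,
  and the twist preserves the others, so proportionality upstairs and downstairs is the same
  condition.\<close>

lemma corner_twist_proportional_iff:
  assumes m: "2 \<le> m" and x: "x \<in> K_set (k + m) k" and y: "y \<in> K_set (k + m) k"
  shows "(\<exists>c. \<forall>i<k + m. y $$ (i, k + m - 1) = c * x $$ (i, k + m - 1)) \<longleftrightarrow>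
    (\<exists>c. \<forall>i<m. corner_twist k m y $$ (i, m - 1) = c * corner_twist k m x $$ (i, m - 1))"
proof (intro iffI; elim exE)
  fix c assume c: "\<forall>i<k + m. y $$ (i, k + m - 1) = c * x $$ (i, k + m - 1)"
  have "corner_twist k m y $$ (i, m - 1) = c * corner_twist k m x $$ (i, m - 1)" if "i < m" for i
    unfolding corner_twist_last_col[OF m that] using c that by simp
  then have "\<forall>i<m. corner_twist k m y $$ (i, m - 1) = c * corner_twist k m x $$ (i, m - 1)" by blast
  then show "\<exists>c. \<forall>i<m. corner_twist k m y $$ (i, m - 1) = c * corner_twist k m x $$ (i, m - 1)" ..
next
  fix c assume c: "\<forall>i<m. corner_twist k m y $$ (i, m - 1) = c * corner_twist k m x $$ (i, m - 1)"
  have "y $$ (i, k + m - 1) = c * x $$ (i, k + m - 1)" if i: "i < k + m" for i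
  proof (cases "i < k")
    case True
    have "k + m - 1 \<in> {k..<k + m}" using m by simp
    then have "x $$ (i, k + m - 1) = 0" "y $$ (i, k + m - 1) = 0"
      using x y True unfolding K_set_iff[OF le_add1] block_diagonal_def by blast+
    then show ?thesis by simp
  next
    case False
    then have "corner_twist k m y $$ (i - k, m - 1) = c * corner_twist k m x $$ (i - k, m - 1)"
      using c i by simp
    then show ?thesis using corner_twist_last_col[OF m, of "i - k" k] False i by simp
  qed
  then show "\<exists>c. \<forall>i<k + m. y $$ (i, k + m - 1) = c * x $$ (i, k + m - 1)" by blast
qed

theorem K_set_quotient_poisson_diffeomorphic:
  assumes m: "2 \<le> m"
  shows "poisson_diffeomorphic
    (std_homogeneous (k + m) (K_set (k + m) k) (K_set (k + m) k \<inter> K_set (k + m) (k + m - 1)))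
    (std_projective (m - 1))"
proof -
  let ?n = "k + m" and ?K = "K_set (k + m) k" and ?SU = "SU_set m"
  have m1: "m - 1 + 1 = m" and m0: "0 < m" and n0: "0 < ?n" using m by auto
  have KSU: "?K \<subseteq> SU_set ?n" by (auto simp: K_set_iff)
  have Kc: "?K \<subseteq> carrier_mat ?n ?n" using KSU SU_set_carrier by blast
  have SUc: "?SU \<subseteq> carrier_mat m m" using SU_set_carrier by blast
  \<comment> \<open>The isotropy group is rewritten as an intersection so that
    \<open>coset_eq_iff_last_col\<close> applies to both quotients in the same form.\<close>
  have "S_block [m - 1, 1] = K_set m (m - 1)" using m by (simp add: K_set_def)
  also have "\<dots> = ?SU \<inter> K_set m (m - 1)" by (auto simp: K_set_iff)
  finally have P: "std_projective (m - 1) = std_homogeneous m ?SU (?SU \<inter> K_set m (m - 1))"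
    unfolding std_projective_def m1 by (rule arg_cong)
  have s: "smooth_morphism (std_poisson ?n ?K) (std_poisson m ?SU) (corner_twist k m)"
    by (rule smooth_morphism_std_poisson[OF smooth_map_corner_twist Kc corner_twist_SU_set[OF _ m0]])
  have j: "smooth_morphism (std_poisson m ?SU) (std_poisson ?n ?K) (corner_embed k m)"
    by (rule smooth_morphism_std_poisson[OF smooth_map_corner_embed SUc corner_embed_K_set])
  show ?thesis
    unfolding P unfolding std_homogeneous_def
  proof (rule poisson_diffeomorphic_quotients[OF s j smooth_fun_local_std_poisson smooth_fun_local_std_poisson])
    show "corner_twist k m (corner_embed k m y) = y" if "y \<in> topspace (top_of (std_poisson m ?SU))" for y
      using that SUc unfolding topspace_std_poisson[OF SUc] by (intro corner_twist_embed) auto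
    show "x <#\<^bsub>mat_lie_group ?n ?K\<^esub> (?K \<inter> K_set ?n (?n - 1)) = y <#\<^bsub>mat_lie_group ?n ?K\<^esub> (?K \<inter> K_set ?n (?n - 1)) \<longleftrightarrow>
        corner_twist k m x <#\<^bsub>mat_lie_group m ?SU\<^esub> (?SU \<inter> K_set m (m - 1)) =
        corner_twist k m y <#\<^bsub>mat_lie_group m ?SU\<^esub> (?SU \<inter> K_set m (m - 1))"
      if "x \<in> topspace (top_of (std_poisson ?n ?K))" "y \<in> topspace (top_of (std_poisson ?n ?K))" for x y
    proof -
      have xy: "x \<in> ?K" "y \<in> ?K" using that unfolding topspace_std_poisson[OF Kc] .
      have L: "x <#\<^bsub>mat_lie_group ?n ?K\<^esub> (?K \<inter> K_set ?n (?n - 1)) = y <#\<^bsub>mat_lie_group ?n ?K\<^esub> (?K \<inter> K_set ?n (?n - 1)) \<longleftrightarrow>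
          (\<exists>c. \<forall>i<?n. y $$ (i, ?n - 1) = c * x $$ (i, ?n - 1))"
        by (rule coset_eq_iff_last_col[OF KSU n0 K_set_mult[OF le_add1] K_set_adjoint[OF le_add1] K_set_one[OF le_add1] xy])
      have R: "corner_twist k m x <#\<^bsub>mat_lie_group m ?SU\<^esub> (?SU \<inter> K_set m (m - 1)) =
          corner_twist k m y <#\<^bsub>mat_lie_group m ?SU\<^esub> (?SU \<inter> K_set m (m - 1)) \<longleftrightarrow>
          (\<exists>c. \<forall>i<m. corner_twist k m y $$ (i, m - 1) = c * corner_twist k m x $$ (i, m - 1))"
        by (rule coset_eq_iff_last_col[OF subset_refl m0 SU_set_mult SU_set_adjoint SU_set_one
              corner_twist_SU_set[OF xy(1) m0] corner_twist_SU_set[OF xy(2) m0]])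
      show ?thesis unfolding L R by (rule corner_twist_proportional_iff[OF m xy])
    qed
    show "bracket (std_poisson ?n ?K) U f h x = bracket (std_poisson ?n ?K) U f' h' x"
      if "\<And>y. y \<in> U \<Longrightarrow> f y = f' y \<and> h y = h' y" for U f f' h h' x
      by (rule bracket_std_poisson_cong[OF that])
    show "bracket (std_poisson ?n ?K) (preimage (std_poisson ?n ?K) (corner_twist k m) U)
        (f \<circ> corner_twist k m) (h \<circ> corner_twist k m) x = bracket (std_poisson m ?SU) U f h (corner_twist k m x)"
      if "openin (top_of (std_poisson m ?SU)) U" "f \<in> smooth_fun (std_poisson m ?SU) U"
        "h \<in> smooth_fun (std_poisson m ?SU) U" "x \<in> preimage (std_poisson ?n ?K) (corner_twist k m) U" for U f h x
      by (rule bracket_corner_twist[OF m0 that(1-3) refl openin_preimage[OF s that(1)] that(4)])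
  qed
qed

section \<open>Isomorphisms of Lie groups\<close>

text \<open>The two matrix spaces may differ in size, so only the restrictions are mutually inverse,
  each covered by its own ambient map.\<close>

lemma diffeomorphism_embedded_spaces:
  assumes G: "smooth_map n m G" and G': "smooth_map m n G'"
    and \<phi>: "\<And>x. x \<in> S \<Longrightarrow> \<phi> x \<in> S'" and \<psi>: "\<And>y. y \<in> S' \<Longrightarrow> \<psi> y \<in> S"
    and inv: "\<And>x. x \<in> S \<Longrightarrow> \<psi> (\<phi> x) = x" "\<And>y. y \<in> S' \<Longrightarrow> \<phi> (\<psi> y) = y"
    and \<iota>: "\<And>x. x \<in> S \<Longrightarrow> \<iota> x \<in> carrier_mat n n" "\<And>y. y \<in> S' \<Longrightarrow> \<iota>' y \<in> carrier_mat m m"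
    and eq: "\<And>x. x \<in> S \<Longrightarrow> \<iota>' (\<phi> x) = G (\<iota> x)" "\<And>y. y \<in> S' \<Longrightarrow> \<iota> (\<psi> y) = G' (\<iota>' y)"
  shows "diffeomorphism (embedded_space n \<iota> S) (embedded_space m \<iota>' S') \<phi>"
proof (rule diffeomorphism_if_inverse_morphisms[where \<psi> = \<psi>])
  show "smooth_morphism (embedded_space n \<iota> S) (embedded_space m \<iota>' S') \<phi>"
    by (rule smooth_morphism_embedded_space[OF G], erule \<phi>, erule \<iota>(1), erule eq(1))
  show "smooth_morphism (embedded_space m \<iota>' S') (embedded_space n \<iota> S) \<psi>"
    by (rule smooth_morphism_embedded_space[OF G'], erule \<psi>, erule \<iota>(2), erule eq(2))
  show "smooth_fun_local (embedded_space m \<iota>' S')" by (rule smooth_fun_local_embedded_space)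
  show "\<psi> (\<phi> x) = x" if "x \<in> topspace (top_of (embedded_space n \<iota> S))" for x
    using that inv(1) topspace_embedded_space[of S \<iota> n, OF \<iota>(1)] by simp
  show "\<phi> (\<psi> y) = y" if "y \<in> topspace (top_of (embedded_space m \<iota>' S'))" for y
    using that inv(2) topspace_embedded_space[of S' \<iota>' m, OF \<iota>(2)] by simp
qed

text \<open>The first isomorphism of the theorem is between equal sets of matrices, so the identity
  serves.\<close>

lemma lie_isomorphic_mat_refl:
  assumes "S \<subseteq> carrier_mat n n"
  shows "lie_isomorphic (mat_lie_group n S) (mat_lie_group n S)"
proof -
  have "smooth_map n n (\<lambda>A. A)" by (simp add: smooth_map_def smooth_complex_index)
  then have "diffeomorphism (embedded_space n (\<lambda>A. A) S) (embedded_space n (\<lambda>A. A) S) (\<lambda>A. A)"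
    by (rule diffeomorphism_embedded_spaces[where \<psi> = "\<lambda>A. A" and G' = "\<lambda>A. A"]) (use assms \<open>smooth_map n n _\<close> in auto)
  moreover have "(\<lambda>A. A) \<in> iso (mat_lie_group n S) (mat_lie_group n S)"
    by (auto simp: iso_def hom_def mat_lie_group_def bij_betw_def)
  ultimately show ?thesis
    unfolding lie_isomorphic_def by (intro exI[of _ "\<lambda>A. A"]) (simp add: manifold_of_def mat_lie_group_def)
qed

text \<open>Zeros of \<open>A\<close> in the rows of the block, to its left and right, cut the
  product sum down to the block.\<close>

lemma sub_block_mult:
  assumes A: "A \<in> carrier_mat n n" and B: "B \<in> carrier_mat n n" and n: "n = l + d + r"
    and z: "\<And>i a. l \<le> i \<Longrightarrow> i < l + d \<Longrightarrow> a < n \<Longrightarrow> a < l \<or> l + d \<le> a \<Longrightarrow> A $$ (i, a) = 0"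
  shows "sub_block l d (A * B) = sub_block l d A * sub_block l d B"
proof (rule eq_matI)
  fix i j assume "i < dim_row (sub_block l d A * sub_block l d B)" "j < dim_col (sub_block l d A * sub_block l d B)"
  then have ij: "i < d" "j < d" by auto
  have "(A * B) $$ (l + i, l + j) = (\<Sum>a<l + d + r. A $$ (l + i, a) * B $$ (a, l + j))"
    using index_mult_mat_sum[OF A B, of "l + i" "l + j"] ij n by simp
  also have "\<dots> = (\<Sum>a<d. A $$ (l + i, l + a) * B $$ (l + a, l + j))"
  proof -
    have "(\<Sum>a<l. A $$ (l + i, a) * B $$ (a, l + j)) = 0"
      using z[of "l + i"] ij n by (intro sum.neutral) auto
    moreover have "(\<Sum>a<r. A $$ (l + i, l + d + a) * B $$ (l + d + a, l + j)) = 0"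
      using z[of "l + i"] ij n by (intro sum.neutral) auto
    ultimately show ?thesis unfolding sum_lessThan_add by simp
  qed
  also have "\<dots> = (sub_block l d A * sub_block l d B) $$ (i, j)"
    using ij by (simp add: index_mult_mat_sum[OF sub_block_carrier sub_block_carrier] del: index_mult_mat(1))
  finally show "sub_block l d (A * B) $$ (i, j) = (sub_block l d A * sub_block l d B) $$ (i, j)"
    unfolding sub_block_index[OF ij] .
qed auto

text \<open>For \<open>l\<close>-by-\<open>l\<close> matrices \<open>sub_block 0 l X\<close> is
  \<open>X\<close> itself, in the explicit \<open>mat\<close> form to which
  \<open>smooth_complex_det\<close> applies.\<close>

definition det_close :: "nat \<Rightarrow> complex mat \<Rightarrow> complex mat" where
  "det_close l X = mat (l + 1) (l + 1) (\<lambda>(a, b). if a < l \<and> b < l then X $$ (a, b)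
     else if a = l \<and> b = l then cnj (det (sub_block 0 l X)) else 0)"

lemma det_close_carrier [simp]: "det_close l X \<in> carrier_mat (l + 1) (l + 1)"
  and det_close_index: "a < l + 1 \<Longrightarrow> b < l + 1 \<Longrightarrow> det_close l X $$ (a, b) =
    (if a < l \<and> b < l then X $$ (a, b) else if a = l \<and> b = l then cnj (det (sub_block 0 l X)) else 0)"
  by (simp_all add: det_close_def)

lemma smooth_map_det_close: "smooth_map l (l + 1) (det_close l)"
  unfolding smooth_map_def
proof (intro conjI ballI allI impI det_close_carrier)
  fix a b assume ab: "a < l + 1" "b < l + 1"
  have d: "smooth_complex l (\<lambda>A. cnj (det (sub_block 0 l A)))"
    unfolding sub_block_def
    by (rule smooth_complex_cnj, rule smooth_complex_det) (simp add: smooth_complex_index)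
  show "smooth_complex l (\<lambda>A. det_close l A $$ (a, b))"
    unfolding det_close_index[OF ab]
    by (cases "a < l \<and> b < l"; cases "a = l \<and> b = l") (use d in \<open>auto simp: smooth_complex_index\<close>)
qed

lemma smooth_map_sub_block: "l + d \<le> n \<Longrightarrow> smooth_map n d (sub_block l d)"
  by (simp add: smooth_map_def smooth_complex_index)

lemma sub_block_self: "A \<in> carrier_mat n n \<Longrightarrow> sub_block 0 n A = A"
  by (rule eq_matI) auto

lemma det_close_eq_diag:
  assumes X: "X \<in> carrier_mat l l"
  shows "det_close l X = diag_block_mat [X, mat 1 1 (\<lambda>_. cnj (det X))]"
proof (rule eq_matI)
  let ?C = "mat 1 1 (\<lambda>_. cnj (det X))"
  have C: "?C \<in> carrier_mat 1 1" by simp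
  note D = diag_block_mat_two_carrier[OF X C]
  show "dim_row (det_close l X) = dim_row (diag_block_mat [X, ?C])"
    "dim_col (det_close l X) = dim_col (diag_block_mat [X, ?C])"
    using D det_close_carrier[of l X] unfolding carrier_mat_def by auto
  fix a b assume "a < dim_row (diag_block_mat [X, ?C])" "b < dim_col (diag_block_mat [X, ?C])"
  then have ab: "a < l + 1" "b < l + 1" using D by auto
  show "det_close l X $$ (a, b) = diag_block_mat [X, ?C] $$ (a, b)"
    unfolding det_close_index[OF ab] diag_block_mat_two_index[OF X C ab] sub_block_self[OF X]
    using ab by auto
qed

lemma det_close_S_block:
  assumes "A \<in> U_set k" "B \<in> U_set m"
  shows "det_close (k + m) (diag_block_mat [A, B]) \<in> S_block [k, m, 1]"
proof (rule S_blockI)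
  let ?X = "diag_block_mat [A, B]" and ?C = "mat 1 1 (\<lambda>_. cnj (det (diag_block_mat [A, B])))"
  have X: "?X \<in> U_set (k + m)" by (rule diag_block_mat_two_U[OF assms])
  note Xc = U_set_carrier[OF X]
  have dX: "cnj (det ?X) * det ?X = 1" by (rule U_set_det[OF X])
  show "det_close (k + m) ?X = diag_block_mat [A, B, ?C]"
    unfolding det_close_eq_diag[OF Xc] diag_block_mat_three(2) ..
  have "?C \<in> U_set 1"
    by (rule U_setI) (use dX in \<open>auto simp: mult.commute\<close>)
  then show "list_all2 (\<lambda>d A. A \<in> U_set d) [k, m, 1] [A, B, ?C]" using assms by simp
  have C: "?C \<in> carrier_mat 1 1" by simp
  show "det (det_close (k + m) ?X) = 1"
    unfolding det_close_eq_diag[OF Xc] diag_block_mat_two_det[OF Xc C] det_single[OF C]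
    using dX by (simp add: mult.commute)
qed

lemma det_close_sub_block:
  assumes A: "A \<in> SU_set (l + 1)" "block_diagonal (l + 1) l A"
  shows "det_close l (sub_block 0 l A) = A"
proof -
  have U: "A \<in> U_set (l + 1)" "det A = 1" using A by (auto simp: SU_set_def)
  let ?M = "sub_block 0 l A" and ?c = "sub_block l 1 A"
  have M: "cnj (det ?M) * det ?M = 1" by (rule U_set_det[OF sub_block_U_set(1)[OF U(1) A(2)]])
  have "det A = det ?M * det ?c"
    by (subst block_diagonal_decompose[OF U_set_carrier[OF U(1)] A(2)])
      (rule diag_block_mat_two_det[OF sub_block_carrier sub_block_carrier])
  then have "det ?M * det ?c = 1" using U(2) by simp
  \<comment> \<open>Multiplication by the conjugate cancels \<open>det ?M\<close>, which has modulus
    one.\<close>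
  then have "cnj (det ?M) * (det ?M * det ?c) = cnj (det ?M)" by simp
  then have c: "det ?c = cnj (det ?M)" unfolding mult.assoc[symmetric] M by simp
  have "mat 1 1 (\<lambda>_. cnj (det ?M)) = ?c"
    unfolding c[symmetric] det_single[OF sub_block_carrier] by (rule eq_matI) auto
  then show ?thesis
    unfolding det_close_eq_diag[OF sub_block_carrier]
    using block_diagonal_decompose[OF U_set_carrier[OF U(1)] A(2)] by simp
qed

text \<open>As \<open>lie_prod\<close> embeds a pair as a block-diagonal matrix of size
  \<open>k + m\<close>, the isomorphism deletes the last row and column on the ambient spaces, and
  \<open>det_close\<close> restores them.\<close>

theorem lie_isomorphic_S_block_three:
  "lie_isomorphic (mat_lie_group (k + m + 1) (S_block [k, m, 1]))
     (lie_prod (mat_lie_group k (U_set k)) (mat_lie_group m (U_set m)))"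
proof -
  let ?n = "k + m + 1" and ?S = "S_block [k, m, 1]"
  define \<phi> where "\<phi> A = (sub_block 0 k A, sub_block k m A)" for A
  define \<psi> where "\<psi> = (\<lambda>(A, B). det_close (k + m) (diag_block_mat [A, B]))"
  have S: "A \<in> SU_set ?n" "block_diagonal ?n k A" "block_diagonal ?n (k + m) A" if "A \<in> ?S" for A
    using that unfolding S_block_three by (auto simp: K_set_iff)
  have SU: "sub_block 0 (k + m) A \<in> U_set (k + m)" "block_diagonal (k + m) k (sub_block 0 (k + m) A)"
    if "A \<in> ?S" for A
  proof -
    show "sub_block 0 (k + m) A \<in> U_set (k + m)"
      by (rule sub_block_U_set(1)[of _ "k + m" 1]) (use S[OF that] in \<open>auto simp: SU_set_def\<close>)
    show "block_diagonal (k + m) k (sub_block 0 (k + m) A)"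
      using S(2)[OF that] by (auto simp: block_diagonal_def)
  qed
  have sub_sub: "sub_block 0 k (sub_block 0 (k + m) A) = sub_block 0 k A"
    "sub_block k m (sub_block 0 (k + m) A) = sub_block k m A" for A
    by (rule eq_matI; simp)+
  have \<phi>: "\<phi> A \<in> U_set k \<times> U_set m" if "A \<in> ?S" for A
    using sub_block_U_set[OF SU[OF that]] unfolding sub_sub \<phi>_def by simp
  have diag_\<phi>: "diag_block_mat [sub_block 0 k A, sub_block k m A] = sub_block 0 (k + m) A" if "A \<in> ?S" for A
    using block_diagonal_decompose[OF sub_block_carrier SU(2)[OF that]] unfolding sub_sub by (rule sym)
  have \<psi>: "\<psi> p \<in> ?S" if "p \<in> U_set k \<times> U_set m" for p
    using that det_close_S_block[of "fst p" k "snd p" m] unfolding \<psi>_def case_prod_unfold by (simp add: mem_Times_iff)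
  have \<psi>\<phi>: "\<psi> (\<phi> A) = A" if "A \<in> ?S" for A
    unfolding \<psi>_def \<phi>_def prod.case diag_\<phi>[OF that]
    by (rule det_close_sub_block) (use S[OF that] in auto)
  have \<phi>\<psi>: "\<phi> (\<psi> p) = p" if p: "p \<in> U_set k \<times> U_set m" for p
  proof -
    obtain A B where AB: "p = (A, B)" "A \<in> U_set k" "B \<in> U_set m" using p by auto
    note c = U_set_carrier[OF AB(2)] U_set_carrier[OF AB(3)]
    have "sub_block 0 k (\<psi> p) = A" "sub_block k m (\<psi> p) = B"
      unfolding \<psi>_def AB(1) prod.case
      by (rule eq_matI; use c in \<open>simp add: det_close_index diag_block_mat_two_index[OF c]\<close>)+
    then show ?thesis unfolding \<phi>_def AB(1) by simp
  qed
  have "diffeomorphism (embedded_space ?n (\<lambda>A. A) ?S)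
      (embedded_space (k + m) (\<lambda>(A, B). diag_block_mat [A, B]) (U_set k \<times> U_set m)) \<phi>"
  proof (rule diffeomorphism_embedded_spaces[where \<psi> = \<psi> and G = "sub_block 0 (k + m)" and G' = "det_close (k + m)"])
    show "smooth_map ?n (k + m) (sub_block 0 (k + m))" by (rule smooth_map_sub_block) simp
    show "smooth_map (k + m) ?n (det_close (k + m))" by (rule smooth_map_det_close)
    show "A \<in> carrier_mat ?n ?n" if "A \<in> ?S" for A using S(1)[OF that] by (rule SU_set_carrier)
    show "(case p of (A, B) \<Rightarrow> diag_block_mat [A, B]) \<in> carrier_mat (k + m) (k + m)"
      if "p \<in> U_set k \<times> U_set m" for p
    proof (cases p)
      case (Pair A B)
      then show ?thesis
        using that diag_block_mat_two_carrier[OF U_set_carrier U_set_carrier, of A k B m] by simp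
    qed
    show "(case \<phi> A of (A, B) \<Rightarrow> diag_block_mat [A, B]) = sub_block 0 (k + m) A" if "A \<in> ?S" for A
      unfolding \<phi>_def prod.case by (rule diag_\<phi>[OF that])
    show "\<psi> p = det_close (k + m) (case p of (A, B) \<Rightarrow> diag_block_mat [A, B])" for p
      unfolding \<psi>_def by (cases p) simp
  qed (erule \<phi> \<psi> \<psi>\<phi> \<phi>\<psi>)+
  then have "diffeomorphism (manifold_of (mat_lie_group ?n ?S))
      (manifold_of (lie_prod (mat_lie_group k (U_set k)) (mat_lie_group m (U_set m)))) \<phi>"
    by (simp add: manifold_of_def mat_lie_group_def lie_prod_def DirProd_def)
  moreover have "\<phi> \<in> iso (mat_lie_group ?n ?S) (lie_prod (mat_lie_group k (U_set k)) (mat_lie_group m (U_set m)))"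
  proof -
    have hom: "\<phi> (A * B) = (fst (\<phi> A) * fst (\<phi> B), snd (\<phi> A) * snd (\<phi> B))" if "A \<in> ?S" "B \<in> ?S" for A B
    proof -
      note c = SU_set_carrier[OF S(1)[OF that(1)]] SU_set_carrier[OF S(1)[OF that(2)]]
      have "sub_block 0 k (A * B) = sub_block 0 k A * sub_block 0 k B"
        by (rule sub_block_mult[OF c, of _ _ "m + 1"]) (use S(2)[OF that(1)] in \<open>auto simp: block_diagonal_def\<close>)
      moreover have "sub_block k m (A * B) = sub_block k m A * sub_block k m B"
      proof (rule sub_block_mult[OF c, of _ _ 1])
        \<comment> \<open>The middle block is isolated on both sides: entries to its left vanish by
          the pattern at \<open>k\<close>, the one to its right by the pattern at
          \<open>k + m\<close>.\<close>
        fix i a assume i: "k \<le> i" "i < k + m" "a < ?n" "a < k \<or> k + m \<le> a"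
        show "A $$ (i, a) = 0"
        proof (cases "a < k")
          case True
          then show ?thesis using S(2)[OF that(1)] i unfolding block_diagonal_def by simp
        next
          case False
          then have "a = k + m" using i by auto
          then show ?thesis using S(3)[OF that(1)] i(2) unfolding block_diagonal_def by simp
        qed
      qed simp
      ultimately show ?thesis unfolding \<phi>_def by simp
    qed
    have bij: "bij_betw \<phi> ?S (U_set k \<times> U_set m)"
    proof (rule bij_betw_byWitness[where f' = \<psi>])
      show "\<phi> ` ?S \<subseteq> U_set k \<times> U_set m" "\<psi> ` (U_set k \<times> U_set m) \<subseteq> ?S" using \<phi> \<psi> by blast+
    qed (use \<psi>\<phi> \<phi>\<psi> in blast)+
    have "\<phi> \<in> ?S \<rightarrow> U_set k \<times> U_set m" using \<phi> by (rule Pi_I)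
    then show ?thesis
      unfolding iso_def hom_def mat_lie_group_def lie_prod_def DirProd_def
      using bij hom by (simp add: case_prod_unfold)
  qed
  ultimately show ?thesis unfolding lie_isomorphic_def by blast
qed

section \<open>Last columns\<close>

lemma proj_class_smult:
  assumes "c \<noteq> 0"
  shows "proj_class (c \<cdot>\<^sub>v Z) = proj_class Z"
proof -
  have "\<exists>d'. d \<cdot>\<^sub>v (c \<cdot>\<^sub>v Z) = d' \<cdot>\<^sub>v Z \<and> d' \<noteq> 0" if "d \<noteq> 0" for d
    using assms that by (intro exI[of _ "d * c"]) (simp add: smult_smult_assoc)
  moreover have "\<exists>d'. d \<cdot>\<^sub>v Z = d' \<cdot>\<^sub>v (c \<cdot>\<^sub>v Z) \<and> d' \<noteq> 0" if "d \<noteq> 0" for d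
    using assms that by (intro exI[of _ "d / c"]) (simp add: smult_smult_assoc)
  ultimately show ?thesis unfolding proj_class_def by blast
qed

lemma U_set_col_nonzero:
  assumes A: "A \<in> U_set n" and j: "j < n"
  shows "col A j \<noteq> 0\<^sub>v n"
proof
  assume "col A j = 0\<^sub>v n"
  then have "A $$ (i, j) = 0" if "i < n" for i
    using U_set_carrier[OF A] that j by (metis carrier_matD(1,2) index_col index_zero_vec(1))
  then have "(\<Sum>a<n. cnj (A $$ (a, j)) * A $$ (a, j)) = 0" by simp
  then show False using U_set_cols[OF A j j] by simp
qed

lemma p_map_eq_if_proportional:
  assumes A: "A \<in> U_set n" and B: "B \<in> U_set n" and n: "0 < n"
    and c: "\<And>i. i < n \<Longrightarrow> B $$ (i, n - 1) = c * A $$ (i, n - 1)"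
  shows "p_map n B = p_map n A"
proof -
  have "col B (n - 1) = c \<cdot>\<^sub>v col A (n - 1)"
    by (rule eq_vecI) (use U_set_carrier[OF A] U_set_carrier[OF B] n c in auto)
  moreover have "c \<noteq> 0"
  proof
    assume "c = 0"
    then have "col B (n - 1) = 0\<^sub>v n"
      by (intro eq_vecI) (use U_set_carrier[OF B] n c in auto)
    then show False using U_set_col_nonzero[OF B, of "n - 1"] n by simp
  qed
  ultimately show ?thesis unfolding p_map_def by (simp add: proj_class_smult)
qed

text \<open>Here \<open>N\<close> stands for the squared norm of a vector and \<open>z\<close> for
  its last coordinate: \<open>l\<close> normalises the vector and makes this coordinate real and
  nonpositive, as \<open>householder\<close> requires.\<close>

lemma ex_scaling_to_unit_vector:
  assumes "0 < N"
  obtains l :: complex and r :: real where "l \<noteq> 0" "r \<ge> 0" "l * z = - of_real r" "cnj l * l * of_real N = 1"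
proof
  \<comment> \<open>A phase turning \<open>z\<close> into minus its modulus; for
    \<open>z = 0\<close> every phase does so, and 1 is taken.\<close>
  define s where "s = (if z = 0 then 1 else - cnj (sgn z))"
  define l where "l = s * of_real (1 / sqrt N)"
  have s: "cnj s * s = 1"
  proof (cases "z = 0")
    case False
    then have "cmod s = 1" by (simp add: s_def norm_sgn)
    then show ?thesis using complex_norm_square[of s] by (simp add: mult.commute)
  qed (simp add: s_def)
  have sz: "s * z = - of_real (cmod z)"
  proof (cases "z = 0")
    case False
    have "cnj (sgn z) * z = of_real (cmod z)"
    proof -
      have "cnj (sgn z) * z = (z * cnj z) / of_real (cmod z)"
        by (simp add: sgn_eq)
      also have "\<dots> = of_real (cmod z)"
        using False unfolding complex_norm_square[symmetric] by (simp add: power2_eq_square)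
      finally show ?thesis .
    qed
    then show ?thesis using False by (simp add: s_def)
  qed (simp add: s_def)
  have "s \<noteq> 0" using s by auto
  then show "l \<noteq> 0" using assms by (simp add: l_def)
  show "0 \<le> cmod z / sqrt N" using assms by simp
  have "l * z = (s * z) * of_real (1 / sqrt N)" unfolding l_def by (simp only: mult_ac)
  also have "\<dots> = - of_real (cmod z / sqrt N)" unfolding sz by simp
  finally show "l * z = - of_real (cmod z / sqrt N)" .
  have "cnj l * l * of_real N = (cnj s * s) * of_real (1 / sqrt N * (1 / sqrt N) * N)"
    unfolding l_def by (simp only: complex_cnj_mult complex_cnj_complex_of_real of_real_mult mult_ac)
  also have "1 / sqrt N * (1 / sqrt N) * N = 1" using assms by (simp add: field_simps)
  finally show "cnj l * l * of_real N = 1" unfolding s by simp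
qed

text \<open>The last entry of \<open>w\<close> is \<open>\<le> 0\<close> so that the reflection vector \<open>e - w\<close> is nonzero.\<close>

lemma householder:
  fixes w :: "nat \<Rightarrow> complex"
  assumes norm: "(\<Sum>i<n. cnj (w i) * w i) = 1" and n: "0 < n" and r: "w (n - 1) = - of_real r" "r \<ge> 0"
  obtains B where "B \<in> U_set n" "\<And>i. i < n \<Longrightarrow> B $$ (i, n - 1) = w i"
    "\<And>i j. i < n - 1 \<Longrightarrow> j < n \<Longrightarrow> w i = 0 \<Longrightarrow> B $$ (i, j) = (if i = j then 1 else 0) \<and>
       B $$ (j, i) = (if i = j then 1 else 0)"
proof
  define v where "v i = (if i = n - 1 then 1 else 0) - w i" for i
  \<comment> \<open>This is both the last entry of \<open>v\<close> and half the squared norm of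
    \<open>v\<close>. So \<open>B\<close> below is the reflection 1 - 2 v v* / |v|^2, and it sends
    the last basis vector e to e - v = w.\<close>
  define s :: complex where "s = 1 + of_real r"
  have s0: "s \<noteq> 0" using r(2) unfolding s_def by (metis add_nonneg_eq_0_iff of_real_1 of_real_add of_real_eq_0_iff zero_le_one zero_neq_one)
  have cs: "cnj s = s" by (simp add: s_def)
  have l: "n - 1 < n" using n by simp
  have "(\<Sum>i<n. cnj (v i) * v i) = (\<Sum>i<n. cnj (w i) * w i + (if i = n - 1 then 1 - cnj (w i) - w i else 0))"
    by (intro sum.cong refl) (simp add: v_def algebra_simps)
  also have "\<dots> = 2 * s"
    unfolding sum.distrib norm using l r(1) by (simp add: s_def)
  finally have vv: "(\<Sum>i<n. cnj (v i) * v i) = 2 * s" .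
  have vl: "v (n - 1) = s" using r(1) by (simp add: v_def s_def)
  define B where "B = mat n n (\<lambda>(a, b). (if a = b then 1 else 0) - v a * cnj (v b) / s)"
  have Bi: "B $$ (a, b) = (if a = b then 1 else 0) - v a * cnj (v b) / s" if "a < n" "b < n" for a b
    using that by (simp add: B_def)
  show "B \<in> U_set n"
  proof (rule U_setI)
    show "B \<in> carrier_mat n n" by (simp add: B_def)
    fix i j assume ij: "i < n" "j < n"
    have "(\<Sum>a<n. cnj (B $$ (a, i)) * B $$ (a, j)) =
        (\<Sum>a<n. (if a = i then (if i = j then 1 else 0) - v i * cnj (v j) / s else 0) -
          (if a = j then cnj (v j) * v i / s else 0) + (cnj (v a) * v a) * (v i * cnj (v j) / (s * s)))"
      using ij by (intro sum.cong refl) (auto simp: Bi cs field_simps s0)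
    also have "\<dots> = (if i = j then 1 else 0) - v i * cnj (v j) / s - cnj (v j) * v i / s + 2 * s * (v i * cnj (v j) / (s * s))"
      unfolding sum.distrib sum_subtractf sum_distrib_right[symmetric] vv using ij by simp
    also have "\<dots> = (if i = j then 1 else 0)" using s0 by (simp add: field_simps)
    finally show "(\<Sum>a<n. cnj (B $$ (a, i)) * B $$ (a, j)) = (if i = j then 1 else 0)" .
  qed
  show "B $$ (i, n - 1) = w i" if "i < n" for i
    unfolding Bi[OF that l] vl cs using s0 by (simp add: v_def)
  show "B $$ (i, j) = (if i = j then 1 else 0) \<and> B $$ (j, i) = (if i = j then 1 else 0)"
    if "i < n - 1" "j < n" "w i = 0" for i j
  proof -
    have "v i = 0" using that by (simp add: v_def)
    moreover have "i < n" using that by simp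
    ultimately show ?thesis using that(2) by (simp add: Bi eq_commute[of j])
  qed
qed

text \<open>The reflection fixes the first \<open>k\<close> basis vectors because the target column
  vanishes there, so it is block-diagonal. Its determinant is then corrected in column 0, which
  differs from the last column because \<open>2 \<le> n\<close>.\<close>

lemma K_set_ex_last_col:
  assumes Z: "Z \<in> carrier_vec n" "Z \<noteq> 0\<^sub>v n" "\<forall>i<k. vec_index Z i = 0" and k: "k < n" and n: "2 \<le> n"
  obtains A c where "A \<in> K_set n k" "c \<noteq> 0" "col A (n - 1) = c \<cdot>\<^sub>v Z"
proof -
  define N where "N = (\<Sum>i<n. (cmod (vec_index Z i))\<^sup>2)"
  obtain i where i: "i < n" "vec_index Z i \<noteq> 0" using Z(1,2) by (metis carrier_vecD eq_vecI index_zero_vec(1,2))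
  have "0 < (cmod (vec_index Z i))\<^sup>2" using i by simp
  also have "\<dots> \<le> N" unfolding N_def using i by (intro member_le_sum) auto
  finally have "0 < N" .
  then obtain c r where c: "c \<noteq> 0" "r \<ge> 0" "c * vec_index Z (n - 1) = - of_real r" "cnj c * c * of_real N = 1"
    by (rule ex_scaling_to_unit_vector)
  define w where "w i = c * vec_index Z i" for i
  have "(\<Sum>i<n. cnj (w i) * w i) = (\<Sum>i<n. (cnj c * c) * of_real ((cmod (vec_index Z i))\<^sup>2))"
    unfolding w_def complex_norm_square by (intro sum.cong refl) (simp add: mult_ac)
  also have "\<dots> = cnj c * c * of_real N" unfolding N_def of_real_sum sum_distrib_left ..
  finally have norm: "(\<Sum>i<n. cnj (w i) * w i) = 1" unfolding c(4) .
  have n0: "0 < n" and wl: "w (n - 1) = - of_real r" using n c(3) by (simp_all add: w_def)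
  obtain B where B: "B \<in> U_set n" "\<And>i. i < n \<Longrightarrow> B $$ (i, n - 1) = w i"
    "\<And>i j. i < n - 1 \<Longrightarrow> j < n \<Longrightarrow> w i = 0 \<Longrightarrow> B $$ (i, j) = (if i = j then 1 else 0) \<and>
       B $$ (j, i) = (if i = j then 1 else 0)"
    by (rule householder[OF norm n0 wl c(2)]) (rule that)
  define A where "A = scale_first_col n (cnj (det B)) B"
  note Bc = U_set_carrier[OF B(1)]
  have dB: "cnj (det B) * det B = 1" by (rule U_set_det[OF B(1)])
  have "A \<in> U_set n"
    unfolding A_def by (rule scale_first_col_U_set[OF B(1)]) (use dB in \<open>simp add: mult.commute\<close>)
  moreover have "det A = 1" unfolding A_def det_scale_first_col[OF Bc n0] by (rule dB)
  moreover have "block_diagonal n k A"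
    unfolding block_diagonal_def
  proof (intro allI impI ballI)
    fix i j assume ij: "i < k" "j \<in> {k..<n}"
    then have "i < n - 1" "i < n" "j < n" "i \<noteq> j" "w i = 0" using k Z(3) by (auto simp: w_def)
    then show "A $$ (i, j) = 0 \<and> A $$ (j, i) = 0"
      using B(3)[of i j] unfolding A_def by (simp add: scale_first_col_index)
  qed
  ultimately have "A \<in> K_set n k" using k by (simp add: K_set_iff SU_set_def)
  moreover have "col A (n - 1) = c \<cdot>\<^sub>v Z"
  proof (rule eq_vecI)
    show "dim_vec (col A (n - 1)) = dim_vec (c \<cdot>\<^sub>v Z)" using Z(1) by (simp add: A_def)
    fix i assume "i < dim_vec (c \<cdot>\<^sub>v Z)"
    then have i: "i < n" using Z(1) by simp
    have "n - 1 < n" "n - 1 \<noteq> 0" using n by auto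
    then show "vec_index (col A (n - 1)) i = vec_index (c \<cdot>\<^sub>v Z) i"
      using i Z(1) B(2)[OF i] unfolding A_def by (simp add: scale_first_col_index w_def)
  qed
  ultimately show thesis using that c(1) by blast
qed

text \<open>Equal cosets have proportional last columns, and the factor is nonzero since columns of
  unitary matrices are nonzero; so \<open>p_map\<close> descends to cosets. The image is all of
  \<open>X_set\<close> by \<open>K_set_ex_last_col\<close>.\<close>

theorem K_set_quotient_projects_onto_X_set:
  assumes k: "k < n" and n: "2 \<le> n"
  shows "\<exists>pbar. (\<forall>A \<in> K_set n k.
      pbar (A <#\<^bsub>mat_lie_group n (K_set n k)\<^esub> (K_set n k \<inter> K_set n (n - 1))) = p_map n A) \<and>
    pbar ` (lcosets\<^bsub>mat_lie_group n (K_set n k)\<^esub> (K_set n k \<inter> K_set n (n - 1))) = X_set n k"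
proof -
  let ?K = "K_set n k"
  let ?q = "\<lambda>A. A <#\<^bsub>mat_lie_group n ?K\<^esub> (?K \<inter> K_set n (n - 1))"
  have kn: "k \<le> n" and n0: "0 < n" and l: "n - 1 < n" using k by auto
  have KSU: "?K \<subseteq> SU_set n" using kn by (auto simp: K_set_iff)
  have KU: "A \<in> U_set n" if "A \<in> ?K" for A using KSU that by (auto simp: SU_set_def)
  define pbar where "pbar C = p_map n (SOME A. A \<in> ?K \<and> ?q A = C)" for C
  have pbar: "pbar (?q A) = p_map n A" if A: "A \<in> ?K" for A
  proof -
    define B where "B = (SOME B. B \<in> ?K \<and> ?q B = ?q A)"
    have B: "B \<in> ?K \<and> ?q B = ?q A" unfolding B_def by (rule someI[of _ A]) (use A in simp)
    have "?q A = ?q B \<longleftrightarrow> (\<exists>c. \<forall>i<n. B $$ (i, n - 1) = c * A $$ (i, n - 1))"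
      by (rule coset_eq_iff_last_col[OF KSU n0 K_set_mult[OF kn] K_set_adjoint[OF kn] K_set_one[OF kn] A conjunct1[OF B]])
    from iffD1[OF this sym[OF conjunct2[OF B]]] obtain c where "\<And>i. i < n \<Longrightarrow> B $$ (i, n - 1) = c * A $$ (i, n - 1)" by blast
    then have "p_map n B = p_map n A"
      by (rule p_map_eq_if_proportional[OF KU[OF A] KU[OF conjunct1[OF B]] n0])
    then show ?thesis unfolding pbar_def B_def .
  qed
  have "lcosets\<^bsub>mat_lie_group n ?K\<^esub> (?K \<inter> K_set n (n - 1)) = ?q ` ?K"
    by (auto simp: LCOSETS_def mat_lie_group_def)
  then have "pbar ` (lcosets\<^bsub>mat_lie_group n ?K\<^esub> (?K \<inter> K_set n (n - 1))) = p_map n ` ?K"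
    using pbar by (simp add: image_image)
  also have "\<dots> = X_set n k"
  proof (intro subset_antisym subsetI)
    fix C assume "C \<in> p_map n ` ?K"
    then obtain A where A: "A \<in> ?K" "C = proj_class (col A (n - 1))" by (auto simp: p_map_def)
    note Ac = U_set_carrier[OF KU[OF A(1)]]
    have "A $$ (i, n - 1) = 0" if "i < k" for i
      using A(1) that k unfolding K_set_iff[OF kn] block_diagonal_def by auto
    then have "\<forall>i<k. vec_index (col A (n - 1)) i = 0" using Ac k by auto
    moreover have "col A (n - 1) \<in> carrier_vec n" using Ac by auto
    ultimately show "C \<in> X_set n k"
      unfolding X_set_def using A(2) U_set_col_nonzero[OF KU[OF A(1)] l] by blast
  next
    fix C assume "C \<in> X_set n k"
    then obtain Z where Z: "Z \<in> carrier_vec n" "Z \<noteq> 0\<^sub>v n" "\<forall>i<k. vec_index Z i = 0" "C = proj_class Z"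
      unfolding X_set_def by blast
    obtain A c where A: "A \<in> ?K" "c \<noteq> 0" "col A (n - 1) = c \<cdot>\<^sub>v Z"
      by (rule K_set_ex_last_col[OF Z(1-3) k n]) (rule that)
    have "p_map n A = C" unfolding p_map_def A(3) proj_class_smult[OF A(2)] Z(4) ..
    then show "C \<in> p_map n ` ?K" using A(1) by blast
  qed
  finally show ?thesis using pbar by (intro exI[of _ pbar] conjI ballI) auto
qed

theorem theorem9:
  fixes n k :: nat
  assumes "3 \<le> n" and "1 \<le> k" and "k \<le> n - 2"
  shows "lie_isomorphic
           (mat_lie_group n (K_set n k \<inter> K_set n (n - 1)))
           (mat_lie_group n (S_block [k, n - k - 1, 1])) \<and>
         lie_isomorphic
           (mat_lie_group n (S_block [k, n - k - 1, 1]))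
           (lie_prod (mat_lie_group k (U_set k))
                     (mat_lie_group (n - k - 1) (U_set (n - k - 1)))) \<and>
         poisson_diffeomorphic
           (std_homogeneous n (K_set n k) (K_set n k \<inter> K_set n (n - 1)))
           (std_projective (n - k - 1)) \<and>
         (\<exists>pbar.
           (\<forall>A \<in> K_set n k.
              pbar (A <#\<^bsub>mat_lie_group n (K_set n k)\<^esub> (K_set n k \<inter> K_set n (n - 1))) = p_map n A) \<and>
           pbar ` (lcosets\<^bsub>mat_lie_group n (K_set n k)\<^esub> (K_set n k \<inter> K_set n (n - 1))) = X_set n k)"
proof (intro conjI)
  have n: "k + (n - k - 1) + 1 = n" "k + (n - k - 1) = n - 1" "k + (n - k) = n"
    and k: "k < n" "2 \<le> n" "2 \<le> n - k"
    using assms by auto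
  have S: "K_set n k \<inter> K_set n (n - 1) = S_block [k, n - k - 1, 1]"
    by (rule S_block_three[of k "n - k - 1", unfolded n(1), unfolded n(2), symmetric])
  have "K_set n k \<subseteq> SU_set n" using k by (auto simp: K_set_iff)
  then have c: "S_block [k, n - k - 1, 1] \<subseteq> carrier_mat n n"
    unfolding S[symmetric] using SU_set_carrier by blast
  show "lie_isomorphic (mat_lie_group n (K_set n k \<inter> K_set n (n - 1))) (mat_lie_group n (S_block [k, n - k - 1, 1]))"
    unfolding S by (rule lie_isomorphic_mat_refl[OF c])
  show "lie_isomorphic (mat_lie_group n (S_block [k, n - k - 1, 1]))
      (lie_prod (mat_lie_group k (U_set k)) (mat_lie_group (n - k - 1) (U_set (n - k - 1))))"
    by (rule lie_isomorphic_S_block_three[of k "n - k - 1", unfolded n(1)])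
  \<comment> \<open>Applied with \<open>m = n - k\<close>, which is at least 2 by the upper bound on
    \<open>k\<close>.\<close>
  show "poisson_diffeomorphic (std_homogeneous n (K_set n k) (K_set n k \<inter> K_set n (n - 1)))
      (std_projective (n - k - 1))"
    by (rule K_set_quotient_poisson_diffeomorphic[OF k(3), of k, unfolded n(3)])
  show "\<exists>pbar. (\<forall>A \<in> K_set n k.
        pbar (A <#\<^bsub>mat_lie_group n (K_set n k)\<^esub> (K_set n k \<inter> K_set n (n - 1))) = p_map n A) \<and>
      pbar ` (lcosets\<^bsub>mat_lie_group n (K_set n k)\<^esub> (K_set n k \<inter> K_set n (n - 1))) = X_set n k"
    by (rule K_set_quotient_projects_onto_X_set[OF k(1,2)])
qed

end
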